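(* Identify the map $\mathbb{R}^{2d}\times\mathcal{S}^1\to\mathcal{S}^1$, $(z,S)\mapsto\pi(z)S\pi(z)^*$, with $(\delta_z,S)\mapsto\pi(z)S\pi(z)^*$. Then there exists an extension $(\mu,S)\mapsto\mu\bullet_\rho S$ of this map to $M(\mathbb{R}^{2d})\times\mathcal{S}^1\to\mathcal{S}^1$ which satisfies $$\|\mu\bullet_\rho S\|_{\mathcal{S}^1}\le\|\mu\|_M\|S\|_{\mathcal{S}^1}\quad\text{for all }\mu\in M(\mathbb{R}^{2d}),\ S\in\mathcal{S}^1,$$ and makes $\mathcal{S}^1$ a Banach module over $M(\mathbb{R}^{2d})$. Moreover, this extension is unique among such extensions which turn $\mathcal{S}^1$ into an essential $L^1(\mathbb{R}^{2d})$-module upon embedding $L^1(\mathbb{R}^{2d})$ in $M(\mathbb{R}^{2d})$.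
   Context: For $z=(x,\omega)\in\mathbb{R}^{2d}$, $\pi(z)\psi(t)=e^{2\pi i\omega\cdot t}\psi(t-x)$ on $L^2(\mathbb{R}^d)$. $\mathcal{S}^1$ is the Banach space of trace-class operators on $L^2(\mathbb{R}^d)$. $M(\mathbb{R}^{2d})$ is the Banach algebra of bounded complex measures on $\mathbb{R}^{2d}$ under convolution, with total variation norm $\|\mu\|_M=|\mu|(\mathbb{R}^{2d})$; $L^1(\mathbb{R}^{2d})$ is embedded as the absolutely continuous measures. A Banach space $B$ is a Banach module over a Banach algebra $(A,* )$ if there is a bilinear map $(a,b)\mapsto a\bullet b$ from $A\times B$ to $B$ with $\|a\bullet b\|_B\le\|a\|_A\|b\|_B$ and $a_1\bullet(a_2\bullet b)=(a_1*a_2)\bullet b$; it is essential if the closed linear span of $A\bullet B$ is $B$. *)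

theory Defs
  imports "HOL-Analysis.Analysis"
begin

section \<open>The Hilbert space \<open>L\<^sup>2(\<real>\<^sup>d)\<close>\<close>

definition sq_integrable :: "('a::euclidean_space \<Rightarrow> complex) \<Rightarrow> bool" where
  "sq_integrable f \<longleftrightarrow>
     f \<in> borel_measurable borel \<and> integrable lborel (\<lambda>x. (cmod (f x))\<^sup>2)"

definition L2_rel :: "('a::euclidean_space \<Rightarrow> complex) \<Rightarrow> ('a \<Rightarrow> complex) \<Rightarrow> bool" where
  "L2_rel f g \<longleftrightarrow> sq_integrable f \<and> sq_integrable g \<and> (AE x in lborel. f x = g x)"

lemma sq_integrable_zero: "sq_integrable (\<lambda>_. 0)"
  by (simp add: sq_integrable_def)

lemma sq_integrable_scale:
  assumes "sq_integrable f" shows "sq_integrable (\<lambda>x. c * f x)"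
  using assms by (auto simp: sq_integrable_def norm_mult power_mult_distrib)

lemma sq_integrable_add:
  assumes "sq_integrable f" "sq_integrable g"
  shows "sq_integrable (\<lambda>x. f x + g x)"
proof -
  have [measurable]: "f \<in> borel_measurable borel" "g \<in> borel_measurable borel"
    using assms by (auto simp: sq_integrable_def)
  have bound: "(cmod (f x + g x))\<^sup>2 \<le> 2 * (cmod (f x))\<^sup>2 + 2 * (cmod (g x))\<^sup>2" for x
  proof -
    have "(cmod (f x + g x))\<^sup>2 \<le> (cmod (f x) + cmod (g x))\<^sup>2"
      by (intro power_mono norm_triangle_ineq) auto
    also have "\<dots> \<le> 2 * (cmod (f x))\<^sup>2 + 2 * (cmod (g x))\<^sup>2"
      using sum_squares_bound[of "cmod (f x)" "cmod (g x)"] by (simp add: power2_sum)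
    finally show ?thesis .
  qed
  have "integrable lborel (\<lambda>x. 2 * (cmod (f x))\<^sup>2 + 2 * (cmod (g x))\<^sup>2)"
    using assms by (auto simp: sq_integrable_def)
  then have "integrable lborel (\<lambda>x. (cmod (f x + g x))\<^sup>2)"
    by (rule Bochner_Integration.integrable_bound) (use bound in \<open>auto simp: abs_le_iff\<close>)
  then show ?thesis by (simp add: sq_integrable_def)
qed

lemma sq_integrable_mult_cnj:
  assumes "sq_integrable f" "sq_integrable g"
  shows "integrable lborel (\<lambda>x. f x * cnj (g x))"
proof -
  have [measurable]: "f \<in> borel_measurable borel" "g \<in> borel_measurable borel"
    using assms by (auto simp: sq_integrable_def)
  have [measurable]: "(\<lambda>x. cnj (g x)) \<in> borel_measurable borel"
    by (intro borel_measurable_continuous_on[where f=cnj]) (auto intro: continuous_intros)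
  have bound: "cmod (f x) * cmod (g x) \<le> (cmod (f x))\<^sup>2 + (cmod (g x))\<^sup>2" for x
  proof -
    have "0 \<le> cmod (f x) * cmod (g x)" by simp
    then show ?thesis
      using sum_squares_bound[of "cmod (f x)" "cmod (g x)"] by linarith
  qed
  have "integrable lborel (\<lambda>x. (cmod (f x))\<^sup>2 + (cmod (g x))\<^sup>2)"
    using assms by (auto simp: sq_integrable_def)
  then show ?thesis
    by (rule Bochner_Integration.integrable_bound) (use bound in \<open>auto simp: norm_mult\<close>)
qed

lemma sq_integrable_translate:
  assumes "sq_integrable f" shows "sq_integrable (\<lambda>t. f (t - x))"
proof -
  have [measurable]: "f \<in> borel_measurable borel"
    using assms by (auto simp: sq_integrable_def)
  have "integrable (distr lborel borel ((+) (- x))) (\<lambda>t. (cmod (f t))\<^sup>2)"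
    using assms by (simp add: sq_integrable_def lborel_distr_plus)
  then have "integrable lborel (\<lambda>t. (cmod (f (- x + t)))\<^sup>2)"
    by (subst (asm) integrable_distr_eq) auto
  then show ?thesis by (simp add: sq_integrable_def)
qed

lemma AE_lborel_translate:
  fixes x :: "'a::euclidean_space"
  assumes "AE t in lborel. P t" shows "AE t in lborel. P (t - x)"
proof -
  have "AE t in distr lborel borel ((+) (- x)). P t"
    unfolding lborel_distr_plus by (rule assms)
  then have "AE t in lborel. P (- x + t)"
    by (rule AE_distrD[rotated]) simp
  then show ?thesis by simp
qed

quotient_type 'n L2 = "real^'n \<Rightarrow> complex" / partial: L2_rel
proof (rule part_equivpI)
  show "\<exists>f. L2_rel f f"
    using sq_integrable_zero by (auto simp: L2_rel_def)
  show "symp L2_rel" by (auto simp: symp_def L2_rel_def)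
  show "transp L2_rel" by (auto simp: transp_def L2_rel_def)
qed

text \<open>Inner product, linear in the first argument.\<close>

lift_definition cinner :: "'n::finite L2 \<Rightarrow> 'n L2 \<Rightarrow> complex"
  is "\<lambda>f g. LINT t|lborel. f t * cnj (g t)"
proof -
  fix f f' g g' :: "real^'n \<Rightarrow> complex"
  assume r: "L2_rel f f'" "L2_rel g g'"
  have "integrable lborel (\<lambda>t. f t * cnj (g t))" "integrable lborel (\<lambda>t. f' t * cnj (g' t))"
    using r by (auto simp: L2_rel_def intro: sq_integrable_mult_cnj)
  moreover have "AE t in lborel. f t * cnj (g t) = f' t * cnj (g' t)"
    using r unfolding L2_rel_def by auto
  ultimately show "(LINT t|lborel. f t * cnj (g t)) = (LINT t|lborel. f' t * cnj (g' t))"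
    by (intro integral_cong_AE) auto
qed

lift_definition scaleC :: "complex \<Rightarrow> 'n::finite L2 \<Rightarrow> 'n L2" (infixr \<open>*\<^sub>C\<close> 75)
  is "\<lambda>c f t. c * f t"
  by (auto simp: L2_rel_def intro: sq_integrable_scale)

instantiation L2 :: (finite) real_inner
begin

lift_definition zero_L2 :: "'a L2" is "\<lambda>_. 0"
  by (simp add: L2_rel_def sq_integrable_zero)

lift_definition plus_L2 :: "'a L2 \<Rightarrow> 'a L2 \<Rightarrow> 'a L2" is "\<lambda>f g t. f t + g t"
  by (auto simp: L2_rel_def intro: sq_integrable_add)

definition uminus_L2 :: "'a L2 \<Rightarrow> 'a L2" where "- (f :: 'a L2) = (-1) *\<^sub>C f"
definition minus_L2 :: "'a L2 \<Rightarrow> 'a L2 \<Rightarrow> 'a L2" where "(f :: 'a L2) - g = f + (-1) *\<^sub>C g"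
definition scaleR_L2 :: "real \<Rightarrow> 'a L2 \<Rightarrow> 'a L2" where "r *\<^sub>R (f :: 'a L2) = complex_of_real r *\<^sub>C f"
definition inner_L2 :: "'a L2 \<Rightarrow> 'a L2 \<Rightarrow> real" where "inner (f :: 'a L2) g = Re (cinner f g)"
definition norm_L2 :: "'a L2 \<Rightarrow> real" where "norm (f :: 'a L2) = sqrt (inner f f)"
definition dist_L2 :: "'a L2 \<Rightarrow> 'a L2 \<Rightarrow> real" where "dist (f :: 'a L2) g = norm (f - g)"
definition sgn_L2 :: "'a L2 \<Rightarrow> 'a L2" where "sgn (f :: 'a L2) = inverse (norm f) *\<^sub>R f"
definition uniformity_L2 :: "('a L2 \<times> 'a L2) filter" where
  "uniformity = (INF e\<in>{0<..}. principal {(f :: 'a L2, g). dist f g < e})"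
definition open_L2 :: "'a L2 set \<Rightarrow> bool" where
  "open (U :: 'a L2 set) \<longleftrightarrow> (\<forall>f\<in>U. \<forall>\<^sub>F (f', g) in uniformity. f' = f \<longrightarrow> g \<in> U)"

instance
proof
  fix f g h :: "'a L2" and r s :: real
  show "f + g + h = f + (g + h)"
    by transfer (auto simp: L2_rel_def add.assoc intro!: sq_integrable_add)
  show "f + g = g + f"
    by transfer (auto simp: L2_rel_def add.commute intro!: sq_integrable_add)
  show "0 + f = f"
    by transfer (auto simp: L2_rel_def)
  show "- f + f = 0" unfolding uminus_L2_def
    by transfer (auto simp: L2_rel_def sq_integrable_zero)
  show "f - g = f + - g" by (simp add: minus_L2_def uminus_L2_def)
  show "r *\<^sub>R (f + g) = r *\<^sub>R f + r *\<^sub>R g" unfolding scaleR_L2_def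
    by transfer (auto simp: L2_rel_def distrib_left intro!: sq_integrable_add sq_integrable_scale)
  show "(r + s) *\<^sub>R f = r *\<^sub>R f + s *\<^sub>R f" unfolding scaleR_L2_def
    by transfer (auto simp: L2_rel_def distrib_right intro!: sq_integrable_add sq_integrable_scale)
  show "r *\<^sub>R s *\<^sub>R f = (r * s) *\<^sub>R f" unfolding scaleR_L2_def
    by transfer (auto simp: L2_rel_def mult.assoc intro!: sq_integrable_scale)
  show "1 *\<^sub>R f = f" unfolding scaleR_L2_def
    by transfer (auto simp: L2_rel_def)
  show "dist f g = norm (f - g)" by (rule dist_L2_def)
  show "sgn f = inverse (norm f) *\<^sub>R f" by (rule sgn_L2_def)
  show "uniformity = (INF e\<in>{0<..}. principal {(f, g :: 'a L2). dist f g < e})"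
    by (rule uniformity_L2_def)
  show "open U \<longleftrightarrow> (\<forall>f\<in>U. \<forall>\<^sub>F (f', g) in uniformity. f' = f \<longrightarrow> g \<in> U)" for U :: "'a L2 set"
    by (rule open_L2_def)
  show "norm f = sqrt (inner f f)" by (rule norm_L2_def)
  show "inner f g = inner g f" unfolding inner_L2_def
  proof transfer
    fix f g :: "real^'a \<Rightarrow> complex"
    assume "L2_rel f f" "L2_rel g g"
    have "(LINT t|lborel. f t * cnj (g t)) = (LINT t|lborel. cnj (g t * cnj (f t)))"
      by (simp add: mult.commute)
    also have "\<dots> = cnj (LINT t|lborel. g t * cnj (f t))"
      by (rule Bochner_Integration.integral_cnj)
    finally show "Re (LINT t|lborel. f t * cnj (g t)) = Re (LINT t|lborel. g t * cnj (f t))"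
      by simp
  qed
  show "inner (f + g) h = inner f h + inner g h" unfolding inner_L2_def
    by transfer
      (auto simp: L2_rel_def distrib_right Bochner_Integration.integral_add sq_integrable_mult_cnj)
  show "inner (r *\<^sub>R f) g = r * inner f g" unfolding inner_L2_def scaleR_L2_def
    by transfer (simp add: mult.assoc)
  have self: "(LINT t|lborel. u t * cnj (u t)) = complex_of_real (LINT t|lborel. (cmod (u t))\<^sup>2)"
    for u :: "real^'a \<Rightarrow> complex"
    by (simp add: complex_norm_square [symmetric] flip: integral_complex_of_real)
  show "0 \<le> inner f f" unfolding inner_L2_def
    by transfer (simp add: self)
  show "inner f f = 0 \<longleftrightarrow> f = 0" unfolding inner_L2_def
  proof transfer
    fix u :: "real^'a \<Rightarrow> complex"
    assume "L2_rel u u"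
    then have u: "sq_integrable u" by (simp add: L2_rel_def)
    have "Re (LINT t|lborel. u t * cnj (u t)) = 0 \<longleftrightarrow> (LINT t|lborel. (cmod (u t))\<^sup>2) = 0"
      by (simp add: self)
    also have "\<dots> \<longleftrightarrow> (AE t in lborel. (cmod (u t))\<^sup>2 = 0)"
      using u by (intro integral_nonneg_eq_0_iff_AE) (auto simp: sq_integrable_def)
    also have "\<dots> \<longleftrightarrow> L2_rel u (\<lambda>_. 0)"
      using u by (auto simp: L2_rel_def sq_integrable_zero)
    finally show "Re (LINT t|lborel. u t * cnj (u t)) = 0 \<longleftrightarrow> L2_rel u (\<lambda>_. 0)" .
  qed
qed

end


section \<open>Trace-class operators and time-frequency shifts\<close>

type_synonym 'n op = "'n L2 \<Rightarrow> 'n L2"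

definition bounded_clinear :: "('n::finite) op \<Rightarrow> bool" where
  "bounded_clinear T \<longleftrightarrow> bounded_linear T \<and> (\<forall>c f. T (c *\<^sub>C f) = c *\<^sub>C T f)"

definition adj :: "('n::finite) op \<Rightarrow> 'n op" where
  "adj T = (THE T'. \<forall>f g. cinner (T f) g = cinner f (T' g))"

definition positive_op :: "('n::finite) op \<Rightarrow> bool" where
  "positive_op P \<longleftrightarrow> bounded_clinear P \<and> (\<forall>f. cinner (P f) f \<in> \<real> \<and> 0 \<le> Re (cinner (P f) f))"

text \<open>\<open>|T| = (T\<^sup>* T)\<^bsup>1/2\<^esup>\<close>, the unique positive square root.\<close>

definition abs_op :: "('n::finite) op \<Rightarrow> 'n op" where
  "abs_op T = (THE P. positive_op P \<and> P \<circ> P = adj T \<circ> T)"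

text \<open>Orthonormal bases, as maximal orthonormal sets.\<close>

definition is_onb :: "('n::finite) L2 set \<Rightarrow> bool" where
  "is_onb E \<longleftrightarrow> (\<forall>e\<in>E. \<forall>e'\<in>E. cinner e e' = (if e = e' then 1 else 0)) \<and>
     (\<forall>f. (\<forall>e\<in>E. cinner f e = 0) \<longrightarrow> f = 0)"

definition trace_class :: "('n::finite) op \<Rightarrow> bool" where
  "trace_class T \<longleftrightarrow> bounded_clinear T \<and>
     (\<exists>E. is_onb E \<and> (\<lambda>e. Re (cinner (abs_op T e) e)) summable_on E)"

text \<open>The sum does not depend on the orthonormal basis, so an arbitrary one is chosen.\<close>

definition trace_norm :: "('n::finite) op \<Rightarrow> real" where
  "trace_norm T = (\<Sum>\<^sub>\<infinity>e\<in>(SOME E. is_onb E). Re (cinner (abs_op T e) e))"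

lift_definition tf_shift :: "(real^'n) \<times> (real^'n) \<Rightarrow> 'n::finite op"
  is "\<lambda>(x, \<omega>) \<psi> t. exp (2 * complex_of_real pi * \<i> * complex_of_real (\<omega> \<bullet> t)) * \<psi> (t - x)"
proof -
  fix z :: "(real^'n) \<times> (real^'n)" and f g :: "real^'n \<Rightarrow> complex"
  assume r: "L2_rel f g"
  obtain x \<omega> where z: "z = (x, \<omega>)" by force
  have mod: "sq_integrable
      (\<lambda>t. exp (2 * complex_of_real pi * \<i> * complex_of_real (\<omega> \<bullet> t)) * h (t - x))"
    if "sq_integrable h" for h :: "real^'n \<Rightarrow> complex"
  proof -
    have sq: "sq_integrable (\<lambda>t. h (t - x))"
      using that by (rule sq_integrable_translate)
    have [measurable]: "(\<lambda>t. h (t - x)) \<in> borel_measurable borel"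
      using sq by (simp add: sq_integrable_def)
    have [measurable]:
      "(\<lambda>t. exp (2 * complex_of_real pi * \<i> * complex_of_real (\<omega> \<bullet> t))) \<in> borel_measurable borel"
      by (intro borel_measurable_continuous_onI continuous_intros)
    show ?thesis using sq by (simp add: sq_integrable_def norm_mult)
  qed
  have "AE t in lborel. f (t - x) = g (t - x)"
    using r by (intro AE_lborel_translate) (auto simp: L2_rel_def)
  then show "L2_rel
      ((case z of (x, \<omega>) \<Rightarrow> \<lambda>\<psi> t.
         exp (2 * complex_of_real pi * \<i> * complex_of_real (\<omega> \<bullet> t)) * \<psi> (t - x)) f)
      ((case z of (x, \<omega>) \<Rightarrow> \<lambda>\<psi> t.
         exp (2 * complex_of_real pi * \<i> * complex_of_real (\<omega> \<bullet> t)) * \<psi> (t - x)) g)"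
    using r mod by (auto simp: z L2_rel_def)
qed


section \<open>Bounded complex measures\<close>

text \<open>Set functions are total in HOL; requiring \<open>\<mu> B = 0\<close> for non-Borel \<open>B\<close> makes equality of set
  functions coincide with equality of measures.\<close>

type_synonym 'a cmeas = "'a set \<Rightarrow> complex"

definition variation :: "'a::euclidean_space cmeas \<Rightarrow> 'a set \<Rightarrow> ennreal" where
  "variation \<mu> B = (SUP A \<in> {A :: nat \<Rightarrow> 'a set. range A \<subseteq> sets borel \<and> disjoint_family A \<and>
     (\<Union>n. A n) = B}. \<Sum>n. ennreal (cmod (\<mu> (A n))))"

definition bounded_cmeas :: "'a::euclidean_space cmeas \<Rightarrow> bool" where
  "bounded_cmeas \<mu> \<longleftrightarrow>
     (\<forall>A :: nat \<Rightarrow> 'a set. range A \<subseteq> sets borel \<longrightarrow> disjoint_family A \<longrightarrow>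
        (\<lambda>n. \<mu> (A n)) sums \<mu> (\<Union>n. A n)) \<and>
     (\<forall>B. B \<notin> sets borel \<longrightarrow> \<mu> B = 0) \<and>
     variation \<mu> UNIV < \<infinity>"

definition tv_norm :: "'a::euclidean_space cmeas \<Rightarrow> real" where
  "tv_norm \<mu> = enn2real (variation \<mu> UNIV)"

text \<open>Positive part \<open>u\<^sup>+(B) = sup {u(A) | A \<subseteq> B}\<close> of the Jordan decomposition of a finite real
  measure \<open>u\<close>; the negative part is \<open>(-u)\<^sup>+\<close>.\<close>

definition pos_part :: "('a::euclidean_space set \<Rightarrow> real) \<Rightarrow> 'a measure" where
  "pos_part u = measure_of UNIV (sets borel)
     (\<lambda>B. SUP A \<in> {A \<in> sets borel. A \<subseteq> B}. ennreal (u A))"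

definition cm_integral :: "'a::euclidean_space cmeas \<Rightarrow> ('a \<Rightarrow> complex) \<Rightarrow> complex" where
  "cm_integral \<mu> f =
     ((LINT x|pos_part (\<lambda>A. Re (\<mu> A)). f x) - (LINT x|pos_part (\<lambda>A. - Re (\<mu> A)). f x)) +
     \<i> * ((LINT x|pos_part (\<lambda>A. Im (\<mu> A)). f x) - (LINT x|pos_part (\<lambda>A. - Im (\<mu> A)). f x))"

definition cm_conv :: "'a::euclidean_space cmeas \<Rightarrow> 'a cmeas \<Rightarrow> 'a cmeas" where
  "cm_conv \<mu> \<nu> B = (if B \<in> sets borel
     then cm_integral \<mu> (\<lambda>x. cm_integral \<nu> (\<lambda>y. indicator B (x + y))) else 0)"

definition dirac :: "'a::euclidean_space \<Rightarrow> 'a cmeas" where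
  "dirac z B = (if B \<in> sets borel then indicator B z else 0)"

definition density_cmeas :: "('a::euclidean_space \<Rightarrow> complex) \<Rightarrow> 'a cmeas" where
  "density_cmeas f B = (if B \<in> sets borel then LINT z:B|lborel. f z else 0)"


section \<open>Banach modules\<close>

record 'a cnormed =
  car :: "'a set"
  vzero :: 'a
  vadd :: "'a \<Rightarrow> 'a \<Rightarrow> 'a"
  vscale :: "complex \<Rightarrow> 'a \<Rightarrow> 'a"
  vnorm :: "'a \<Rightarrow> real"

record 'a cnormed_alg = "'a cnormed" +
  amult :: "'a \<Rightarrow> 'a \<Rightarrow> 'a"

definition vdist :: "('a, 'm) cnormed_scheme \<Rightarrow> 'a \<Rightarrow> 'a \<Rightarrow> real" where
  "vdist V x y = vnorm V (vadd V x (vscale V (-1) y))"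

definition vlim :: "('a, 'm) cnormed_scheme \<Rightarrow> (nat \<Rightarrow> 'a) \<Rightarrow> 'a \<Rightarrow> bool" where
  "vlim V X l \<longleftrightarrow> (\<lambda>n. vdist V (X n) l) \<longlonglongrightarrow> 0"

definition vcauchy :: "('a, 'm) cnormed_scheme \<Rightarrow> (nat \<Rightarrow> 'a) \<Rightarrow> bool" where
  "vcauchy V X \<longleftrightarrow> (\<forall>e>0. \<exists>N. \<forall>m\<ge>N. \<forall>n\<ge>N. vdist V (X m) (X n) < e)"

locale cbanach_space =
  fixes V :: "('a, 'm) cnormed_scheme"
  assumes zero_closed: "vzero V \<in> car V"
    and add_closed: "\<lbrakk>x \<in> car V; y \<in> car V\<rbrakk> \<Longrightarrow> vadd V x y \<in> car V"
    and scale_closed: "x \<in> car V \<Longrightarrow> vscale V c x \<in> car V"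
    and add_assoc: "\<lbrakk>x \<in> car V; y \<in> car V; w \<in> car V\<rbrakk> \<Longrightarrow>
      vadd V (vadd V x y) w = vadd V x (vadd V y w)"
    and add_commute: "\<lbrakk>x \<in> car V; y \<in> car V\<rbrakk> \<Longrightarrow> vadd V x y = vadd V y x"
    and add_zero: "x \<in> car V \<Longrightarrow> vadd V x (vzero V) = x"
    and add_inverse: "x \<in> car V \<Longrightarrow> vadd V x (vscale V (-1) x) = vzero V"
    and scale_one: "x \<in> car V \<Longrightarrow> vscale V 1 x = x"
    and scale_scale: "x \<in> car V \<Longrightarrow> vscale V c (vscale V c' x) = vscale V (c * c') x"
    and scale_add_left: "x \<in> car V \<Longrightarrow>
      vscale V (c + c') x = vadd V (vscale V c x) (vscale V c' x)"
    and scale_add_right: "\<lbrakk>x \<in> car V; y \<in> car V\<rbrakk> \<Longrightarrow>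
      vscale V c (vadd V x y) = vadd V (vscale V c x) (vscale V c y)"
    and norm_zero_iff: "x \<in> car V \<Longrightarrow> vnorm V x = 0 \<longleftrightarrow> x = vzero V"
    and norm_scale: "x \<in> car V \<Longrightarrow> vnorm V (vscale V c x) = cmod c * vnorm V x"
    and norm_triangle: "\<lbrakk>x \<in> car V; y \<in> car V\<rbrakk> \<Longrightarrow>
      vnorm V (vadd V x y) \<le> vnorm V x + vnorm V y"
    and complete: "\<lbrakk>range X \<subseteq> car V; vcauchy V X\<rbrakk> \<Longrightarrow> \<exists>l\<in>car V. vlim V X l"

definition bilinear_on :: "('a, 'l) cnormed_scheme \<Rightarrow> ('b, 'm) cnormed_scheme \<Rightarrow>
    ('c, 'n) cnormed_scheme \<Rightarrow> ('a \<Rightarrow> 'b \<Rightarrow> 'c) \<Rightarrow> bool" where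
  "bilinear_on A B C h \<longleftrightarrow>
     (\<forall>a\<in>car A. \<forall>b\<in>car B. h a b \<in> car C) \<and>
     (\<forall>a\<in>car A. \<forall>a'\<in>car A. \<forall>b\<in>car B. h (vadd A a a') b = vadd C (h a b) (h a' b)) \<and>
     (\<forall>a\<in>car A. \<forall>b\<in>car B. \<forall>b'\<in>car B. h a (vadd B b b') = vadd C (h a b) (h a b')) \<and>
     (\<forall>c. \<forall>a\<in>car A. \<forall>b\<in>car B. h (vscale A c a) b = vscale C c (h a b)) \<and>
     (\<forall>c. \<forall>a\<in>car A. \<forall>b\<in>car B. h a (vscale B c b) = vscale C c (h a b))"

locale cbanach_algebra = cbanach_space A for A :: "('a, 'm) cnormed_alg_scheme" +
  assumes mult_bilinear: "bilinear_on A A A (amult A)"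
    and mult_assoc: "\<lbrakk>a \<in> car A; b \<in> car A; c \<in> car A\<rbrakk> \<Longrightarrow>
      amult A (amult A a b) c = amult A a (amult A b c)"
    and norm_mult: "\<lbrakk>a \<in> car A; b \<in> car A\<rbrakk> \<Longrightarrow> vnorm A (amult A a b) \<le> vnorm A a * vnorm A b"

locale cbanach_module = A: cbanach_algebra A + B: cbanach_space B
  for A :: "('a, 'm) cnormed_alg_scheme" and B :: "('b, 'n) cnormed_scheme" +
  fixes act :: "'a \<Rightarrow> 'b \<Rightarrow> 'b"
  assumes act_bilinear: "bilinear_on A B B act"
    and norm_act: "\<lbrakk>a \<in> car A; b \<in> car B\<rbrakk> \<Longrightarrow> vnorm B (act a b) \<le> vnorm A a * vnorm B b"
    and act_act: "\<lbrakk>a \<in> car A; a' \<in> car A; b \<in> car B\<rbrakk> \<Longrightarrow> act a (act a' b) = act (amult A a a') b"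

definition closed_subspace :: "('a, 'm) cnormed_scheme \<Rightarrow> 'a set \<Rightarrow> bool" where
  "closed_subspace V W \<longleftrightarrow> W \<subseteq> car V \<and> vzero V \<in> W \<and>
     (\<forall>x\<in>W. \<forall>y\<in>W. vadd V x y \<in> W) \<and> (\<forall>c. \<forall>x\<in>W. vscale V c x \<in> W) \<and>
     (\<forall>X. \<forall>l\<in>car V. range X \<subseteq> W \<longrightarrow> vlim V X l \<longrightarrow> l \<in> W)"

definition closed_span :: "('a, 'm) cnormed_scheme \<Rightarrow> 'a set \<Rightarrow> 'a set" where
  "closed_span V S = closed_subspace V hull S"

locale essential_cbanach_module = cbanach_module +
  assumes essential: "closed_span B {act a b | a b. a \<in> car A \<and> b \<in> car B} = car B"


section \<open>The spaces \<open>S\<^sup>1\<close>, \<open>M\<close> and \<open>L\<^sup>1\<close>\<close>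

definition S1_space :: "('n::finite) op cnormed" where
  "S1_space = \<lparr>car = {T. trace_class T}, vzero = (\<lambda>_. 0), vadd = (\<lambda>S T f. S f + T f),
         vscale = (\<lambda>c T f. c *\<^sub>C T f), vnorm = trace_norm\<rparr>"

definition M_algebra :: "('a::euclidean_space) cmeas cnormed_alg" where
  "M_algebra = \<lparr>car = {\<mu>. bounded_cmeas \<mu>}, vzero = (\<lambda>_. 0), vadd = (\<lambda>\<mu> \<nu> B. \<mu> B + \<nu> B),
        vscale = (\<lambda>c \<mu> B. c * \<mu> B), vnorm = tv_norm, amult = cm_conv\<rparr>"

text \<open>\<open>f \<in> L\<^sup>1\<close> is identified with the measure \<open>f dz\<close>; the total variation norm restricts to the
  \<open>L\<^sup>1\<close> norm and convolution of measures to convolution of functions.\<close>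

definition L1_algebra :: "('a::euclidean_space) cmeas cnormed_alg" where
  "L1_algebra = M_algebra\<lparr>car := density_cmeas ` {f. integrable lborel f}\<rparr>"

definition shift_module_extension ::
    "(((real^'n) \<times> (real^'n)) cmeas \<Rightarrow> ('n::finite) op \<Rightarrow> 'n op) \<Rightarrow> bool" where
  "shift_module_extension act \<longleftrightarrow>
     (\<forall>z. \<forall>S\<in>car S1_space. act (dirac z) S = tf_shift z \<circ> S \<circ> adj (tf_shift z)) \<and>
     (\<forall>\<mu>\<in>car M_algebra. \<forall>S\<in>car S1_space.
        vnorm S1_space (act \<mu> S) \<le> vnorm M_algebra \<mu> * vnorm S1_space S) \<and>
     cbanach_module M_algebra S1_space act"

end

theory Submission
  imports Defs
begin

text \<open>The action is defined weakly: \<open>\<mu> \<bullet> S\<close> is the operator with matrix coefficients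
  \<open>\<langle>(\<mu> \<bullet> S) u, v\<rangle> = \<integral> \<langle>\<pi>(z) S \<pi>(z)\<^sup>* u, v\<rangle> d\<mu>(z)\<close>. The trace norm is the supremum of
  \<open>|\<Sum>\<^bsub>e\<in>F\<^esub> \<langle>V T e, e\<rangle>|\<close> over contractions \<open>V\<close> and finite orthonormal \<open>F\<close>, so that trace norm estimates for
  \<open>\<mu> \<bullet> S\<close> reduce to estimates for scalar integrals. Essentiality follows from an approximate identity acting
  on rank one operators, which span a dense subspace.

  For uniqueness, let \<open>\<mu>\<close> be a measure, \<open>g \<in> L\<^sup>1\<close> and \<open>T = g \<bullet>' S\<close> for a competing action \<open>\<bullet>'\<close>. Translation is
  continuous on \<open>L\<^sup>1\<close>, so there are finite combinations \<open>d\<close> of point masses with \<open>d * g \<approx> \<mu> * g\<close> in total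
  variation and simultaneously \<open>d \<bullet> T \<approx> \<mu> \<bullet> T\<close> weakly. Hence
  \<open>\<mu> \<bullet>' T = (\<mu> * g) \<bullet>' S \<approx> (d * g) \<bullet>' S = d \<bullet>' T = d \<bullet> T \<approx> \<mu> \<bullet> T\<close>, and such \<open>T\<close> span a dense
  subspace.\<close>

section \<open>Completeness of \<open>L\<^sup>2\<close>\<close>

text \<open>Two obstacles shape the development. A total variation limit of discrete measures is
  again discrete, so the prescribed values at \<open>dirac z\<close> say nothing directly about
  other measures. Only after convolution with an integrable function does discrete approximation
  hold in norm, and this is where essentiality over \<open>L1_algebra\<close> enters. Moreover,
  integrals against a complex measure are given through four Jordan parts, which yield the bound by
  total variation times supremum only up to a constant, whereas the module inequality has constant
  one. The sharp bound therefore goes through step functions on partitions, and one partition lemma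
  serves both this bound and the discretisation in the uniqueness proof. From then on measures are
  handled as functionals on bounded Borel functions. On the operator side, \<open>trace_norm\<close>
  is given through \<open>abs_op\<close>, which hides its triangle inequality; square roots and a
  substitute for the polar decomposition lead from there to the dual description.\<close>

lemma sq_integrable_rep [simp]: "sq_integrable (rep_L2 f)"
  using Quotient3_L2 unfolding Quotient3_def L2_rel_def by blast

lemma borel_measurable_rep [measurable]: "rep_L2 f \<in> borel_measurable borel"
  using sq_integrable_rep[of f] by (simp add: sq_integrable_def)

lemma ex_rep_AE:
  assumes "sq_integrable u"
  obtains f where "AE t in lborel. rep_L2 f t = u t"
proof -
  have "L2_rel (rep_L2 (abs_L2 u)) u"
    using Quotient3_rep_abs[OF Quotient3_L2, of u] assms by (simp add: L2_rel_def)
  then show thesis using that by (auto simp: L2_rel_def)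
qed

lemma cinner_rep: "cinner f g = (LINT t|lborel. rep_L2 f t * cnj (rep_L2 g t))"
  by (fact cinner.rep_eq)

lemma eq_L2_iff_AE: "f = g \<longleftrightarrow> (AE t in lborel. rep_L2 f t = rep_L2 g t)"
  using Quotient3_rel_rep[OF Quotient3_L2, of f g] by (auto simp: L2_rel_def)

lemma rep_add_AE: "AE t in lborel. rep_L2 (f + g) t = rep_L2 f t + rep_L2 g t"
  using Quotient3_rep_abs[OF Quotient3_L2, of "\<lambda>t. rep_L2 f t + rep_L2 g t"]
  by (auto simp: L2_rel_def plus_L2_def sq_integrable_add)

lemma rep_scaleC_AE: "AE t in lborel. rep_L2 (c *\<^sub>C f) t = c * rep_L2 f t"
  using Quotient3_rep_abs[OF Quotient3_L2, of "\<lambda>t. c * rep_L2 f t"]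
  by (auto simp: L2_rel_def scaleC_def sq_integrable_scale)

lemma rep_diff_AE: "AE t in lborel. rep_L2 (f - g) t = rep_L2 f t - rep_L2 g t"
  using rep_add_AE[of f "(-1) *\<^sub>C g"] rep_scaleC_AE[of "-1" g]
  unfolding minus_L2_def by eventually_elim simp

lemma norm_L2_nn_integral:
  "ennreal ((norm f)\<^sup>2) = (\<integral>\<^sup>+ t. ennreal ((cmod (rep_L2 f t))\<^sup>2) \<partial>lborel)"
proof -
  have "(norm f)\<^sup>2 = Re (cinner f f)"
    by (metis dot_square_norm inner_L2_def)
  also have "\<dots> = (LINT t|lborel. (cmod (rep_L2 f t))\<^sup>2)"
    by (simp add: cinner_rep complex_norm_square [symmetric] flip: of_real_power)
  finally show ?thesis
    using sq_integrable_rep[of f]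
    by (simp add: nn_integral_eq_integral sq_integrable_def)
qed

text \<open>Riesz--Fischer. Along a fast subsequence the weighted sum \<open>\<Sum>k. 4\<^sup>k |u\<^sub>k\<^sub>+\<^sub>1 - u\<^sub>k|\<^sup>2\<close> is integrable,
  which forces pointwise convergence without Minkowski's inequality.\<close>

instance L2 :: (finite) complete_space
proof
  fix X :: "nat \<Rightarrow> 'a L2"
  assume X: "Cauchy X"
  have "\<exists>r. strict_mono (r :: nat \<Rightarrow> nat) \<and> (\<forall>k. norm (X (r (Suc k)) - X (r k)) < (1/4)^k)"
  proof -
    have "\<exists>N. \<forall>m\<ge>N. \<forall>n\<ge>N. norm (X m - X n) < (1/4)^k" for k
      using X by (auto simp: Cauchy_def dist_norm)
    then obtain N where N: "\<And>k m n. m \<ge> N k \<Longrightarrow> n \<ge> N k \<Longrightarrow> norm (X m - X n) < (1/4)^k"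
      by metis
    \<comment> \<open>The sum forces \<open>r k \<ge> N k\<close>, the summand \<open>k\<close>
      forces strict growth.\<close>
    define r where "r k = (\<Sum>i\<le>k. N i) + k" for k
    have "strict_mono r" by (auto simp: strict_mono_Suc_iff r_def)
    moreover have "r k \<ge> N k" for k
      unfolding r_def by (intro trans_le_add1 member_le_sum) auto
    moreover from this have "r (Suc k) \<ge> N k" for k
      using \<open>strict_mono r\<close> by (metis le_trans less_imp_le lessI strict_monoD)
    ultimately show ?thesis using N by metis
  qed
  then obtain r where r: "strict_mono (r :: nat \<Rightarrow> nat)"
    and rX: "\<And>k. norm (X (r (Suc k)) - X (r k)) < (1/4)^k" by blast
  define u where "u k = rep_L2 (X (r k))" for k
  have u[measurable]: "u k \<in> borel_measurable borel" for k by (simp add: u_def)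
  have nu: "(\<integral>\<^sup>+ t. ennreal ((cmod (u j t - u k t))\<^sup>2) \<partial>lborel) = ennreal ((norm (X (r j) - X (r k)))\<^sup>2)"
    for j k
    unfolding norm_L2_nn_integral u_def
    by (rule nn_integral_cong_AE) (use rep_diff_AE[of "X (r j)" "X (r k)"] in eventually_elim, simp)
  have em: "ennreal (4^k) * ennreal x = ennreal (4^k * x)" if "0 \<le> x" for k x
    by (rule ennreal_mult[symmetric]) (use that in auto)
  have "AE t in lborel. convergent (\<lambda>k. u k t)"
  proof -
    have "(\<integral>\<^sup>+ t. (\<Sum>k. ennreal (4^k) * ennreal ((cmod (u (Suc k) t - u k t))\<^sup>2)) \<partial>lborel)
        = (\<Sum>k. ennreal (4^k) * ennreal ((norm (X (r (Suc k)) - X (r k)))\<^sup>2))"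
      by (subst nn_integral_suminf) (auto simp: nn_integral_cmult nu)
    \<comment> \<open>The squared increments are at most 16^(-k), so the weight 4^k still leaves a
      geometric series.\<close>
    also have "\<dots> \<le> (\<Sum>k. ennreal ((1/4)^k))"
    proof (intro suminf_le allI summableI)
      fix k
      have "(norm (X (r (Suc k)) - X (r k)))\<^sup>2 \<le> ((1/4)^k)\<^sup>2"
        using rX[of k] by (intro power_mono) auto
      then have "4^k * (norm (X (r (Suc k)) - X (r k)))\<^sup>2 \<le> 4^k * ((1/4)^k)\<^sup>2"
        by (intro mult_left_mono) auto
      also have "\<dots> = (1/4)^k" by (simp add: power2_eq_square power_one_over inverse_eq_divide)
      finally show "ennreal (4^k) * ennreal ((norm (X (r (Suc k)) - X (r k)))\<^sup>2) \<le> ennreal ((1/4)^k)"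
        unfolding em[OF zero_le_power2] by (rule ennreal_leI)
    qed
    also have "\<dots> < \<infinity>"
      by (subst suminf_ennreal2) (auto intro!: summable_geometric)
    finally have "AE t in lborel. (\<Sum>k. ennreal (4^k) * ennreal ((cmod (u (Suc k) t - u k t))\<^sup>2)) \<noteq> \<infinity>"
      by (intro nn_integral_noteq_infinite) auto
    then show ?thesis
    proof eventually_elim
      case (elim t)
      define a where "a k = cmod (u (Suc k) t - u k t)" for k
      have "summable (\<lambda>k. 4^k * (a k)\<^sup>2)"
      proof (rule summable_suminf_not_top)
        show "(\<Sum>k. ennreal (4^k * (a k)\<^sup>2)) \<noteq> top"
          using elim unfolding a_def em[OF zero_le_power2] by simp
      qed (simp add: a_def)
      \<comment> \<open>Weighted terms below 1 mean increments of at most 2^(-k): weighted square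
        summability has become absolute summability.\<close>
      then have "(\<lambda>k. 4^k * (a k)\<^sup>2) \<longlonglongrightarrow> 0" by (rule summable_LIMSEQ_zero)
      then have "eventually (\<lambda>k. 4^k * (a k)\<^sup>2 < 1) sequentially"
        by (rule order_tendstoD) simp
      then obtain K where K: "\<And>k. k \<ge> K \<Longrightarrow> 4^k * (a k)\<^sup>2 < 1"
        by (auto simp: eventually_sequentially)
      have sq4: "((2::real)^k)\<^sup>2 = 4^k" for k :: nat
        by (simp add: power2_eq_square flip: power_mult_distrib)
      have "summable a"
      proof (rule summable_comparison_test)
        show "\<exists>N. \<forall>n\<ge>N. norm (a n) \<le> (1/2)^n"
        proof (intro exI allI impI)
          fix k assume "k \<ge> K"
          then have "(2^k * a k)\<^sup>2 < 1\<^sup>2"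
            using K[of k] unfolding power_mult_distrib sq4 by simp
          then have "2^k * a k < 1" by (rule power2_less_imp_less) simp
          then have "a k \<le> 1 / 2^k" by (simp add: pos_le_divide_eq mult.commute)
          then show "norm (a k) \<le> (1/2)^k"
            by (simp add: a_def power_one_over inverse_eq_divide)
        qed
      qed (auto intro: summable_geometric)
      then have "summable (\<lambda>k. u (Suc k) t - u k t)"
        by (rule summable_norm_cancel[OF back_subst[of summable]]) (simp add: a_def[abs_def])
      then have "convergent (\<lambda>n. \<Sum>k<n. u (Suc k) t - u k t)"
        by (simp add: summable_iff_convergent)
      then obtain l where "(\<lambda>n. \<Sum>k<n. u (Suc k) t - u k t) \<longlonglongrightarrow> l"
        by (auto simp: convergent_def)
      then have "(\<lambda>n. u n t - u 0 t) \<longlonglongrightarrow> l"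
        unfolding sum_lessThan_telescope[of "\<lambda>k. u k t"] .
      from tendsto_add[OF this tendsto_const[of "u 0 t"]]
      have "(\<lambda>n. u n t) \<longlonglongrightarrow> l + u 0 t" unfolding diff_add_cancel .
      then show "convergent (\<lambda>k. u k t)" unfolding convergent_def by blast
    qed
  qed
  then have lim: "AE t in lborel. (\<lambda>k. u k t) \<longlonglongrightarrow> lim (\<lambda>k. u k t)"
    by eventually_elim (simp add: convergent_LIMSEQ_iff)
  define v where "v t = lim (\<lambda>k. u k t)" for t
  have [measurable]: "v \<in> borel_measurable borel"
    unfolding v_def by (rule borel_measurable_lim_metric) simp
  \<comment> \<open>With k fixed and j tending to infinity, Fatou's lemma carries the Cauchy
    estimate over to the pointwise limit. Both square integrability of \<open>v\<close> and norm
    convergence come from it.\<close>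
  have fatou: "(\<integral>\<^sup>+ t. ennreal ((cmod (v t - u k t))\<^sup>2) \<partial>lborel)
      \<le> liminf (\<lambda>j. ennreal ((norm (X (r j) - X (r k)))\<^sup>2))" for k
  proof -
    have "(\<integral>\<^sup>+ t. ennreal ((cmod (v t - u k t))\<^sup>2) \<partial>lborel)
        = (\<integral>\<^sup>+ t. liminf (\<lambda>j. ennreal ((cmod (u j t - u k t))\<^sup>2)) \<partial>lborel)"
    proof (rule nn_integral_cong_AE, use lim in eventually_elim)
      case (elim t)
      then have "(\<lambda>j. ennreal ((cmod (u j t - u k t))\<^sup>2)) \<longlonglongrightarrow> ennreal ((cmod (v t - u k t))\<^sup>2)"
        unfolding v_def by (intro tendsto_intros)
      then show ?case
        by (intro lim_imp_Liminf[symmetric]) auto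
    qed
    also have "\<dots> \<le> liminf (\<lambda>j. \<integral>\<^sup>+ t. ennreal ((cmod (u j t - u k t))\<^sup>2) \<partial>lborel)"
      by (rule nn_integral_liminf) auto
    finally show ?thesis by (simp add: nu)
  qed
  have close: "\<exists>N. \<forall>k\<ge>N. (\<integral>\<^sup>+ t. ennreal ((cmod (v t - u k t))\<^sup>2) \<partial>lborel) \<le> ennreal (e\<^sup>2)"
    if e: "e > 0" for e :: real
  proof -
    obtain N where N: "\<And>m n. m \<ge> N \<Longrightarrow> n \<ge> N \<Longrightarrow> norm (X m - X n) < e"
      using CauchyD[OF X e] by blast
    have rN: "r k \<ge> N" if "k \<ge> N" for k
      using seq_suble[OF r, of k] that by linarith
    show ?thesis
    proof (intro exI allI impI)
      fix k assume k: "k \<ge> N"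
      have "eventually (\<lambda>j. ennreal ((norm (X (r j) - X (r k)))\<^sup>2) \<le> ennreal (e\<^sup>2)) sequentially"
        using eventually_ge_at_top[of N]
      proof eventually_elim
        case (elim j)
        have "norm (X (r j) - X (r k)) \<le> e" using N[OF rN[OF elim] rN[OF k]] by simp
        then show ?case by (intro ennreal_leI power_mono) auto
      qed
      then have "liminf (\<lambda>j. ennreal ((norm (X (r j) - X (r k)))\<^sup>2)) \<le> liminf (\<lambda>j::nat. ennreal (e\<^sup>2))"
        by (rule Liminf_mono)
      then show "(\<integral>\<^sup>+ t. ennreal ((cmod (v t - u k t))\<^sup>2) \<partial>lborel) \<le> ennreal (e\<^sup>2)"
        using fatou[of k] by (simp add: Liminf_const)
    qed
  qed
  have sq: "sq_integrable v"
  proof -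
    obtain k where k: "(\<integral>\<^sup>+ t. ennreal ((cmod (v t - u k t))\<^sup>2) \<partial>lborel) \<le> ennreal (1\<^sup>2)"
      using close[OF zero_less_one] by blast
    have "sq_integrable (\<lambda>t. v t - u k t)"
      unfolding sq_integrable_def integrable_iff_bounded using le_less_trans[OF k, of \<infinity>] by auto
    from sq_integrable_add[OF this, of "u k"] show ?thesis by (simp add: u_def)
  qed
  obtain f where f: "AE t in lborel. rep_L2 f t = v t" using ex_rep_AE[OF sq] .
  have nf: "ennreal ((norm (f - X (r k)))\<^sup>2) = (\<integral>\<^sup>+ t. ennreal ((cmod (v t - u k t))\<^sup>2) \<partial>lborel)" for k
    unfolding norm_L2_nn_integral u_def
    by (rule nn_integral_cong_AE)
      (use f rep_diff_AE[of f "X (r k)"] in eventually_elim, simp)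
  have "(X \<circ> r) \<longlonglongrightarrow> f"
  proof (rule metric_LIMSEQ_I)
    fix e :: real assume "e > 0"
    then obtain N where N: "\<And>k. k \<ge> N \<Longrightarrow> ennreal ((norm (f - X (r k)))\<^sup>2) \<le> ennreal ((e/2)\<^sup>2)"
      using close[of "e/2"] by (auto simp: nf)
    show "\<exists>N. \<forall>n\<ge>N. dist ((X \<circ> r) n) f < e"
    proof (intro exI allI impI)
      fix k assume "k \<ge> N"
      from N[OF this] have "(norm (f - X (r k)))\<^sup>2 \<le> (e/2)\<^sup>2" by (simp add: ennreal_le_iff)
      then have "norm (f - X (r k)) \<le> e/2" using \<open>e > 0\<close> by (simp add: power2_le_iff_abs_le)
      then show "dist ((X \<circ> r) k) f < e" using \<open>e > 0\<close> by (simp add: dist_norm norm_minus_commute)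
    qed
  qed
  then have "X \<longlonglongrightarrow> f" using Cauchy_converges_subseq[OF X r] by simp
  then show "convergent X" by (auto simp: convergent_def)
qed

instance L2 :: (finite) banach ..

section \<open>Hilbert space geometry of \<open>L\<^sup>2\<close>\<close>

lemma scaleC_add_right: "c *\<^sub>C (f + g) = c *\<^sub>C f + c *\<^sub>C g"
  by transfer (auto simp: L2_rel_def distrib_left intro!: sq_integrable_add sq_integrable_scale)

lemma scaleC_add_left: "(c + d) *\<^sub>C f = c *\<^sub>C f + d *\<^sub>C f"
  by transfer (auto simp: L2_rel_def distrib_right intro!: sq_integrable_add sq_integrable_scale)

lemma scaleC_scaleC [simp]: "c *\<^sub>C d *\<^sub>C f = (c * d) *\<^sub>C f"
  by transfer (auto simp: L2_rel_def mult.assoc intro!: sq_integrable_scale)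

lemma scaleC_one [simp]: "1 *\<^sub>C f = f"
  by transfer (auto simp: L2_rel_def)

lemma scaleC_minus1: "(-1) *\<^sub>C f = - f"
  by (simp add: uminus_L2_def)

lemma scaleC_zero_right [simp]: "c *\<^sub>C 0 = 0"
  by (metis add_cancel_right_right scaleC_add_right)

lemma scaleC_zero_left [simp]: "0 *\<^sub>C f = 0"
  by (metis add_cancel_right_right scaleC_add_left)

lemma scaleC_scaleR: "c *\<^sub>C (r *\<^sub>R f) = r *\<^sub>R (c *\<^sub>C f)"
  by (simp add: scaleR_L2_def mult.commute)

lemma scaleC_diff_right: "c *\<^sub>C (f - g) = c *\<^sub>C f - c *\<^sub>C g"
  by (metis add_diff_cancel diff_add_cancel scaleC_add_right)

lemma scaleC_diff_left: "(c - d) *\<^sub>C f = c *\<^sub>C f - d *\<^sub>C f"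
  by (metis add_diff_cancel diff_add_cancel scaleC_add_left)

lemma cinner_commute: "cinner f g = cnj (cinner g f)"
  unfolding cinner_rep by (subst Bochner_Integration.integral_cnj [symmetric]) (simp add: mult.commute)

lemma cinner_add_left: "cinner (f + g) h = cinner f h + cinner g h"
  by transfer
    (auto simp: L2_rel_def distrib_right Bochner_Integration.integral_add sq_integrable_mult_cnj)

lemma cinner_scaleC_left [simp]: "cinner (c *\<^sub>C f) g = c * cinner f g"
  by transfer (simp add: mult.assoc)

lemma cinner_add_right: "cinner f (g + h) = cinner f g + cinner f h"
  by (metis cinner_add_left cinner_commute complex_cnj_add)

lemma cinner_scaleC_right [simp]: "cinner f (c *\<^sub>C g) = cnj c * cinner f g"
  by (metis cinner_commute cinner_scaleC_left complex_cnj_mult)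

lemma cinner_zero_left [simp]: "cinner 0 f = 0"
  by (metis cinner_scaleC_left mult_zero_left scaleC_zero_left)

lemma cinner_zero_right [simp]: "cinner f 0 = 0"
  by (metis cinner_commute cinner_zero_left complex_cnj_zero)

lemma cinner_minus_left [simp]: "cinner (- f) g = - cinner f g"
  by (metis cinner_scaleC_left mult_minus1 scaleC_minus1)

lemma cinner_minus_right [simp]: "cinner f (- g) = - cinner f g"
  by (metis cinner_commute cinner_minus_left complex_cnj_minus)

lemma cinner_diff_left: "cinner (f - g) h = cinner f h - cinner g h"
  by (metis cinner_add_left cinner_minus_left diff_conv_add_uminus)

lemma cinner_diff_right: "cinner f (g - h) = cinner f g - cinner f h"
  by (metis cinner_add_right cinner_minus_right diff_conv_add_uminus)

lemma cinner_scaleR_left [simp]: "cinner (r *\<^sub>R f) g = complex_of_real r * cinner f g"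
  by (simp add: scaleR_L2_def)

lemma cinner_scaleR_right [simp]: "cinner f (r *\<^sub>R g) = complex_of_real r * cinner f g"
  by (simp add: scaleR_L2_def)

lemma cinner_sum_left: "cinner (\<Sum>i\<in>I. f i) g = (\<Sum>i\<in>I. cinner (f i) g)"
  by (induction I rule: infinite_finite_induct) (auto simp: cinner_add_left)

lemma cinner_sum_right: "cinner g (\<Sum>i\<in>I. f i) = (\<Sum>i\<in>I. cinner g (f i))"
  by (induction I rule: infinite_finite_induct) (auto simp: cinner_add_right)

lemma Re_cinner: "Re (cinner f g) = inner f g"
  by (simp add: inner_L2_def)

lemma cinner_self: "cinner f f = complex_of_real ((norm f)\<^sup>2)"
proof -
  have "Im (cinner f f) = 0"
    using cinner_commute[of f f] by (metis Reals_cnj_iff complex_is_Real_iff)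
  then show ?thesis by (simp add: complex_eq_iff Re_cinner dot_square_norm)
qed

lemma cinner_eq_inner: "cinner f g = Complex (inner f g) (inner f (\<i> *\<^sub>C g))"
  by (simp add: complex_eq_iff flip: Re_cinner)

lemma norm_scaleC [simp]: "norm (c *\<^sub>C f) = cmod c * norm f"
proof -
  have "cinner (c *\<^sub>C f) (c *\<^sub>C f) = (c * cnj c) * cinner f f" by (simp add: mult.assoc)
  then have "complex_of_real ((norm (c *\<^sub>C f))\<^sup>2) = complex_of_real ((cmod c * norm f)\<^sup>2)"
    unfolding cinner_self complex_norm_square [symmetric] by (simp add: power_mult_distrib)
  then have "(norm (c *\<^sub>C f))\<^sup>2 = (cmod c * norm f)\<^sup>2" by (simp only: of_real_eq_iff)
  then show ?thesis by (rule power2_eq_imp_eq) auto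
qed

lemma Cauchy_Schwarz_cinner: "cmod (cinner f g) \<le> norm f * norm g"
proof (cases "cinner f g = 0")
  case False
  define c where "c = cnj (sgn (cinner f g))"
  have c: "cmod c = 1" using False by (simp add: c_def norm_sgn)
  have "c * cinner f g = complex_of_real (cmod (cinner f g))"
    using False complex_norm_square[of "cinner f g"]
    by (simp add: c_def sgn_eq field_simps power2_eq_square)
  then have "cmod (cinner f g) = Re (cinner (c *\<^sub>C f) g)"
    by simp
  also have "\<dots> \<le> norm (c *\<^sub>C f) * norm g"
    by (simp only: Re_cinner norm_cauchy_schwarz)
  finally show ?thesis using c by simp
qed simp

lemma bounded_bilinear_cinner: "bounded_bilinear cinner"
  by (rule bounded_bilinear.intro)
    (auto simp: cinner_add_left cinner_add_right scaleR_conv_of_real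
      intro!: exI[of _ 1] Cauchy_Schwarz_cinner)

lemma bounded_linear_scaleC: "bounded_linear ((*\<^sub>C) c)"
  by (rule bounded_linear_intro[where K = "cmod c"])
    (auto simp: scaleC_add_right scaleC_scaleR mult.commute)

lemmas tendsto_cinner = bounded_bilinear.tendsto[OF bounded_bilinear_cinner]
lemmas tendsto_scaleC = bounded_linear.tendsto[OF bounded_linear_scaleC]

lemma cinner_eqI: "(\<And>h. cinner f h = cinner g h) \<Longrightarrow> f = g"
  using cinner_self[of "f - g"] by (simp add: cinner_diff_left)

lemma cinner_eqI2: "(\<And>h. cinner h f = cinner h g) \<Longrightarrow> f = g"
  using cinner_self[of "f - g"] by (simp add: cinner_diff_right)

text \<open>The minimiser of \<open>\<parallel>x\<parallel>\<^sup>2 - 2 \<phi>(x)\<close> represents \<open>\<phi>\<close>; minimising sequences are Cauchy by the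
  parallelogram law.\<close>

lemma Riesz_real:
  fixes \<phi> :: "'a :: {real_inner, complete_space} \<Rightarrow> real"
  assumes "bounded_linear \<phi>"
  shows "\<exists>y. \<forall>x. \<phi> x = inner x y"
proof -
  interpret bounded_linear \<phi> by fact
  define J where "J x = (norm x)\<^sup>2 - 2 * \<phi> x" for x
  obtain K where K: "\<And>x. norm (\<phi> x) \<le> norm x * K" using bounded by blast
  have low: "- K\<^sup>2 \<le> J x" for x
  proof -
    have "\<phi> x \<le> norm x * K" using K[of x] by simp
    then show ?thesis
      using sum_squares_bound[of "norm x" K] by (simp add: J_def)
  qed
  then have bdd: "bdd_below (range J)" by (auto intro!: bdd_belowI)
  define m where "m = Inf (range J)"
  have mJ: "m \<le> J x" for x unfolding m_def by (intro cInf_lower bdd) auto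
  have "\<exists>x. J x < m + 1 / Suc n" for n
    using cInf_lessD[of "range J" "m + 1 / Suc n"] by (auto simp: m_def)
  then obtain X where X: "\<And>n. J (X n) < m + 1 / Suc n" by metis
  have par: "(norm (x - y))\<^sup>2 \<le> 2 * (J x - m) + 2 * (J y - m)" for x y
  proof -
    \<comment> \<open>The midpoint cannot fall below \<open>m\<close>, and \<open>\<phi>\<close> is
      additive, so only the parallelogram law remains.\<close>
    have "J ((1/2) *\<^sub>R (x + y)) = (norm (x + y))\<^sup>2 / 4 - \<phi> x - \<phi> y"
      by (simp add: J_def scaleR add power_divide add_divide_distrib del: scaleR_add_right)
    moreover have "(norm (x + y))\<^sup>2 + (norm (x - y))\<^sup>2 = 2 * (norm x)\<^sup>2 + 2 * (norm y)\<^sup>2"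
      by (simp add: power2_norm_eq_inner inner_add inner_diff inner_commute)
    ultimately show ?thesis
      using mJ[of "(1/2) *\<^sub>R (x + y)"] by (simp add: J_def)
  qed
  have "Cauchy X"
  proof (rule CauchyI)
    fix e :: real assume e: "e > 0"
    obtain N where N: "4 / e\<^sup>2 < real N" using reals_Archimedean2 by blast
    show "\<exists>N. \<forall>a\<ge>N. \<forall>b\<ge>N. norm (X a - X b) < e"
    proof (intro exI allI impI)
      fix a b assume ab: "a \<ge> N" "b \<ge> N"
      have "N > 0" using N e by (metis divide_nonneg_nonneg gr0I not_less of_nat_0 zero_le_numeral zero_le_power2)
      then have "1 / real (Suc a) \<le> 1 / real N" "1 / real (Suc b) \<le> 1 / real N"
        using ab by (auto intro!: divide_left_mono)
      then have "(norm (X a - X b))\<^sup>2 < 4 / real N"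
        using par[of "X a" "X b"] X[of a] X[of b] by simp
      also have "\<dots> < e\<^sup>2" using N e \<open>N > 0\<close> by (simp add: field_simps)
      finally show "norm (X a - X b) < e" using e by (simp add: power2_less_imp_less)
    qed
  qed
  then obtain y where y: "X \<longlonglongrightarrow> y" using Cauchy_convergent convergent_def by metis
  have "(\<lambda>n. J (X n)) \<longlonglongrightarrow> J y"
    unfolding J_def by (intro tendsto_intros y tendsto)
  moreover have "(\<lambda>n. m + 1 / Suc n) \<longlonglongrightarrow> m + 0"
    by (intro tendsto_intros LIMSEQ_Suc lim_1_over_n)
  ultimately have "J y \<le> m + 0"
    by (rule LIMSEQ_le) (use X less_imp_le in blast)
  then have min: "J y \<le> J x" for x using mJ[of x] by simp
  have "\<phi> h = inner h y" for h
  proof (cases "h = 0")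
    case False
    define b where "b = inner h y - \<phi> h"
    \<comment> \<open>The minimiser of the quadratic 2 t b + t^2 |h|^2, where its value is - b^2 /
      |h|^2.\<close>
    define t where "t = - b / (norm h)\<^sup>2"
    have "J (y + t *\<^sub>R h) = J y + 2 * t * b + t\<^sup>2 * (norm h)\<^sup>2"
      unfolding J_def b_def power2_norm_eq_inner
      by (simp add: add scaleR inner_add inner_commute algebra_simps power2_eq_square)
    then have "0 \<le> 2 * t * b + t\<^sup>2 * (norm h)\<^sup>2" using min[of "y + t *\<^sub>R h"] by simp
    also have "\<dots> = - b\<^sup>2 / (norm h)\<^sup>2" using False by (simp add: t_def field_simps power2_eq_square)
    finally have "b = 0" using False by (simp add: divide_le_0_iff)
    then show ?thesis by (simp add: b_def)
  qed (simp add: zero)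
  then show ?thesis by blast
qed

text \<open>The source of adjoints and of the module action. The real representation theorem is
  applied to \<open>Re (B f g)\<close> as a function of \<open>g\<close>; evaluating it at
  \<open>\<i> *\<^sub>C g\<close> recovers the imaginary part.\<close>

lemma Riesz_sesquilinear:
  fixes B :: "('n::finite) L2 \<Rightarrow> 'n L2 \<Rightarrow> complex"
  assumes addl: "\<And>f f' g. B (f + f') g = B f g + B f' g"
    and addr: "\<And>f g g'. B f (g + g') = B f g + B f g'"
    and scl: "\<And>c f g. B (c *\<^sub>C f) g = c * B f g"
    and scr: "\<And>c f g. B f (c *\<^sub>C g) = cnj c * B f g"
    and bnd: "\<And>f g. cmod (B f g) \<le> K * norm f * norm g"
  obtains T where "bounded_clinear T" "\<And>f g. cinner (T f) g = B f g"
proof -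
  have "\<exists>y. \<forall>g. cinner y g = B f g" for f
  proof -
    have "bounded_linear (\<lambda>g. Re (B f g))"
    proof (rule bounded_linear_intro[where K = "K * norm f"])
      show "norm (Re (B f g)) \<le> norm g * (K * norm f)" for g
        using order_trans[OF abs_Re_le_cmod bnd[of f g]] by (simp add: mult.commute mult.left_commute)
    qed (simp_all add: addr scr scaleR_L2_def)
    then obtain y where y: "\<And>g. Re (B f g) = inner g y" using Riesz_real by blast
    have "cinner y g = B f g" for g
      using y[of g] y[of "\<i> *\<^sub>C g"]
      by (simp add: cinner_eq_inner scr complex_eq_iff inner_commute)
    then show ?thesis by blast
  qed
  then obtain T where T: "\<And>f g. cinner (T f) g = B f g" by metis
  have add: "T (f + f') = T f + T f'" for f f'
    by (rule cinner_eqI) (simp add: T cinner_add_left addl)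
  have sc: "T (c *\<^sub>C f) = c *\<^sub>C T f" for c f
    by (rule cinner_eqI) (simp add: T scl)
  have "norm (T f) \<le> norm f * K" for f
  proof (cases "T f = 0")
    case True
    \<comment> \<open>The sign of \<open>K\<close> comes from the bound at (f, f), which forces
      \<open>K \<ge> 0\<close> unless \<open>f = 0\<close>.\<close>
    then show ?thesis using bnd[of f f] T[of f f]
      by (cases "f = 0") (auto simp: mult_less_0_iff zero_le_mult_iff)
  next
    case False
    have "(norm (T f))\<^sup>2 = cmod (B f (T f))" unfolding T[symmetric] cinner_self by (simp del: of_real_power)
    also have "\<dots> \<le> K * norm f * norm (T f)" by (rule bnd)
    finally show ?thesis using False by (simp add: power2_eq_square mult.commute)
  qed
  then have "bounded_linear T"
    by (intro bounded_linear_intro[where K = K]) (auto simp: add sc scaleR_L2_def)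
  then show thesis using that T sc by (auto simp: bounded_clinear_def)
qed

section \<open>Orthonormal systems\<close>

definition orthonormal :: "('n::finite) L2 set \<Rightarrow> bool" where
  "orthonormal E \<longleftrightarrow> (\<forall>e\<in>E. \<forall>e'\<in>E. cinner e e' = (if e = e' then 1 else 0))"

lemma orthonormal_norm: "orthonormal E \<Longrightarrow> e \<in> E \<Longrightarrow> norm e = 1"
  using cinner_self[of e] norm_ge_zero[of e]
  by (auto simp: orthonormal_def power2_eq_1_iff simp flip: of_real_power)

lemma is_onb_orthonormal: "is_onb E \<Longrightarrow> orthonormal E"
  by (auto simp: is_onb_def orthonormal_def)

lemma orthonormal_subset: "orthonormal E \<Longrightarrow> F \<subseteq> E \<Longrightarrow> orthonormal F"
  unfolding orthonormal_def by blast

text \<open>Zorn's lemma: any two vectors in the union of a chain already lie in a common member,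
  and a nonzero vector orthogonal to a maximal set could be normalised and adjoined.\<close>

lemma ex_onb: "\<exists>E :: ('n::finite) L2 set. is_onb E"
proof -
  have "\<exists>M\<in>{E :: 'n L2 set. orthonormal E}. \<forall>X\<in>{E. orthonormal E}. M \<subseteq> X \<longrightarrow> X = M"
  proof (rule subset_Zorn)
    fix C :: "'n L2 set set" assume C: "subset.chain {E. orthonormal E} C"
    have "orthonormal (\<Union>C)"
      unfolding orthonormal_def
    proof (intro ballI)
      fix e e' assume "e \<in> \<Union>C" "e' \<in> \<Union>C"
      then obtain X Y where XY: "X \<in> C" "Y \<in> C" "e \<in> X" "e' \<in> Y" by blast
      then have "X \<subseteq> Y \<or> Y \<subseteq> X" "orthonormal X" "orthonormal Y"
        using C by (auto simp: subset_chain_def)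
      then show "cinner e e' = (if e = e' then 1 else 0)"
        using XY unfolding orthonormal_def by (metis subsetD)
    qed
    then show "\<exists>U\<in>{E. orthonormal E}. \<forall>X\<in>C. X \<subseteq> U" by blast
  qed
  then obtain M :: "'n L2 set" where M: "orthonormal M" and max: "\<And>X. orthonormal X \<Longrightarrow> M \<subseteq> X \<Longrightarrow> X = M"
    by blast
  have "f = 0" if f: "\<forall>e\<in>M. cinner f e = 0" for f
  proof (rule ccontr)
    assume "f \<noteq> 0"
    define g where "g = (1 / norm f) *\<^sub>R f"
    have gg: "cinner g g = 1" using \<open>f \<noteq> 0\<close> by (simp add: cinner_self g_def)
    have ge: "cinner g e = 0" "cinner e g = 0" if "e \<in> M" for e
      using f that cinner_commute[of e f] by (auto simp: g_def)
    have "orthonormal (insert g M)"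
      using M gg ge by (auto simp: orthonormal_def)
    then have "g \<in> M" using max[of "insert g M"] by blast
    then show False using ge[of g] gg by simp
  qed
  then have "is_onb M" using M by (auto simp: is_onb_def orthonormal_def)
  then show ?thesis ..
qed

text \<open>For finite orthonormal \<open>F\<close> this is the orthogonal projection onto its
  span.\<close>

definition proj_sum :: "('n::finite) L2 set \<Rightarrow> 'n L2 \<Rightarrow> 'n L2" where
  "proj_sum F x = (\<Sum>e\<in>F. cinner x e *\<^sub>C e)"

lemma cinner_proj_sum:
  assumes "orthonormal E" "finite F" "F \<subseteq> E" "e \<in> E"
  shows "cinner (proj_sum F x) e = (if e \<in> F then cinner x e else 0)"
proof -
  have "cinner (proj_sum F x) e = (\<Sum>e'\<in>F. cinner x e' * cinner e' e)"
    by (simp add: proj_sum_def cinner_sum_left)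
  also have "\<dots> = (\<Sum>e'\<in>F. if e' = e then cinner x e else 0)"
    using assms by (intro sum.cong) (auto simp: orthonormal_def)
  also have "\<dots> = (if e \<in> F then cinner x e else 0)" using assms by simp
  finally show ?thesis .
qed

lemma cinner_proj_sum_right: "finite F \<Longrightarrow> cinner x (proj_sum F x) = (\<Sum>e\<in>F. (cmod (cinner x e))\<^sup>2)"
  by (simp add: proj_sum_def cinner_sum_right complex_norm_square mult.commute
      del: of_real_power)

lemma norm_proj_sum:
  assumes "orthonormal F" "finite F"
  shows "(norm (proj_sum F x))\<^sup>2 = (\<Sum>e\<in>F. (cmod (cinner x e))\<^sup>2)"
proof -
  have "cinner (proj_sum F x) (proj_sum F x) = (\<Sum>e\<in>F. cnj (cinner x e) * cinner (proj_sum F x) e)"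
    by (subst (2) proj_sum_def) (simp add: cinner_sum_right)
  also have "\<dots> = (\<Sum>e\<in>F. complex_of_real ((cmod (cinner x e))\<^sup>2))"
    by (intro sum.cong) (use assms in \<open>auto simp: cinner_proj_sum complex_norm_square mult.commute simp del: of_real_power\<close>)
  finally have "complex_of_real ((norm (proj_sum F x))\<^sup>2) = complex_of_real (\<Sum>e\<in>F. (cmod (cinner x e))\<^sup>2)"
    by (simp add: cinner_self)
  then show ?thesis by (simp only: of_real_eq_iff)
qed

lemma Pythagoras_proj_sum:
  assumes "orthonormal F" "finite F"
  shows "(norm (x - proj_sum F x))\<^sup>2 = (norm x)\<^sup>2 - (\<Sum>e\<in>F. (cmod (cinner x e))\<^sup>2)"
proof -
  have "inner x (proj_sum F x) = (\<Sum>e\<in>F. (cmod (cinner x e))\<^sup>2)"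
    unfolding Re_cinner[symmetric] cinner_proj_sum_right[OF assms(2)] by simp
  then show ?thesis
    using norm_proj_sum[OF assms, of x]
    by (simp add: power2_norm_eq_inner inner_diff inner_commute)
qed

lemma Bessel:
  assumes "orthonormal F" "finite F"
  shows "(\<Sum>e\<in>F. (cmod (cinner x e))\<^sup>2) \<le> (norm x)\<^sup>2"
  using Pythagoras_proj_sum[OF assms, of x] by (metis diff_ge_0_iff_ge zero_le_power2)

text \<open>The sum over \<open>E\<close> is exhausted by an increasing sequence of finite sets. The
  projections onto their spans form a Cauchy sequence whose limit has the same coefficients as
  \<open>x\<close> on all of \<open>E\<close>, and maximality of \<open>E\<close> identifies the
  limit with \<open>x\<close>.\<close>

lemma Parseval:
  assumes E: "is_onb E"
  shows "((\<lambda>e. (cmod (cinner x e))\<^sup>2) has_sum (norm x)\<^sup>2) E"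
proof -
  let ?a = "\<lambda>e. (cmod (cinner x e))\<^sup>2"
  have oE: "orthonormal E" using E by (rule is_onb_orthonormal)
  have bess: "sum ?a F \<le> (norm x)\<^sup>2" if "finite F" "F \<subseteq> E" for F
    using Bessel orthonormal_subset[OF oE] that by blast
  have sm: "?a summable_on E"
    by (intro nonneg_bdd_above_summable_on) (auto intro!: bdd_aboveI bess)
  define s where "s = infsum ?a E"
  have hs: "(?a has_sum s) E" using sm by (simp add: s_def)
  have le: "sum ?a F \<le> s" if "finite F" "F \<subseteq> E" for F
    using finite_sum_le_has_sum[OF hs] that by auto
  have "\<exists>F. finite F \<and> F \<subseteq> E \<and> s - 1 / Suc n < sum ?a F" for n
  proof -
    obtain F where "finite F" "F \<subseteq> E" "dist (sum ?a F) s \<le> 1 / (2 * Suc n)"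
      using has_sum_finite_approximation[OF hs, of "1 / (2 * Suc n)"] by auto
    moreover have "1 / (2 * real (Suc n)) < 1 / Suc n" by (simp add: field_simps)
    ultimately show ?thesis by (intro exI[of _ F]) (auto simp: dist_real_def abs_le_iff)
  qed
  then obtain F0 where F0: "\<And>n. finite (F0 n)" "\<And>n. F0 n \<subseteq> E" "\<And>n. s - 1 / Suc n < sum ?a (F0 n)"
    by metis
  define F where "F n = (\<Union>i\<le>n. F0 i)" for n
  have F: "finite (F n)" "F n \<subseteq> E" for n using F0 by (auto simp: F_def)
  have Fs: "s - 1 / Suc n < sum ?a (F n)" for n
    by (rule less_le_trans[OF F0(3)]) (use F in \<open>auto intro!: sum_mono2 simp: F_def\<close>)
  have Fmono: "F m \<subseteq> F n" if "m \<le> n" for m n using that by (force simp: F_def)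
  define y where "y n = proj_sum (F n) x" for n
  have ydiff: "(norm (y n - y m))\<^sup>2 \<le> 1 / Suc m" if "m \<le> n" for m n
  proof -
    have "y n - y m = proj_sum (F n - F m) x"
      unfolding y_def proj_sum_def using Fmono[OF that] F by (simp add: sum_diff)
    then have "(norm (y n - y m))\<^sup>2 = sum ?a (F n - F m)"
      using norm_proj_sum[of "F n - F m" x] orthonormal_subset[OF oE, of "F n - F m"] F by auto
    also have "\<dots> = sum ?a (F n) - sum ?a (F m)" using Fmono[OF that] F by (simp add: sum_diff)
    finally show ?thesis using Fs[of m] le[OF F] by (smt (verit))
  qed
  have "Cauchy y"
  proof (rule CauchyI')
    fix e :: real assume e: "e > 0"
    obtain M where M: "1 / real (Suc M) < e\<^sup>2" using nat_approx_posE[of "e\<^sup>2"] e by auto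
    show "\<exists>M. \<forall>m\<ge>M. \<forall>n>m. dist (y m) (y n) < e"
    proof (intro exI allI impI)
      fix m n assume mn: "m \<ge> M" "n > m"
      have "(norm (y n - y m))\<^sup>2 \<le> 1 / Suc m" using mn by (intro ydiff) auto
      also have "\<dots> \<le> 1 / Suc M" using mn by (auto intro!: divide_left_mono)
      also have "\<dots> < e\<^sup>2" by (rule M)
      finally show "dist (y m) (y n) < e"
        using e by (simp add: dist_norm norm_minus_commute power2_less_imp_less)
    qed
  qed
  then obtain z where z: "y \<longlonglongrightarrow> z" using Cauchy_convergent convergent_def by metis
  have "x - z = 0"
  proof -
    have "cinner (x - z) e = 0" if e: "e \<in> E" for e
    proof -
      have lim: "(\<lambda>n. cinner (y n) e) \<longlonglongrightarrow> cinner z e" by (intro tendsto_cinner z tendsto_const)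
      have "(\<lambda>n. cinner (y n) e) \<longlonglongrightarrow> cinner x e"
      proof (cases "\<exists>N. e \<in> F N")
        case True
        then obtain N where N: "e \<in> F N" ..
        show ?thesis
        proof (rule Lim_transform_eventually[OF tendsto_const])
          show "eventually (\<lambda>n. cinner x e = cinner (y n) e) sequentially"
            using eventually_ge_at_top[of N]
            by eventually_elim (use N Fmono F oE e in \<open>auto simp: y_def cinner_proj_sum[OF oE]\<close>)
        qed
      next
        case False
        \<comment> \<open>An \<open>e\<close> missed by every \<open>F n\<close> has coefficient
          zero: the sum over \<open>F n\<close> is already within 1 / (n + 1) of \<open>s\<close>,
          and adjoining \<open>e\<close> cannot push it beyond \<open>s\<close>.\<close>
        have "?a e \<le> 1 / Suc n" for n
        proof -
          have "?a e + sum ?a (F n) = sum ?a (insert e (F n))" using False F by simp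
          also have "\<dots> \<le> s" using F e by (intro le) auto
          finally show ?thesis using Fs[of n] by simp
        qed
        then have "?a e \<le> 0"
          using LIMSEQ_le_const[OF LIMSEQ_Suc[OF lim_1_over_n[where 'a = real]], of "?a e"] by blast
        then have "cinner x e = 0" by simp
        then show ?thesis using False F e by (simp add: y_def cinner_proj_sum[OF oE])
      qed
      with lim have "cinner z e = cinner x e" by (rule LIMSEQ_unique)
      then show ?thesis by (simp add: cinner_diff_left)
    qed
    then show ?thesis using E unfolding is_onb_def by (metis)
  qed
  then have "(\<lambda>n. (norm (y n))\<^sup>2) \<longlonglongrightarrow> (norm x)\<^sup>2" using z by (intro tendsto_intros) auto
  moreover have "(norm (y n))\<^sup>2 \<le> s" for n
    unfolding y_def using norm_proj_sum[OF orthonormal_subset[OF oE F(2)] F(1)] le[OF F] by simp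
  ultimately have "(norm x)\<^sup>2 \<le> s" using LIMSEQ_le_const2 by blast
  moreover have "s \<le> (norm x)\<^sup>2" by (rule has_sum_le_finite_sums[OF hs bess])
  ultimately show ?thesis using hs by simp
qed

section \<open>Bounded operators\<close>

lemma bounded_clinearI:
  assumes "\<And>f g. T (f + g) = T f + T g" "\<And>c f. T (c *\<^sub>C f) = c *\<^sub>C T f"
    "\<And>f. norm (T f) \<le> norm f * K"
  shows "bounded_clinear T"
  unfolding bounded_clinear_def
  using assms by (auto intro!: bounded_linear_intro[where K = K] simp: scaleR_L2_def)

lemma bounded_clinear_bounded_linear: "bounded_clinear T \<Longrightarrow> bounded_linear T"
  by (simp add: bounded_clinear_def)

lemma bounded_clinear_scaleC: "bounded_clinear T \<Longrightarrow> T (c *\<^sub>C f) = c *\<^sub>C T f"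
  by (simp add: bounded_clinear_def)

lemma bounded_clinear_zero: "bounded_clinear (\<lambda>f. 0)"
  by (simp add: bounded_clinear_def)

lemma bounded_clinear_id: "bounded_clinear (\<lambda>f. f)"
  by (simp add: bounded_clinear_def bounded_linear_ident)

lemma bounded_clinear_add:
  "bounded_clinear S \<Longrightarrow> bounded_clinear T \<Longrightarrow> bounded_clinear (\<lambda>f. S f + T f)"
  by (simp add: bounded_clinear_def bounded_linear_add scaleC_add_right)

lemma bounded_clinear_diff:
  "bounded_clinear S \<Longrightarrow> bounded_clinear T \<Longrightarrow> bounded_clinear (\<lambda>f. S f - T f)"
  by (simp add: bounded_clinear_def bounded_linear_sub scaleC_diff_right)

lemma bounded_clinear_scale:
  "bounded_clinear T \<Longrightarrow> bounded_clinear (\<lambda>f. c *\<^sub>C T f)"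
  by (simp add: bounded_clinear_def bounded_linear_compose[OF bounded_linear_scaleC] mult.commute)

lemma bounded_clinear_scaleR:
  "bounded_clinear T \<Longrightarrow> bounded_clinear (\<lambda>f. r *\<^sub>R T f)"
  unfolding scaleR_L2_def by (rule bounded_clinear_scale)

lemma bounded_clinear_compose:
  "bounded_clinear S \<Longrightarrow> bounded_clinear T \<Longrightarrow> bounded_clinear (\<lambda>f. S (T f))"
  by (simp add: bounded_clinear_def bounded_linear_compose)

lemma ex_adjoint:
  assumes T: "bounded_clinear T"
  shows "\<exists>T'. bounded_clinear T' \<and> (\<forall>f g. cinner (T f) g = cinner f (T' g))"
proof -
  interpret bounded_linear T using T by (rule bounded_clinear_bounded_linear)
  obtain K where K: "\<And>x. norm (T x) \<le> norm x * K" using bounded by blast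
  obtain T' where T': "bounded_clinear T'" "\<And>f g. cinner (T' f) g = cinner f (T g)"
  proof (rule Riesz_sesquilinear[of "\<lambda>f g. cinner f (T g)" K])
    show "cmod (cinner f (T g)) \<le> K * norm f * norm g" for f g
      using order_trans[OF Cauchy_Schwarz_cinner[of f "T g"] mult_left_mono[OF K[of g], of "norm f"]]
      by (simp add: algebra_simps)
  qed (simp_all add: cinner_add_left cinner_add_right add bounded_clinear_scaleC[OF T])
  moreover have "cinner (T f) g = cinner f (T' g)" for f g
    using T'(2)[of g f] by (metis cinner_commute)
  ultimately show ?thesis by blast
qed

lemma adj_eqI:
  assumes "\<And>f g. cinner (T f) g = cinner f (S g)"
  shows "adj T = S"
  unfolding adj_def
proof (rule the_equality)
  fix T' assume "\<forall>f g. cinner (T f) g = cinner f (T' g)"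
  then show "T' = S" using assms by (intro ext cinner_eqI2) metis
qed (simp add: assms)

lemma
  assumes "bounded_clinear T"
  shows cinner_adj_right: "cinner f (adj T g) = cinner (T f) g"
    and bounded_clinear_adj: "bounded_clinear (adj T)"
    and cinner_adj_left: "cinner (adj T f) g = cinner f (T g)"
proof -
  obtain T' where T': "bounded_clinear T'" "\<And>f g. cinner (T f) g = cinner f (T' g)"
    using ex_adjoint[OF assms] by blast
  then have eq: "adj T = T'" by (intro adj_eqI) auto
  show "bounded_clinear (adj T)" using T' eq by simp
  show *: "cinner f (adj T g) = cinner (T f) g" for f g using T' eq by simp
  show "cinner (adj T f) g = cinner f (T g)" using *[of g f] by (metis cinner_commute)
qed

text \<open>The unit ball of the bounded operators, against which trace class is tested. It is
  stable under composition and adjoints.\<close>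

definition contr :: "('n::finite) op \<Rightarrow> bool" where
  "contr V \<longleftrightarrow> bounded_clinear V \<and> (\<forall>f. norm (V f) \<le> norm f)"

lemma norm_le_if_cinner_le:
  assumes "\<And>g. cmod (cinner f g) \<le> C * norm g" "0 \<le> C" shows "norm f \<le> C"
proof (cases "f = 0")
  case False
  have "norm f * norm f \<le> C * norm f"
    using assms(1)[of f] unfolding cinner_self by (simp add: power2_eq_square norm_mult)
  then show ?thesis using False by simp
qed (simp add: assms)

lemma contr_id: "contr (\<lambda>f. f)"
  by (simp add: contr_def bounded_clinear_id)

lemma contr_compose: "contr V \<Longrightarrow> contr W \<Longrightarrow> contr (\<lambda>f. V (W f))"
  unfolding contr_def by (auto intro: bounded_clinear_compose order_trans)

lemma contr_adj:
  assumes "contr V" shows "contr (adj V)"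
proof -
  have V: "bounded_clinear V" "\<And>f. norm (V f) \<le> norm f" using assms by (auto simp: contr_def)
  have "norm (adj V f) \<le> norm f" for f
  proof (cases "adj V f = 0")
    case False
    have "(norm (adj V f))\<^sup>2 = cmod (cinner (V (adj V f)) f)"
      unfolding cinner_adj_right[OF V(1), symmetric] cinner_self by (simp del: of_real_power)
    also have "\<dots> \<le> norm (adj V f) * norm f"
      by (rule order_trans[OF Cauchy_Schwarz_cinner]) (simp add: V mult_right_mono)
    finally show ?thesis using False by (simp add: power2_eq_square)
  qed simp
  then show ?thesis using bounded_clinear_adj[OF V(1)] by (simp add: contr_def)
qed

section \<open>Positive operators and their square roots\<close>

lemma positive_op_bounded_clinear: "positive_op P \<Longrightarrow> bounded_clinear P"
  by (simp add: positive_op_def)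

lemma positive_op_nonneg: "positive_op P \<Longrightarrow> 0 \<le> inner (P f) f"
  by (simp add: positive_op_def flip: Re_cinner)

text \<open>Polarisation: the quadratic form is real, and its values at f + g and f + i g separate
  the two mixed terms.\<close>

lemma positive_op_symmetric:
  assumes P: "positive_op P" shows "cinner (P f) g = cinner f (P g)"
proof -
  have bP: "bounded_clinear P" using P by (rule positive_op_bounded_clinear)
  interpret bounded_linear P using bP by (rule bounded_clinear_bounded_linear)
  have re: "cinner (P f) f = cinner f (P f)" for f
    using P cinner_commute[of f "P f"] unfolding positive_op_def by (metis Reals_cnj_iff)
  have 1: "cinner (P f) g + cinner (P g) f = cinner f (P g) + cinner g (P f)" for f g
    using re[of "f + g"] re[of f] re[of g]
    by (simp add: add cinner_add_left cinner_add_right algebra_simps)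
  have "\<i> * (cinner (P g) f - cinner (P f) g) = \<i> * (cinner g (P f) - cinner f (P g))"
    using 1[of f "\<i> *\<^sub>C g"] by (simp add: bounded_clinear_scaleC[OF bP] algebra_simps)
  then have "cinner (P g) f - cinner (P f) g = cinner g (P f) - cinner f (P g)" by simp
  with 1[of f g] have "2 * cinner (P f) g = 2 * cinner f (P g)" by algebra
  then show ?thesis by simp
qed

lemma positive_opI:
  assumes "bounded_clinear P" "\<And>f g. cinner (P f) g = cinner f (P g)" "\<And>f. 0 \<le> inner (P f) f"
  shows "positive_op P"
proof -
  have "cinner (P f) f \<in> \<real>" for f
    using assms(2)[of f f] cinner_commute[of f "P f"] by (metis Reals_cnj_iff)
  then show ?thesis using assms(1,3) by (simp add: positive_op_def Re_cinner)
qed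

text \<open>The operator inequality P^2 \<le> K P. Positivity is tested at f - P f / K, and the term
  with three factors of P is absorbed by the norm bound. This is what makes 1 - P / K a contraction
  in the constructions of roots and resolvents.\<close>

lemma norm_positive_op_square_le:
  assumes P: "positive_op P" and K: "\<And>f. norm (P f) \<le> K * norm f" "K > 0"
  shows "(norm (P f))\<^sup>2 \<le> K * inner (P f) f"
proof -
  interpret bounded_linear P using P by (intro bounded_clinear_bounded_linear positive_op_bounded_clinear)
  have sym: "inner (P f) g = inner f (P g)" for f g
    using positive_op_symmetric[OF P] by (metis Re_cinner)
  have "inner (P (P f)) (P f) \<le> K * (norm (P f))\<^sup>2"
    using order_trans[OF norm_cauchy_schwarz[of "P (P f)" "P f"] mult_right_mono[OF K(1)[of "P f"], of "norm (P f)"]]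
    by (simp add: power2_eq_square mult.assoc)
  then have "inner (P (P f)) (P f) / K\<^sup>2 \<le> (norm (P f))\<^sup>2 / K"
    using K by (simp add: field_simps power2_eq_square)
  moreover have "0 \<le> inner (P (f - (1 / K) *\<^sub>R P f)) (f - (1 / K) *\<^sub>R P f)"
    by (rule positive_op_nonneg[OF P])
  moreover have "inner (P (f - (1 / K) *\<^sub>R P f)) (f - (1 / K) *\<^sub>R P f)
      = inner (P f) f - 2 * (norm (P f))\<^sup>2 / K + inner (P (P f)) (P f) / K\<^sup>2"
    unfolding diff scaleR power2_norm_eq_inner
    using sym[of "P f" f] by (simp add: inner_diff inner_commute power2_eq_square)
  ultimately have "(norm (P f))\<^sup>2 / K \<le> inner (P f) f" by (simp add: field_simps)
  then show ?thesis using K by (simp add: field_simps)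
qed

lemma positive_op_eq_0_if_inner_0:
  assumes P: "positive_op P" and "inner (P f) f = 0" shows "P f = 0"
proof -
  interpret bounded_linear P using P by (intro bounded_clinear_bounded_linear positive_op_bounded_clinear)
  obtain K where "K > 0" "\<And>x. norm (P x) \<le> norm x * K" using pos_bounded by blast
  then show ?thesis using norm_positive_op_square_le[OF P, of K f] assms(2) by (simp add: mult.commute)
qed

text \<open>With \<open>A = 1 - P\<close> and \<open>\<parallel>A\<parallel> \<le> 1\<close>, the iteration \<open>Y \<mapsto> (A + Y\<^sup>2)/2\<close> converges to \<open>1 - P\<^bsup>1/2\<^esup>\<close>:
  its increments are dominated by those of the scalar iteration \<open>y \<mapsto> (1 + y\<^sup>2)/2\<close>.\<close>

lemma ex_sqrt_contraction:
  fixes A :: "('n::finite) op"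
  assumes A: "contr A" and sym: "\<And>f g. cinner (A f) g = cinner f (A g)"
  obtains Y where "contr Y" "\<And>f g. cinner (Y f) g = cinner f (Y g)"
    "\<And>f. 2 *\<^sub>R Y f = A f + Y (Y f)"
    "\<And>B f. bounded_linear B \<Longrightarrow> (\<And>g. B (A g) = A (B g)) \<Longrightarrow> B (Y f) = Y (B f)"
proof -
  define Y where "Y n = ((\<lambda>Z f. (1/2) *\<^sub>R (A f + Z (Z f))) ^^ n) (\<lambda>f. 0)" for n
  define y where "y n = ((\<lambda>t. (1 + t\<^sup>2) / 2) ^^ n) (0::real)" for n
  have Y0: "Y 0 f = 0" and YS: "Y (Suc n) f = (1/2) *\<^sub>R (A f + Y n (Y n f))" for n f
    by (auto simp: Y_def)
  have y0: "y 0 = 0" and yS: "y (Suc n) = (1 + (y n)\<^sup>2) / 2" for n by (auto simp: y_def)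
  have bA: "bounded_clinear A" and nA: "\<And>f. norm (A f) \<le> norm f" using A by (auto simp: contr_def)
  have bY: "bounded_clinear (Y n)" for n
  proof (induction n)
    case 0 then show ?case unfolding Y0[abs_def] by (rule bounded_clinear_zero)
  next
    case (Suc n) then show ?case unfolding YS[abs_def]
      by (intro bounded_clinear_scaleR bounded_clinear_add bA bounded_clinear_compose[of "Y n" "Y n"])
  qed
  have lin: "linear (Y n)" for n
    using bounded_linear.linear[OF bounded_clinear_bounded_linear[OF bY]] .
  have symY: "cinner (Y n f) g = cinner f (Y n g)" for n f g
    by (induction n arbitrary: f g) (auto simp: Y0 YS sym cinner_add_left cinner_add_right)
  have yb: "0 \<le> y n \<and> y n \<le> 1" for n
    by (induction n) (auto simp: y0 yS power_le_one)
  have nY: "norm (Y n f) \<le> y n * norm f" for n f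
  proof (induction n arbitrary: f)
    case 0 then show ?case by (simp add: Y0 y0)
  next
    case (Suc n)
    have "norm (Y n (Y n f)) \<le> y n * (y n * norm f)"
      using Suc.IH[of "Y n f"] mult_left_mono[OF Suc.IH[of f]] yb[of n] by (meson order_trans)
    then have "norm (A f + Y n (Y n f)) \<le> norm f + (y n)\<^sup>2 * norm f"
      using norm_triangle_ineq[of "A f" "Y n (Y n f)"] nA[of f] by (simp add: power2_eq_square)
    moreover have "norm (Y (Suc n) f) = norm (A f + Y n (Y n f)) / 2"
      unfolding YS norm_scaleR by simp
    ultimately show ?case by (simp add: yS algebra_simps)
  qed
  have nY1: "norm (Y n f) \<le> norm f" for n f
    using nY[of n f] yb[of n] mult_right_mono[of "y n" 1 "norm f"] by simp
  have ymono: "y n \<le> y (Suc n)" for n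
  proof -
    have "0 \<le> (1 - y n)\<^sup>2" by simp
    then show ?thesis by (simp add: yS power2_diff)
  qed
  have step: "norm (Y (Suc n) f - Y n f) \<le> (y (Suc n) - y n) * norm f" for n f
  proof (induction n arbitrary: f)
    case 0 then show ?case using nY[of "Suc 0" f] by (simp add: Y0 y0)
  next
    case (Suc n)
    let ?d = "y (Suc n) - y n"
    have d: "0 \<le> ?d" using ymono[of n] by simp
    have "Y (Suc (Suc n)) f - Y (Suc n) f = (1/2) *\<^sub>R (Y (Suc n) (Y (Suc n) f) - Y n (Y n f))"
      by (simp add: YS[of "Suc n"] YS[of n f] scaleR_diff_right[symmetric] del: scaleR_diff_right)
    \<comment> \<open>A difference of squares split without commuting the factors; the two terms are
      bounded by the factors of (y (n+1) + y n) (y (n+1) - y n).\<close>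
    also have "Y (Suc n) (Y (Suc n) f) - Y n (Y n f)
        = Y (Suc n) (Y (Suc n) f - Y n f) + (Y (Suc n) (Y n f) - Y n (Y n f))"
      by (simp add: linear_diff[OF lin])
    finally have "norm (Y (Suc (Suc n)) f - Y (Suc n) f)
        \<le> (1/2) * (norm (Y (Suc n) (Y (Suc n) f - Y n f)) + norm (Y (Suc n) (Y n f) - Y n (Y n f)))"
      using norm_triangle_ineq by simp
    also have "\<dots> \<le> (1/2) * (y (Suc n) * (?d * norm f) + ?d * (y n * norm f))"
    proof (intro mult_left_mono add_mono)
      show "norm (Y (Suc n) (Y (Suc n) f - Y n f)) \<le> y (Suc n) * (?d * norm f)"
        using nY[of "Suc n" "Y (Suc n) f - Y n f"] mult_left_mono[OF Suc.IH[of f]] yb[of "Suc n"]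
        by (meson order_trans)
      show "norm (Y (Suc n) (Y n f) - Y n (Y n f)) \<le> ?d * (y n * norm f)"
        using Suc.IH[of "Y n f"] mult_left_mono[OF nY[of n f] d] by (meson order_trans)
    qed simp
    also have "\<dots> = (y (Suc (Suc n)) - y (Suc n)) * norm f"
    proof -
      have "y (Suc (Suc n)) - y (Suc n) = ((y (Suc n))\<^sup>2 - (y n)\<^sup>2) / 2"
        by (subst (1 2) yS) (simp add: field_simps)
      then show ?thesis by (simp only:) (simp add: power2_eq_square field_simps)
    qed
    finally show ?case .
  qed
  have dist: "norm (Y (n + k) f - Y n f) \<le> (y (n + k) - y n) * norm f" for n k f
  proof (induction k)
    case (Suc k)
    have "norm (Y (n + Suc k) f - Y n f) \<le> norm (Y (Suc (n + k)) f - Y (n + k) f) + norm (Y (n + k) f - Y n f)"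
      using norm_triangle_ineq[of "Y (Suc (n + k)) f - Y (n + k) f" "Y (n + k) f - Y n f"] by simp
    then show ?case using step[of "n + k" f] Suc by (simp add: algebra_simps)
  qed simp
  \<comment> \<open>The scalar iteration increases and is bounded by 1, so it is Cauchy, and by
    \<open>dist\<close> this passes to \<open>Y n f\<close> for each f.\<close>
  have "incseq y" using ymono by (rule incseq_SucI)
  then obtain l where "y \<longlonglongrightarrow> l" using incseq_convergent[of y 1] yb by blast
  then have "Cauchy y" by (rule LIMSEQ_imp_Cauchy)
  have "convergent (\<lambda>n. Y n f)" for f
  proof (rule Cauchy_convergent, rule CauchyI')
    fix e :: real assume e: "e > 0"
    define e' where "e' = e / (norm f + 1)"
    have "e' > 0" using e by (auto simp: e'_def intro!: divide_pos_pos add_nonneg_pos)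
    then obtain M where M: "\<And>m n. m \<ge> M \<Longrightarrow> n \<ge> M \<Longrightarrow> norm (y m - y n) < e'"
      using CauchyD[OF \<open>Cauchy y\<close>] by blast
    show "\<exists>M. \<forall>m\<ge>M. \<forall>n>m. dist (Y m f) (Y n f) < e"
    proof (intro exI allI impI)
      fix m n assume mn: "m \<ge> M" "n > m"
      then obtain k where k: "n = m + k" using less_imp_add_positive by blast
      have "dist (Y m f) (Y n f) \<le> (y n - y m) * norm f"
        using dist[of m k f] by (simp add: k dist_norm norm_minus_commute)
      also have "\<dots> \<le> e' * norm f"
        using M[of n m] mn by (intro mult_right_mono) auto
      also have "\<dots> < e' * (norm f + 1)" using \<open>e' > 0\<close> by simp
      also have "\<dots> = e" using norm_ge_zero[of f] by (simp add: e'_def del: norm_ge_zero)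
      finally show "dist (Y m f) (Y n f) < e" .
    qed
  qed
  then have "\<exists>g. (\<lambda>n. Y n f) \<longlonglongrightarrow> g" for f by (simp add: convergent_def)
  then obtain Z where Z: "\<And>f. (\<lambda>n. Y n f) \<longlonglongrightarrow> Z f" by metis
  have nZ: "norm (Z f) \<le> norm f" for f
    by (rule LIMSEQ_le_const2[OF tendsto_norm[OF Z]]) (simp add: nY1)
  have bZ: "bounded_clinear Z"
  proof (rule bounded_clinearI[where K = 1])
    show "Z (f + g) = Z f + Z g" for f g
      by (rule LIMSEQ_unique[OF Z]) (simp add: linear_add[OF lin] tendsto_add Z)
    show "Z (c *\<^sub>C f) = c *\<^sub>C Z f" for c f
      by (rule LIMSEQ_unique[OF Z]) (simp add: bounded_clinear_scaleC[OF bY] tendsto_scaleC Z)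
  qed (simp add: nZ)
  show thesis
  proof (rule that[of Z])
    show "contr Z" using bZ nZ by (simp add: contr_def)
    show "cinner (Z f) g = cinner f (Z g)" for f g
    proof (rule LIMSEQ_unique)
      show "(\<lambda>n. cinner (Y n f) g) \<longlonglongrightarrow> cinner (Z f) g" by (intro tendsto_cinner Z tendsto_const)
      show "(\<lambda>n. cinner (Y n f) g) \<longlonglongrightarrow> cinner f (Z g)"
        unfolding symY by (intro tendsto_cinner Z tendsto_const)
    qed
    show "2 *\<^sub>R Z f = A f + Z (Z f)" for f
    proof (rule LIMSEQ_unique)
      \<comment> \<open>Operator and argument vary together; since every \<open>Y n\<close> is a
        contraction, the argument may be replaced by its limit first.\<close>
      have "(\<lambda>n. Y n (Y n f - Z f)) \<longlonglongrightarrow> 0"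
      proof (rule tendsto_norm_zero_cancel, rule tendsto_sandwich[of "\<lambda>_. 0" _ _ "\<lambda>n. norm (Y n f - Z f)"])
        show "(\<lambda>n. norm (Y n f - Z f)) \<longlonglongrightarrow> 0" using Z[of f] by (simp add: LIM_zero tendsto_norm_zero)
      qed (auto simp: nY1)
      then have "(\<lambda>n. Y n (Y n f - Z f) + Y n (Z f)) \<longlonglongrightarrow> 0 + Z (Z f)" by (intro tendsto_add Z)
      then have "(\<lambda>n. Y n (Y n f)) \<longlonglongrightarrow> Z (Z f)" by (simp add: linear_diff[OF lin])
      then show "(\<lambda>n. 2 *\<^sub>R Y (Suc n) f) \<longlonglongrightarrow> A f + Z (Z f)"
        unfolding YS by (simp add: tendsto_add)
      show "(\<lambda>n. 2 *\<^sub>R Y (Suc n) f) \<longlonglongrightarrow> 2 *\<^sub>R Z f"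
        by (intro tendsto_scaleR tendsto_const LIMSEQ_Suc Z)
    qed
    show "B (Z f) = Z (B f)" if B: "bounded_linear B" "\<And>g. B (A g) = A (B g)" for B f
    proof (rule LIMSEQ_unique)
      have com: "B (Y n f) = Y n (B f)" for n f
      proof (induction n arbitrary: f)
        case 0 then show ?case by (simp add: Y0 linear_simps[OF B(1)])
      next
        case (Suc n) then show ?case by (simp add: YS linear_simps[OF B(1)] B(2))
      qed
      show "(\<lambda>n. B (Y n f)) \<longlonglongrightarrow> B (Z f)" by (rule bounded_linear.tendsto[OF B(1) Z])
      show "(\<lambda>n. B (Y n f)) \<longlonglongrightarrow> Z (B f)" unfolding com by (rule Z)
    qed
  qed
qed

text \<open>With K bounding P, the fixed point Y of the iteration for A = 1 - P / K satisfies (1 -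
  Y)^2 = 1 - A = P / K, whence the root sqrt K (1 - Y). Commutation with everything that commutes
  with P is recorded because uniqueness of the root rests on it.\<close>

lemma ex_positive_sqrt:
  fixes P :: "('n::finite) op"
  assumes P: "positive_op P"
  shows "\<exists>R. positive_op R \<and> (\<forall>f. R (R f) = P f) \<and>
    (\<forall>B. bounded_linear B \<longrightarrow> (\<forall>f. B (P f) = P (B f)) \<longrightarrow> (\<forall>f. B (R f) = R (B f)))"
proof -
  have bP: "bounded_clinear P" using P by (rule positive_op_bounded_clinear)
  interpret bounded_linear P using bP by (rule bounded_clinear_bounded_linear)
  obtain K where K: "K > 0" "\<And>x. norm (P x) \<le> norm x * K" using pos_bounded by blast
  define A where "A f = f - (1 / K) *\<^sub>R P f" for f
  have bA: "bounded_clinear A"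
    unfolding A_def[abs_def] by (intro bounded_clinear_diff bounded_clinear_id bounded_clinear_scaleR bP)
  have "norm (A f) \<le> norm f" for f
  proof -
    have "(norm (A f))\<^sup>2 = (norm f)\<^sup>2 - 2 * inner (P f) f / K + (norm (P f))\<^sup>2 / K\<^sup>2"
      unfolding power2_norm_eq_inner A_def
      by (simp add: inner_diff inner_commute power2_eq_square)
    moreover have "(norm (P f))\<^sup>2 / K\<^sup>2 \<le> inner (P f) f / K"
      using norm_positive_op_square_le[OF P, of K f] K
      by (simp add: mult.commute power2_eq_square field_simps)
    moreover have "0 \<le> inner (P f) f / K" using positive_op_nonneg[OF P] K by simp
    ultimately have "(norm (A f))\<^sup>2 \<le> (norm f)\<^sup>2" by simp
    then show ?thesis by (rule power2_le_imp_le) simp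
  qed
  then have cA: "contr A" using bA by (simp add: contr_def)
  have symA: "cinner (A f) g = cinner f (A g)" for f g
    by (simp add: A_def cinner_diff_left cinner_diff_right positive_op_symmetric[OF P])
  obtain Y where Y: "contr Y" "\<And>f g. cinner (Y f) g = cinner f (Y g)"
    "\<And>f. 2 *\<^sub>R Y f = A f + Y (Y f)"
    "\<And>B f. bounded_linear B \<Longrightarrow> (\<And>g. B (A g) = A (B g)) \<Longrightarrow> B (Y f) = Y (B f)"
    using ex_sqrt_contraction[OF cA symA] by blast
  have bY: "bounded_clinear Y" and nY: "\<And>f. norm (Y f) \<le> norm f" using Y(1) by (auto simp: contr_def)
  have linY: "linear Y" using bounded_linear.linear[OF bounded_clinear_bounded_linear[OF bY]] .
  define R where "R f = sqrt K *\<^sub>R (f - Y f)" for f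
  have bR: "bounded_clinear R"
    unfolding R_def[abs_def] by (intro bounded_clinear_scaleR bounded_clinear_diff bounded_clinear_id bY)
  have "positive_op R"
  proof (rule positive_opI[OF bR])
    show "cinner (R f) g = cinner f (R g)" for f g
      by (simp add: R_def cinner_diff_left cinner_diff_right Y(2))
    have "inner (Y f) f \<le> inner f f" for f
      using norm_cauchy_schwarz[of "Y f" f] mult_right_mono[OF nY[of f], of "norm f"]
      by (simp add: dot_square_norm power2_eq_square)
    then show "0 \<le> inner (R f) f" for f using K by (simp add: R_def inner_diff)
  qed
  moreover have "R (R f) = P f" for f
  proof -
    have "R (R f) = K *\<^sub>R (f - 2 *\<^sub>R Y f + Y (Y f))"
      using K by (simp add: R_def linear_diff[OF linY] linear_scale[OF linY] algebra_simps scaleR_2)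
    also have "\<dots> = P f" using K by (simp add: Y(3) A_def)
    finally show ?thesis .
  qed
  moreover have "B (R f) = R (B f)" if B: "bounded_linear B" "\<forall>f. B (P f) = P (B f)" for B f
  proof -
    have "B (A g) = A (B g)" for g using B(2) by (simp add: A_def linear_simps[OF B(1)])
    then have "B (Y f) = Y (B f)" by (rule Y(4)[OF B(1)])
    then show ?thesis by (simp add: R_def linear_simps[OF B(1)])
  qed
  ultimately show ?thesis by blast
qed

text \<open>Any root Q commutes with P = Q^2, hence with the constructed root R. For g = R f - Q f
  this gives (R + Q) g = R^2 f - Q^2 f = 0, so both nonnegative forms vanish at g, hence R g = Q g =
  0, and |g|^2 = <f, (R - Q) g> = 0 by symmetry.\<close>

lemma positive_sqrt_unique:
  assumes P: "positive_op P" and Q: "positive_op Q" "\<And>f. Q (Q f) = P f"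
    and Q': "positive_op Q'" "\<And>f. Q' (Q' f) = P f"
  shows "Q = Q'"
proof -
  obtain R where R: "positive_op R" "\<And>f. R (R f) = P f"
    and com: "\<And>B f. bounded_linear B \<Longrightarrow> (\<forall>f. B (P f) = P (B f)) \<Longrightarrow> B (R f) = R (B f)"
    using ex_positive_sqrt[OF P] by blast
  have "Q = R" if Q: "positive_op Q" "\<And>f. Q (Q f) = P f" for Q
  proof
    fix f
    have lQ: "bounded_linear Q" and lR: "bounded_linear R"
      using Q R by (auto intro: bounded_clinear_bounded_linear positive_op_bounded_clinear)
    have QR: "Q (R g) = R (Q g)" for g
      by (rule com[OF lQ]) (metis Q(2))
    define g where "g = R f - Q f"
    have 0: "R g + Q g = 0"
      by (simp add: g_def linear_simps[OF lQ] linear_simps[OF lR] Q(2) R(2) QR)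
    then have "inner (R g) g + inner (Q g) g = 0" by (metis inner_add_left inner_zero_left)
    then have "inner (R g) g = 0" "inner (Q g) g = 0"
      using positive_op_nonneg[OF Q(1), of g] positive_op_nonneg[OF R(1), of g] by linarith+
    then have "R g = 0" "Q g = 0"
      using positive_op_eq_0_if_inner_0[OF R(1)] positive_op_eq_0_if_inner_0[OF Q(1)] by blast+
    then have "cinner (R f - Q f) g = 0"
      using positive_op_symmetric[OF R(1), of f g] positive_op_symmetric[OF Q(1), of f g]
      by (simp add: cinner_diff_left)
    then show "Q f = R f" using cinner_self[of g] by (simp add: g_def)
  qed
  then show ?thesis using Q Q' by blast
qed

section \<open>The modulus of an operator and a substitute for its polar decomposition\<close>

lemma positive_op_adj_comp:
  assumes T: "bounded_clinear T" shows "positive_op (adj T \<circ> T)"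
  unfolding o_def
  by (rule positive_opI[OF bounded_clinear_compose[OF bounded_clinear_adj[OF T] T]])
    (auto simp: cinner_adj_left[OF T] cinner_adj_right[OF T] simp flip: Re_cinner simp: cinner_self)

text \<open>Existence and uniqueness of the positive root give the \<open>THE\<close> in
  \<open>abs_op\<close> its meaning.\<close>

lemma
  assumes T: "bounded_clinear T"
  shows positive_abs_op: "positive_op (abs_op T)"
    and abs_op_square: "abs_op T (abs_op T f) = adj T (T f)"
proof -
  let ?Q = "\<lambda>P. positive_op P \<and> P \<circ> P = adj T \<circ> T"
  obtain R where R: "positive_op R" "\<And>f. R (R f) = (adj T \<circ> T) f"
    using ex_positive_sqrt[OF positive_op_adj_comp[OF T]] by blast
  have uniq: "P = R" if "?Q P" for P
    by (rule positive_sqrt_unique[OF positive_op_adj_comp[OF T]]) (use that R in \<open>auto simp: fun_eq_iff\<close>)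
  have "?Q (abs_op T)"
    unfolding abs_op_def by (rule theI[of ?Q R]) (use R uniq in \<open>auto simp: fun_eq_iff\<close>)
  then show "positive_op (abs_op T)" "abs_op T (abs_op T f) = adj T (T f)"
    by (auto simp: fun_eq_iff)
qed

lemma cinner_abs_op:
  assumes T: "bounded_clinear T"
  shows "cinner (abs_op T f) (abs_op T g) = cinner (T f) (T g)"
  by (metis T abs_op_square cinner_adj_left positive_abs_op positive_op_symmetric)

lemma norm_abs_op:
  assumes T: "bounded_clinear T" shows "norm (abs_op T f) = norm (T f)"
  using cinner_abs_op[OF T, of f f] unfolding norm_L2_def by (simp flip: Re_cinner)

text \<open>Inverts B = P + e. Positivity bounds B below by e, so x - (B x - f) / L is a contraction
  in x once L bounds B, and its fixed point solves B x = f.\<close>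

lemma ex_resolvent:
  fixes P :: "('n::finite) op"
  assumes P: "positive_op P" and e: "e > 0"
  shows "\<exists>G. bounded_clinear G \<and> (\<forall>f. P (G f) + e *\<^sub>R G f = f)"
proof -
  define B where "B f = P f + e *\<^sub>R f" for f
  have bP: "bounded_clinear P" using P by (rule positive_op_bounded_clinear)
  have bB: "bounded_clinear B" unfolding B_def[abs_def]
    by (intro bounded_clinear_add bP bounded_clinear_scaleR bounded_clinear_id)
  have low: "e * (norm f)\<^sup>2 \<le> inner (B f) f" for f
    using positive_op_nonneg[OF P, of f] by (simp add: B_def inner_add dot_square_norm)
  have pB: "positive_op B"
  proof (rule positive_opI[OF bB])
    show "0 \<le> inner (B f) f" for f by (rule order_trans[OF _ low]) (use e in auto)
  qed (simp add: B_def cinner_add_left cinner_add_right positive_op_symmetric[OF P])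
  interpret B: bounded_linear B using bB by (rule bounded_clinear_bounded_linear)
  obtain L where L: "L > 0" "\<And>x. norm (B x) \<le> norm x * L" using B.pos_bounded by blast
  \<comment> \<open>The contraction factor is sqrt (1 - e / L); \<open>max\<close> keeps the
    radicand nonnegative without a comparison of e and L.\<close>
  define c where "c = sqrt (max 0 (1 - e / L))"
  have c: "0 \<le> c" "c < 1" using e L by (auto simp: c_def)
  have con: "norm (f - (1 / L) *\<^sub>R B f) \<le> c * norm f" for f
  proof -
    have "(norm (f - (1 / L) *\<^sub>R B f))\<^sup>2 = (norm f)\<^sup>2 - 2 * inner (B f) f / L + (norm (B f))\<^sup>2 / L\<^sup>2"
      unfolding power2_norm_eq_inner by (simp add: inner_diff inner_commute power2_eq_square)
    moreover have "(norm (B f))\<^sup>2 / L\<^sup>2 \<le> inner (B f) f / L"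
      using norm_positive_op_square_le[OF pB, of L f] L
      by (simp add: mult.commute power2_eq_square field_simps)
    moreover have "e * (norm f)\<^sup>2 / L \<le> inner (B f) f / L" using low[of f] L by (simp add: divide_right_mono)
    ultimately have "(norm (f - (1 / L) *\<^sub>R B f))\<^sup>2 \<le> (1 - e / L) * (norm f)\<^sup>2" by (simp add: algebra_simps)
    also have "\<dots> \<le> max 0 (1 - e / L) * (norm f)\<^sup>2" by (intro mult_right_mono) auto
    also have "\<dots> = (c * norm f)\<^sup>2" by (simp add: c_def power_mult_distrib)
    finally show ?thesis by (rule power2_le_imp_le) (use c in simp)
  qed
  have "\<exists>x. B x = f" for f
  proof -
    define \<Phi> where "\<Phi> x = x - (1 / L) *\<^sub>R (B x - f)" for x
    have "\<exists>!x. \<Phi> x = x"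
    proof (rule banach_fix_type[OF c], intro allI)
      fix x y
      have "\<Phi> x - \<Phi> y = (x - y) - (1 / L) *\<^sub>R B (x - y)"
        by (simp add: \<Phi>_def B.diff algebra_simps)
      then show "dist (\<Phi> x) (\<Phi> y) \<le> c * dist x y" using con[of "x - y"] by (simp only: dist_norm)
    qed
    then obtain x where "\<Phi> x = x" by blast
    then have "B x = f" using L by (simp add: \<Phi>_def)
    then show ?thesis ..
  qed
  then obtain G where G: "\<And>f. B (G f) = f" by metis
  have nB: "e * norm f \<le> norm (B f)" for f
  proof (cases "f = 0")
    case False
    have "e * (norm f)\<^sup>2 \<le> norm (B f) * norm f" using low[of f] norm_cauchy_schwarz[of "B f" f] by simp
    then show ?thesis using False by (simp add: power2_eq_square)
  qed (simp add: B.zero)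
  have inj: "f = g" if "B f = B g" for f g
    using nB[of "f - g"] that e by (simp add: B.diff mult_le_0_iff)
  have "bounded_clinear G"
  proof (rule bounded_clinearI[where K = "1 / e"])
    show "G (f + g) = G f + G g" for f g by (rule inj) (simp add: G B.add)
    show "G (c *\<^sub>C f) = c *\<^sub>C G f" for c f by (rule inj) (simp add: G bounded_clinear_scaleC[OF bB])
    show "norm (G f) \<le> norm f * (1 / e)" for f using nB[of "G f"] e by (simp add: G field_simps)
  qed
  then show ?thesis using G by (auto simp: B_def)
qed

text \<open>The contraction \<open>T (|T| + \<epsilon>)\<^sup>-\<^sup>1\<close> replaces the partial isometry of the polar decomposition, whose
  construction would require orthogonal complements.\<close>

lemma approx_polar:
  fixes T :: "('n::finite) op"
  assumes T: "bounded_clinear T" and e: "e > 0"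
  shows "\<exists>W. contr W \<and> (\<forall>f. norm (T f - W (abs_op T f)) \<le> e * norm f) \<and>
    (\<forall>f. norm (adj W (T f) - abs_op T f) \<le> e * norm f)"
proof -
  define P where "P = abs_op T"
  have P: "positive_op P" using positive_abs_op[OF T] by (simp add: P_def)
  interpret P: bounded_linear P using P by (intro bounded_clinear_bounded_linear positive_op_bounded_clinear)
  interpret T: bounded_linear T using T by (rule bounded_clinear_bounded_linear)
  obtain G where bG: "bounded_clinear G" and G: "\<And>f. P (G f) + e *\<^sub>R G f = f"
    using ex_resolvent[OF P e] by blast
  interpret G: bounded_linear G using bG by (rule bounded_clinear_bounded_linear)
  \<comment> \<open>So far G is a right inverse of P + e; injectivity, again from positivity, makes
    it a left inverse.\<close>
  have GP: "G (P f + e *\<^sub>R f) = f" for f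
  proof -
    define g where "g = G (P f + e *\<^sub>R f) - f"
    have "P g + e *\<^sub>R g = 0" unfolding g_def
      using G[of "P f + e *\<^sub>R f"] by (simp add: P.diff algebra_simps)
    then have "inner (P g) g + e * (norm g)\<^sup>2 = 0"
      by (metis dot_square_norm inner_add_left inner_scaleR_left inner_zero_left)
    then have "g = 0" using positive_op_nonneg[OF P, of g] e
      by (smt (verit) mult_pos_pos zero_less_power2 norm_eq_zero)
    then show ?thesis by (simp add: g_def)
  qed
  have nPG: "norm (P (G f)) \<le> norm f" for f
  proof -
    \<comment> \<open>Expand the norm of f = P G f + e G f; the cross term is nonnegative.\<close>
    have "(norm f)\<^sup>2 = (norm (P (G f)))\<^sup>2 + 2 * e * inner (P (G f)) (G f) + e\<^sup>2 * (norm (G f))\<^sup>2"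
    proof -
      have "inner f f = inner (P (G f) + e *\<^sub>R G f) (P (G f) + e *\<^sub>R G f)" by (simp add: G)
      then show ?thesis unfolding power2_norm_eq_inner
        by (simp only: inner_add) (simp add: inner_commute power2_eq_square)
    qed
    moreover have "0 \<le> 2 * e * inner (P (G f)) (G f)" using positive_op_nonneg[OF P] e by simp
    moreover have "0 \<le> e\<^sup>2 * (norm (G f))\<^sup>2" by simp
    ultimately have "(norm (P (G f)))\<^sup>2 \<le> (norm f)\<^sup>2" by linarith
    then show ?thesis by (rule power2_le_imp_le) simp
  qed
  have nT: "norm (T f) = norm (P f)" for f using norm_abs_op[OF T] by (simp add: P_def)
  define W where "W f = T (G f)" for f
  have W: "contr W"
    using bounded_clinear_compose[OF T bG] by (simp add: contr_def W_def[abs_def] nT nPG)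
  show ?thesis unfolding P_def[symmetric]
  proof (intro exI[of _ W] conjI allI W)
    fix f
    \<comment> \<open>T is applied to f = G P f + e G f. The remainder is controlled because T and
      its modulus have the same norm at every vector.\<close>
    have "T f - W (P f) = e *\<^sub>R T (G f)"
      using GP[of f] by (metis G.add G.scaleR T.add T.scaleR W_def add_diff_cancel_left')
    then show "norm (T f - W (P f)) \<le> e * norm f" using nPG[of f] e by (simp add: nT)
    show "norm (adj W (T f) - P f) \<le> e * norm f"
    proof (rule norm_le_if_cinner_le)
      fix g
      have "cinner (adj W (T f)) g = cinner (T f) (T (G g))"
        using W by (simp add: contr_def cinner_adj_left W_def)
      also have "\<dots> = cinner (P f) (P (G g))" using cinner_abs_op[OF T] by (simp add: P_def)
      finally have "cinner (adj W (T f) - P f) g = cinner (P f) (P (G g) - g)"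
        by (simp add: cinner_diff_left cinner_diff_right)
      also have "P (G g) - g = - (e *\<^sub>R G g)" using G[of g] by (simp add: algebra_simps)
      also have "cinner (P f) (- (e *\<^sub>R G g)) = - (e * cinner f (P (G g)))"
        by (simp add: positive_op_symmetric[OF P])
      also have "cmod \<dots> \<le> e * (norm f * norm g)"
        using order_trans[OF Cauchy_Schwarz_cinner[of f "P (G g)"] mult_left_mono[OF nPG[of g], of "norm f"]] e
        by (simp add: norm_mult)
      finally show "cmod (cinner (adj W (T f) - P f) g) \<le> e * norm f * norm g" by simp
    qed (use e in simp)
  qed
qed

section \<open>The trace norm\<close>

lemma has_sum_finite_sum:
  fixes g :: "'a \<Rightarrow> 'b \<Rightarrow> 'c :: topological_comm_monoid_add"
  assumes "\<And>i. i \<in> I \<Longrightarrow> (g i has_sum s i) A"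
  shows "((\<lambda>x. \<Sum>i\<in>I. g i x) has_sum (\<Sum>i\<in>I. s i)) A"
  using assms by (induction I rule: infinite_finite_induct) (auto intro!: has_sum_add)

text \<open>Multiplication by a contraction does not increase the Hilbert-Schmidt norm. Expand each
  \<open>R (V f)\<close> by Parseval in \<open>E\<close>, exchange the sums, and apply Bessel in
  \<open>F\<close> to \<open>adj V (R e)\<close>.\<close>

lemma hilbert_schmidt_bound:
  fixes R :: "('n::finite) op"
  assumes R: "positive_op R" and V: "contr V" and F: "orthonormal F" "finite F"
    and E: "is_onb E" "(\<lambda>e. (norm (R e))\<^sup>2) summable_on E"
  shows "(\<Sum>f\<in>F. (norm (R (V f)))\<^sup>2) \<le> (\<Sum>\<^sub>\<infinity>e\<in>E. (norm (R e))\<^sup>2)"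
proof -
  have V': "contr (adj V)" "bounded_clinear V" using V contr_adj by (auto simp: contr_def)
  have c: "cmod (cinner (R (V f)) e) = cmod (cinner (adj V (R e)) f)" for f e
  proof -
    have "cinner (R (V f)) e = cinner f (adj V (R e))"
      by (simp add: positive_op_symmetric[OF R] cinner_adj_right[OF V'(2)])
    also have "\<dots> = cnj (cinner (adj V (R e)) f)" by (rule cinner_commute)
    finally show ?thesis by simp
  qed
  have "((\<lambda>e. (cmod (cinner (R (V f)) e))\<^sup>2) has_sum (norm (R (V f)))\<^sup>2) E" for f
    by (rule Parseval[OF E(1)])
  then have 1: "((\<lambda>e. \<Sum>f\<in>F. (cmod (cinner (adj V (R e)) f))\<^sup>2) has_sum (\<Sum>f\<in>F. (norm (R (V f)))\<^sup>2)) E"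
    unfolding c by (intro has_sum_finite_sum)
  have 2: "((\<lambda>e. (norm (R e))\<^sup>2) has_sum (\<Sum>\<^sub>\<infinity>e\<in>E. (norm (R e))\<^sup>2)) E" using E(2) by simp
  show ?thesis
  proof (rule has_sum_mono[OF 1 2])
    fix e
    have "(\<Sum>f\<in>F. (cmod (cinner (adj V (R e)) f))\<^sup>2) \<le> (norm (adj V (R e)))\<^sup>2" by (rule Bessel[OF F])
    also have "\<dots> \<le> (norm (R e))\<^sup>2" using V' by (intro power_mono) (auto simp: contr_def)
    finally show "(\<Sum>f\<in>F. (cmod (cinner (adj V (R e)) f))\<^sup>2) \<le> (norm (R e))\<^sup>2" .
  qed
qed

text \<open>With R the root of P, the diagonal entry at e is |R e|^2, so the Hilbert-Schmidt bound
  with the identity as contraction applies. One inequality is enough, since the bases may be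
  exchanged.\<close>

lemma trace_basis_independent:
  fixes P :: "('n::finite) op"
  assumes P: "positive_op P" and E: "is_onb E" "(\<lambda>e. inner (P e) e) summable_on E"
    and E': "is_onb E'"
  shows "(\<lambda>e. inner (P e) e) summable_on E'"
    and "(\<Sum>\<^sub>\<infinity>e\<in>E'. inner (P e) e) \<le> (\<Sum>\<^sub>\<infinity>e\<in>E. inner (P e) e)"
proof -
  obtain R where R: "positive_op R" "\<And>f. R (R f) = P f" using ex_positive_sqrt[OF P] by blast
  have eq: "inner (P e) e = (norm (R e))\<^sup>2" for e
    by (metis Re_cinner R dot_square_norm positive_op_symmetric)
  have le: "(\<Sum>e\<in>F. inner (P e) e) \<le> (\<Sum>\<^sub>\<infinity>e\<in>E. inner (P e) e)" if "finite F" "F \<subseteq> E'" for F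
    using hilbert_schmidt_bound[OF R(1) contr_id orthonormal_subset[OF is_onb_orthonormal[OF E'] that(2)] that(1) E(1)]
      E(2) by (simp add: eq)
  show s: "(\<lambda>e. inner (P e) e) summable_on E'"
    by (rule nonneg_bdd_above_summable_on) (auto simp: eq[symmetric] positive_op_nonneg[OF P] intro!: bdd_aboveI le)
  show "(\<Sum>\<^sub>\<infinity>e\<in>E'. inner (P e) e) \<le> (\<Sum>\<^sub>\<infinity>e\<in>E. inner (P e) e)"
    by (rule infsum_le_finite_sums[OF s]) (rule le)
qed

lemma trace_class_bounded_clinear: "trace_class T \<Longrightarrow> bounded_clinear T"
  by (simp add: trace_class_def)

text \<open>Reconciles the basis for which \<open>trace_class\<close> asserts summability with the
  one that \<open>trace_norm\<close> selects by \<open>SOME\<close>.\<close>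

lemma has_sum_trace_norm:
  fixes T :: "('n::finite) op"
  assumes T: "trace_class T" and E: "is_onb E"
  shows "((\<lambda>e. inner (abs_op T e) e) has_sum trace_norm T) E"
proof -
  have bT: "bounded_clinear T" using T by (rule trace_class_bounded_clinear)
  note P = positive_abs_op[OF bT]
  obtain E0 where E0: "is_onb E0" "(\<lambda>e. inner (abs_op T e) e) summable_on E0"
    using T unfolding trace_class_def Re_cinner by blast
  have E1: "is_onb (SOME E :: 'n L2 set. is_onb E)" using ex_onb by (rule someI_ex)
  note s = trace_basis_independent(1)[OF P E0]
  have "(\<Sum>\<^sub>\<infinity>e\<in>E. inner (abs_op T e) e) = trace_norm T"
    unfolding trace_norm_def Re_cinner
    using trace_basis_independent(2)[OF P E s[OF E] E1] trace_basis_independent(2)[OF P E1 s[OF E1] E]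
    by (rule antisym[rotated])
  then show ?thesis using s[OF E] by (metis has_sum_infsum)
qed

text \<open>The Hilbert-Schmidt bound handles \<open>F\<close> directly, so no basis extending it
  has to be chosen.\<close>

lemma sum_abs_op_le_trace_norm:
  fixes T :: "('n::finite) op"
  assumes T: "trace_class T" and F: "orthonormal F" "finite F"
  shows "(\<Sum>e\<in>F. inner (abs_op T e) e) \<le> trace_norm T"
proof -
  have bT: "bounded_clinear T" using T by (rule trace_class_bounded_clinear)
  note P = positive_abs_op[OF bT]
  obtain E :: "'n L2 set" where E: "is_onb E" using ex_onb by blast
  obtain R where R: "positive_op R" "\<And>f. R (R f) = abs_op T f" using ex_positive_sqrt[OF P] by blast
  have eq: "inner (abs_op T e) e = (norm (R e))\<^sup>2" for e
    by (metis Re_cinner R dot_square_norm positive_op_symmetric)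
  have h: "((\<lambda>e. (norm (R e))\<^sup>2) has_sum trace_norm T) E" using has_sum_trace_norm[OF T E] unfolding eq .
  show ?thesis
    using hilbert_schmidt_bound[OF R(1) contr_id F E has_sum_imp_summable[OF h]] infsumI[OF h]
    unfolding eq by simp
qed

lemma trace_norm_nonneg:
  assumes "trace_class T" shows "0 \<le> trace_norm T"
  using sum_abs_op_le_trace_norm[OF assms, of "{}"] by (simp add: orthonormal_def)

text \<open>Together with \<open>trace_class_if_pairing_le\<close>, this exhibits the trace norm as dual to the contractions. The
  factor with the sum over \<open>F\<close> alone is small for tails of a basis and yields finite rank approximation.\<close>

lemma trace_pairing_bound:
  fixes T :: "('n::finite) op"
  assumes T: "trace_class T" and V: "contr V" and F: "orthonormal F" "finite F"
  shows "cmod (\<Sum>e\<in>F. cinner (V (T e)) e) \<le> sqrt (\<Sum>e\<in>F. inner (abs_op T e) e) * sqrt (trace_norm T)"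
proof (rule field_le_epsilon)
  fix \<epsilon> :: real assume \<epsilon>: "\<epsilon> > 0"
  have bT: "bounded_clinear T" using T by (rule trace_class_bounded_clinear)
  have bV: "bounded_clinear V" and nV: "\<And>f. norm (V f) \<le> norm f" using V by (auto simp: contr_def)
  interpret V: bounded_linear V using bV by (rule bounded_clinear_bounded_linear)
  note P = positive_abs_op[OF bT]
  \<comment> \<open>Each of the \<open>card F\<close> terms will err by at most \<delta>; the added
    1 covers empty \<open>F\<close>.\<close>
  define \<delta> where "\<delta> = \<epsilon> / (card F + 1)"
  have \<delta>: "\<delta> > 0" using \<epsilon> by (simp add: \<delta>_def)
  have "(card F + 1) * \<delta> = \<epsilon>" by (simp add: \<delta>_def del: of_nat_Suc)
  then have \<delta>': "card F * \<delta> \<le> \<epsilon>" using \<delta> by (simp add: algebra_simps)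
  obtain W where W: "contr W" "\<And>f. norm (T f - W (abs_op T f)) \<le> \<delta> * norm f"
    using approx_polar[OF bT \<delta>] by blast
  \<comment> \<open>Writing the modulus as R R and moving V W to the other side turns each term into
    the inner product of \<open>R e\<close> and \<open>R (U e)\<close>. Cauchy-Schwarz over
    \<open>F\<close> leaves the partial trace in the first factor and, in the second, a
    Hilbert-Schmidt sum below the full trace norm.\<close>
  define U where "U = adj (\<lambda>f. V (W f))"
  have VW: "contr (\<lambda>f. V (W f))" by (rule contr_compose[OF V W(1)])
  have U: "contr U" unfolding U_def by (rule contr_adj[OF VW])
  obtain R where R: "positive_op R" "\<And>f. R (R f) = abs_op T f" using ex_positive_sqrt[OF P] by blast
  have eq: "inner (abs_op T e) e = (norm (R e))\<^sup>2" for e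
    by (metis Re_cinner R dot_square_norm positive_op_symmetric)
  obtain E :: "'n L2 set" where E: "is_onb E" using ex_onb by blast
  have h: "((\<lambda>e. (norm (R e))\<^sup>2) has_sum trace_norm T) E" using has_sum_trace_norm[OF T E] unfolding eq .
  have bdU: "(\<Sum>f\<in>F. (norm (R (U f)))\<^sup>2) \<le> trace_norm T"
    using hilbert_schmidt_bound[OF R(1) U F E has_sum_imp_summable[OF h]] infsumI[OF h] by simp
  have t: "cmod (cinner (V (T e)) e) \<le> norm (R e) * norm (R (U e)) + \<delta>" if e: "e \<in> F" for e
  proof -
    have ne: "norm e = 1" using orthonormal_norm[OF F(1) e] .
    have "cinner (V (W (abs_op T e))) e = cinner (R e) (R (U e))"
      using VW by (simp add: U_def cinner_adj_right contr_def positive_op_symmetric[OF R(1), symmetric] R(2))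
    then have "cmod (cinner (V (W (abs_op T e))) e) \<le> norm (R e) * norm (R (U e))"
      using Cauchy_Schwarz_cinner by metis
    moreover have "cmod (cinner (V (T e - W (abs_op T e))) e) \<le> \<delta>"
      using order_trans[OF Cauchy_Schwarz_cinner[of "V (T e - W (abs_op T e))" e]]
        order_trans[OF nV W(2)[of e]] ne by simp
    moreover have "cinner (V (T e)) e = cinner (V (W (abs_op T e))) e + cinner (V (T e - W (abs_op T e))) e"
      by (simp add: V.diff cinner_diff_left)
    ultimately show ?thesis using norm_triangle_ineq by (smt (verit))
  qed
  have "cmod (\<Sum>e\<in>F. cinner (V (T e)) e) \<le> (\<Sum>e\<in>F. norm (R e) * norm (R (U e)) + \<delta>)"
    by (rule sum_norm_le) (rule t)
  also have "\<dots> = (\<Sum>e\<in>F. \<bar>norm (R e)\<bar> * \<bar>norm (R (U e))\<bar>) + card F * \<delta>" by (simp add: sum.distrib)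
  also have "\<dots> \<le> L2_set (\<lambda>e. norm (R e)) F * L2_set (\<lambda>e. norm (R (U e))) F + \<epsilon>"
    using \<delta>' by (intro add_mono L2_set_mult_ineq)
  also have "L2_set (\<lambda>e. norm (R e)) F * L2_set (\<lambda>e. norm (R (U e))) F
      \<le> sqrt (\<Sum>e\<in>F. inner (abs_op T e) e) * sqrt (trace_norm T)"
    unfolding L2_set_def eq by (intro mult_left_mono real_sqrt_le_mono bdU) (simp add: sum_nonneg)
  finally show "cmod (\<Sum>e\<in>F. cinner (V (T e)) e)
      \<le> sqrt (\<Sum>e\<in>F. inner (abs_op T e) e) * sqrt (trace_norm T) + \<epsilon>" by simp
qed

lemma trace_pairing_le:
  assumes T: "trace_class T" and V: "contr V" and F: "orthonormal F" "finite F"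
  shows "cmod (\<Sum>e\<in>F. cinner (V (T e)) e) \<le> trace_norm T"
proof -
  have "cmod (\<Sum>e\<in>F. cinner (V (T e)) e) \<le> sqrt (\<Sum>e\<in>F. inner (abs_op T e) e) * sqrt (trace_norm T)"
    by (rule trace_pairing_bound[OF assms])
  also have "\<dots> \<le> sqrt (trace_norm T) * sqrt (trace_norm T)"
    by (intro mult_right_mono real_sqrt_le_mono sum_abs_op_le_trace_norm[OF T F])
      (simp add: trace_norm_nonneg[OF T])
  finally show ?thesis using trace_norm_nonneg[OF T] by simp
qed

text \<open>Testing with V = \<open>adj W\<close> from the approximate polar decomposition
  reproduces the partial traces of the modulus up to an arbitrarily small error, so contractions and
  the finite parts of a single basis suffice.\<close>

lemma trace_class_if_pairing_le:
  fixes T :: "('n::finite) op"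
  assumes T: "bounded_clinear T" and E: "is_onb E"
    and le: "\<And>V F. contr V \<Longrightarrow> finite F \<Longrightarrow> F \<subseteq> E \<Longrightarrow> cmod (\<Sum>e\<in>F. cinner (V (T e)) e) \<le> C"
  shows "trace_class T" and "trace_norm T \<le> C"
proof -
  note P = positive_abs_op[OF T]
  have oE: "orthonormal E" using E by (rule is_onb_orthonormal)
  have fin: "(\<Sum>e\<in>F. inner (abs_op T e) e) \<le> C" if F: "finite F" "F \<subseteq> E" for F
  proof (rule field_le_epsilon)
    fix \<epsilon> :: real assume \<epsilon>: "\<epsilon> > 0"
    define \<delta> where "\<delta> = \<epsilon> / (card F + 1)"
    have \<delta>: "\<delta> > 0" using \<epsilon> by (simp add: \<delta>_def)
  have "(card F + 1) * \<delta> = \<epsilon>" by (simp add: \<delta>_def del: of_nat_Suc)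
  then have \<delta>': "card F * \<delta> \<le> \<epsilon>" using \<delta> by (simp add: algebra_simps)
    obtain W where W: "contr W" "\<And>f. norm (adj W (T f) - abs_op T f) \<le> \<delta> * norm f"
      using approx_polar[OF T \<delta>] by blast
    have "(\<Sum>e\<in>F. inner (abs_op T e) e) \<le> (\<Sum>e\<in>F. Re (cinner (adj W (T e)) e) + \<delta>)"
    proof (rule sum_mono)
      fix e assume "e \<in> F"
      then have ne: "norm e = 1" using oE F by (auto intro: orthonormal_norm)
      have "inner (abs_op T e - adj W (T e)) e \<le> \<delta>"
        using norm_cauchy_schwarz[of "abs_op T e - adj W (T e)" e] W(2)[of e] ne
        by (simp add: norm_minus_commute)
      then show "inner (abs_op T e) e \<le> Re (cinner (adj W (T e)) e) + \<delta>"
        by (simp add: Re_cinner inner_diff_left)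
    qed
    also have "\<dots> = Re (\<Sum>e\<in>F. cinner (adj W (T e)) e) + card F * \<delta>" by (simp add: sum.distrib)
    also have "\<dots> \<le> C + \<epsilon>"
      using order_trans[OF complex_Re_le_cmod le[OF contr_adj[OF W(1)] F]] \<delta>' by (intro add_mono)
    finally show "(\<Sum>e\<in>F. inner (abs_op T e) e) \<le> C + \<epsilon>" .
  qed
  have s: "(\<lambda>e. inner (abs_op T e) e) summable_on E"
    by (rule nonneg_bdd_above_summable_on) (auto simp: positive_op_nonneg[OF P] intro!: bdd_aboveI fin)
  then show tc: "trace_class T" unfolding trace_class_def Re_cinner using T E by blast
  show "trace_norm T \<le> C" by (rule has_sum_le_finite_sums[OF has_sum_trace_norm[OF tc E] fin])
qed

section \<open>Rank one operators\<close>

definition rank_one :: "('n::finite) L2 \<Rightarrow> 'n L2 \<Rightarrow> 'n op" where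
  "rank_one u v f = cinner f v *\<^sub>C u"

lemma bounded_clinear_rank_one: "bounded_clinear (rank_one u v)"
proof (rule bounded_clinearI[where K = "norm v * norm u"])
  show "norm (rank_one u v f) \<le> norm f * (norm v * norm u)" for f
    using mult_right_mono[OF Cauchy_Schwarz_cinner[of f v] norm_ge_zero[of u]]
    by (simp add: rank_one_def mult.assoc)
qed (simp_all add: rank_one_def cinner_add_left scaleC_add_left)

lemma contr_rank_one:
  assumes "norm u \<le> 1" "norm v \<le> 1" shows "contr (rank_one u v)"
proof -
  have "norm (rank_one u v f) \<le> norm f" for f
  proof -
    have "norm (rank_one u v f) \<le> (norm f * norm v) * norm u"
      using mult_right_mono[OF Cauchy_Schwarz_cinner[of f v] norm_ge_zero[of u]] by (simp add: rank_one_def)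
    also have "\<dots> \<le> (norm f * 1) * 1"
      using assms by (intro mult_mono mult_left_mono) auto
    finally show ?thesis by simp
  qed
  then show ?thesis using bounded_clinear_rank_one by (simp add: contr_def)
qed

text \<open>Each pairing is a sum of products of the coefficients of \<open>V u\<close> and
  \<open>v\<close>; Cauchy-Schwarz and Bessel bound it.\<close>

lemma trace_norm_rank_one:
  fixes u v :: "('n::finite) L2"
  shows "trace_class (rank_one u v)" and "trace_norm (rank_one u v) \<le> norm u * norm v"
proof -
  obtain E :: "'n L2 set" where E: "is_onb E" using ex_onb by blast
  have le: "cmod (\<Sum>e\<in>F. cinner (V (rank_one u v e)) e) \<le> norm u * norm v"
    if V: "contr V" and F: "finite F" "F \<subseteq> E" for V F
  proof -
    have oF: "orthonormal F" using is_onb_orthonormal[OF E] F orthonormal_subset by blast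
    have bV: "bounded_clinear V" and nV: "norm (V u) \<le> norm u" using V by (auto simp: contr_def)
    have "cmod (\<Sum>e\<in>F. cinner (V (rank_one u v e)) e) \<le> (\<Sum>e\<in>F. \<bar>cmod (cinner (V u) e)\<bar> * \<bar>cmod (cinner v e)\<bar>)"
    proof (rule sum_norm_le)
      fix e
      have "cmod (cinner e v) = cmod (cinner v e)" by (metis cinner_commute complex_mod_cnj)
      then show "cmod (cinner (V (rank_one u v e)) e) \<le> \<bar>cmod (cinner (V u) e)\<bar> * \<bar>cmod (cinner v e)\<bar>"
        by (simp add: rank_one_def bounded_clinear_scaleC[OF bV] norm_mult mult.commute)
    qed
    also have "\<dots> \<le> L2_set (\<lambda>e. cmod (cinner (V u) e)) F * L2_set (\<lambda>e. cmod (cinner v e)) F"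
      by (rule L2_set_mult_ineq)
    also have "\<dots> \<le> norm (V u) * norm v"
      unfolding L2_set_def
      by (intro mult_mono real_le_lsqrt Bessel[OF oF F(1)] sum_nonneg) (auto simp: sum_nonneg)
    also have "\<dots> \<le> norm u * norm v" using nV by (intro mult_right_mono) auto
    finally show ?thesis .
  qed
  note * = trace_class_if_pairing_le[OF bounded_clinear_rank_one E le]
  show "trace_class (rank_one u v)" by (rule *(1))
  show "trace_norm (rank_one u v) \<le> norm u * norm v" by (rule *(2))
qed

text \<open>For unit vectors, the matrix coefficient is itself a trace pairing: the contraction
  \<open>rank_one u v\<close> and the system consisting of \<open>u\<close> alone.\<close>

lemma norm_cinner_le_trace_norm:
  assumes T: "trace_class T"
  shows "cmod (cinner (T u) v) \<le> trace_norm T * norm u * norm v"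
proof (cases "u = 0 \<or> v = 0")
  case True
  interpret bounded_linear T using T by (intro bounded_clinear_bounded_linear trace_class_bounded_clinear)
  show ?thesis using True zero by auto
next
  case False
  interpret bounded_linear T using T by (intro bounded_clinear_bounded_linear trace_class_bounded_clinear)
  define u' v' where "u' = (1 / norm u) *\<^sub>R u" and "v' = (1 / norm v) *\<^sub>R v"
  have n: "norm u' = 1" "norm v' = 1" using False by (auto simp: u'_def v'_def)
  have "orthonormal {u'}" using n by (simp add: orthonormal_def cinner_self)
  then have "cmod (\<Sum>e\<in>{u'}. cinner (rank_one u' v' (T e)) e) \<le> trace_norm T"
    using n by (intro trace_pairing_le[OF T] contr_rank_one) auto
  then have "cmod (cinner (T u') v') \<le> trace_norm T"
    using n by (simp add: rank_one_def cinner_self)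
  moreover have "cinner (T u') v' = complex_of_real (1 / norm u * (1 / norm v)) * cinner (T u) v"
    by (simp add: u'_def v'_def scaleR)
  ultimately have "(1 / norm u * (1 / norm v)) * cmod (cinner (T u) v) \<le> trace_norm T"
    by (simp only: norm_mult norm_of_real) simp
  then show ?thesis using False by (simp add: field_simps)
qed

lemma norm_le_trace_norm:
  assumes T: "trace_class T" shows "norm (T u) \<le> trace_norm T * norm u"
  by (rule norm_le_if_cinner_le) (auto simp: norm_cinner_le_trace_norm[OF T] trace_norm_nonneg[OF T])

section \<open>The Banach space \<open>S\<^sup>1\<close>\<close>

text \<open>The modulus of a sum is not dominated by the sum of the moduli as an operator. The
  pairing, however, is linear in the operator, so the triangle inequality is read off from the dual
  description.\<close>

lemma trace_class_add:
  fixes S T :: "('n::finite) op"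
  assumes S: "trace_class S" and T: "trace_class T"
  shows "trace_class (\<lambda>f. S f + T f)" and "trace_norm (\<lambda>f. S f + T f) \<le> trace_norm S + trace_norm T"
proof -
  obtain E :: "'n L2 set" where E: "is_onb E" using ex_onb by blast
  have le: "cmod (\<Sum>e\<in>F. cinner (V (S e + T e)) e) \<le> trace_norm S + trace_norm T"
    if V: "contr V" and F: "finite F" "F \<subseteq> E" for V F
  proof -
    have oF: "orthonormal F" using is_onb_orthonormal[OF E] F orthonormal_subset by blast
    interpret V: bounded_linear V using V by (simp add: contr_def bounded_clinear_bounded_linear)
    have "(\<Sum>e\<in>F. cinner (V (S e + T e)) e) = (\<Sum>e\<in>F. cinner (V (S e)) e) + (\<Sum>e\<in>F. cinner (V (T e)) e)"
      by (simp add: V.add cinner_add_left sum.distrib)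
    then show ?thesis
      using order_trans[OF norm_triangle_ineq
        add_mono[OF trace_pairing_le[OF S V oF F(1)] trace_pairing_le[OF T V oF F(1)]]] by simp
  qed
  have b: "bounded_clinear (\<lambda>f. S f + T f)"
    by (intro bounded_clinear_add trace_class_bounded_clinear S T)
  show "trace_class (\<lambda>f. S f + T f)"
    by (rule trace_class_if_pairing_le(1)[OF b E]) (rule le)
  show "trace_norm (\<lambda>f. S f + T f) \<le> trace_norm S + trace_norm T"
    by (rule trace_class_if_pairing_le(2)[OF b E]) (rule le)
qed

lemma trace_class_scaleC_le:
  fixes T :: "('n::finite) op"
  assumes T: "trace_class T"
  shows "trace_class (\<lambda>f. c *\<^sub>C T f)" and "trace_norm (\<lambda>f. c *\<^sub>C T f) \<le> cmod c * trace_norm T"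
proof -
  obtain E :: "'n L2 set" where E: "is_onb E" using ex_onb by blast
  have le: "cmod (\<Sum>e\<in>F. cinner (V (c *\<^sub>C T e)) e) \<le> cmod c * trace_norm T"
    if V: "contr V" and F: "finite F" "F \<subseteq> E" for V F
  proof -
    have oF: "orthonormal F" using is_onb_orthonormal[OF E] F orthonormal_subset by blast
    have "(\<Sum>e\<in>F. cinner (V (c *\<^sub>C T e)) e) = c * (\<Sum>e\<in>F. cinner (V (T e)) e)"
      using V by (simp add: contr_def bounded_clinear_scaleC sum_distrib_left)
    then show ?thesis
      using trace_pairing_le[OF T V oF F(1)] by (simp add: norm_mult mult_left_mono)
  qed
  note * = trace_class_if_pairing_le[OF bounded_clinear_scale[OF T[THEN trace_class_bounded_clinear]] E le]
  show "trace_class (\<lambda>f. c *\<^sub>C T f)" by (rule *(1))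
  show "trace_norm (\<lambda>f. c *\<^sub>C T f) \<le> cmod c * trace_norm T" by (rule *(2))
qed

lemma trace_norm_zero: "trace_class (\<lambda>f. 0 :: ('n::finite) L2)" "trace_norm (\<lambda>f. 0 :: 'n L2) = 0"
proof -
  have z: "rank_one 0 0 = (\<lambda>f. 0 :: 'n L2)" by (simp add: rank_one_def fun_eq_iff)
  show "trace_class (\<lambda>f. 0 :: 'n L2)" using trace_norm_rank_one(1)[of "0 :: 'n L2" 0] by (simp add: z)
  then have "0 \<le> trace_norm (\<lambda>f. 0 :: 'n L2)" by (rule trace_norm_nonneg)
  then show "trace_norm (\<lambda>f. 0 :: 'n L2) = 0"
    using trace_norm_rank_one(2)[of "0 :: 'n L2" 0] by (simp add: z)
qed

lemma trace_norm_scaleC: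
  fixes T :: "('n::finite) op"
  assumes T: "trace_class T"
  shows "trace_norm (\<lambda>f. c *\<^sub>C T f) = cmod c * trace_norm T"
proof (cases "c = 0")
  case True
  then show ?thesis using trace_norm_zero by simp
next
  case False
  have "trace_norm (\<lambda>f. (1 / c) *\<^sub>C c *\<^sub>C T f) \<le> cmod (1 / c) * trace_norm (\<lambda>f. c *\<^sub>C T f)"
    by (rule trace_class_scaleC_le(2)[OF trace_class_scaleC_le(1)[OF T]])
  then have "trace_norm T \<le> trace_norm (\<lambda>f. c *\<^sub>C T f) / cmod c"
    using False by (simp add: norm_divide)
  then have "cmod c * trace_norm T \<le> trace_norm (\<lambda>f. c *\<^sub>C T f)" using False by (simp add: field_simps)
  then show ?thesis using trace_class_scaleC_le(2)[OF T, of c] by simp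
qed

lemma trace_class_diff:
  fixes S T :: "('n::finite) op"
  assumes S: "trace_class S" and T: "trace_class T"
  shows "trace_class (\<lambda>f. S f - T f)"
  using trace_class_add(1)[OF S trace_class_scaleC_le(1)[OF T, of "-1"]] by (simp add: scaleC_minus1)

lemma S1_space_simps [simp]:
  "car S1_space = {T. trace_class T}" "vzero S1_space = (\<lambda>_. 0)" "vadd S1_space = (\<lambda>S T f. S f + T f)"
  "vscale S1_space = (\<lambda>c T f. c *\<^sub>C T f)" "vnorm S1_space = trace_norm"
  by (auto simp: S1_space_def)

lemma vdist_S1_space: "vdist S1_space S T = trace_norm (\<lambda>f. S f - T f)"
  by (simp add: vdist_def scaleC_minus1)

text \<open>The operator norm is below the trace norm, so the sequence converges at each vector. A
  pairing involves finitely many vectors only, hence passes to this limit and keeps the Cauchy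
  bound; this turns pointwise into trace norm convergence.\<close>

lemma S1_complete:
  fixes X :: "nat \<Rightarrow> ('n::finite) op"
  assumes X: "\<And>n. trace_class (X n)"
    and cau: "\<And>e. e > 0 \<Longrightarrow> \<exists>N. \<forall>m\<ge>N. \<forall>n\<ge>N. trace_norm (\<lambda>f. X m f - X n f) < e"
  shows "\<exists>T. trace_class T \<and> (\<lambda>n. trace_norm (\<lambda>f. X n f - T f)) \<longlonglongrightarrow> 0"
proof -
  note bX = trace_class_bounded_clinear[OF X]
  have linX: "linear (X n)" for n using bounded_linear.linear[OF bounded_clinear_bounded_linear[OF bX]] .
  have nd: "norm (X m f - X n f) \<le> trace_norm (\<lambda>f. X m f - X n f) * norm f" for m n f
    using norm_le_trace_norm[OF trace_class_diff[OF X X]] by blast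
  have "convergent (\<lambda>n. X n f)" for f
  proof (rule Cauchy_convergent, rule CauchyI)
    fix e :: real assume e: "e > 0"
    have "e / (norm f + 1) > 0" using e by (auto intro!: divide_pos_pos add_nonneg_pos)
    from cau[OF this] obtain N where
      N: "\<And>m n. m \<ge> N \<Longrightarrow> n \<ge> N \<Longrightarrow> trace_norm (\<lambda>f. X m f - X n f) < e / (norm f + 1)" by blast
    show "\<exists>N. \<forall>m\<ge>N. \<forall>n\<ge>N. norm (X m f - X n f) < e"
    proof (intro exI allI impI)
      fix m n assume "m \<ge> N" "n \<ge> N"
      have "norm (X m f - X n f) \<le> e / (norm f + 1) * norm f"
        using nd[of m f n] mult_right_mono[OF less_imp_le[OF N[OF \<open>m \<ge> N\<close> \<open>n \<ge> N\<close>]], of "norm f"] by simp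
      also have "\<dots> < e / (norm f + 1) * (norm f + 1)"
        using \<open>e / (norm f + 1) > 0\<close> by (intro mult_strict_left_mono) auto
      also have "\<dots> = e" using norm_ge_zero[of f] by (simp del: norm_ge_zero)
      finally show "norm (X m f - X n f) < e" .
    qed
  qed
  then have "\<exists>g. (\<lambda>n. X n f) \<longlonglongrightarrow> g" for f by (simp add: convergent_def)
  then obtain T where T: "\<And>f. (\<lambda>n. X n f) \<longlonglongrightarrow> T f" by metis
  obtain N1 where N1: "\<And>m n. m \<ge> N1 \<Longrightarrow> n \<ge> N1 \<Longrightarrow> trace_norm (\<lambda>f. X m f - X n f) < 1"
    using cau[of 1] by auto
  have bT: "bounded_clinear T"
  proof (rule bounded_clinearI[where K = "1 + trace_norm (X N1)"])
    show "T (f + g) = T f + T g" for f g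
      by (rule LIMSEQ_unique[OF T]) (simp add: linear_add[OF linX] tendsto_add T)
    show "T (c *\<^sub>C f) = c *\<^sub>C T f" for c f
      by (rule LIMSEQ_unique[OF T]) (simp add: bounded_clinear_scaleC[OF bX] tendsto_scaleC T)
    fix f
    have "norm (X n f) \<le> norm f * (1 + trace_norm (X N1))" if "n \<ge> N1" for n
    proof -
      have "norm (X n f) \<le> norm (X n f - X N1 f) + norm (X N1 f)"
        using norm_triangle_sub[of "X n f" "X N1 f"] by simp
      also have "\<dots> \<le> 1 * norm f + trace_norm (X N1) * norm f"
        using nd[of n f N1] mult_right_mono[OF less_imp_le[OF N1[OF that order_refl]], of "norm f"]
          norm_le_trace_norm[OF X, of N1 f] by simp
      finally show ?thesis by (simp add: algebra_simps)
    qed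
    then show "norm (T f) \<le> norm f * (1 + trace_norm (X N1))"
      using LIMSEQ_le_const2[OF tendsto_norm[OF T]] by blast
  qed
  obtain E :: "'n L2 set" where E: "is_onb E" using ex_onb by blast
  have close: "trace_class (\<lambda>f. X n f - T f) \<and> trace_norm (\<lambda>f. X n f - T f) \<le> e"
    if N: "\<And>m n. m \<ge> N \<Longrightarrow> n \<ge> N \<Longrightarrow> trace_norm (\<lambda>f. X m f - X n f) < e" and n: "n \<ge> N" for e N n
  proof -
    have le: "cmod (\<Sum>e\<in>F. cinner (V (X n e - T e)) e) \<le> e" if V: "contr V" and F: "finite F" "F \<subseteq> E" for V F
    proof -
      have oF: "orthonormal F" using is_onb_orthonormal[OF E] F orthonormal_subset by blast
      have blV: "bounded_linear V" using V by (simp add: contr_def bounded_clinear_bounded_linear)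
      have "(\<lambda>m. cmod (\<Sum>e\<in>F. cinner (V (X n e - X m e)) e)) \<longlonglongrightarrow> cmod (\<Sum>e\<in>F. cinner (V (X n e - T e)) e)"
        by (intro tendsto_norm tendsto_sum tendsto_cinner bounded_linear.tendsto[OF blV] tendsto_diff tendsto_const T)
      moreover have "cmod (\<Sum>e\<in>F. cinner (V (X n e - X m e)) e) \<le> e" if "m \<ge> N" for m
        using trace_pairing_le[OF trace_class_diff[OF X X] V oF F(1), of n m] N[OF n that] by simp
      ultimately show ?thesis using LIMSEQ_le_const2 by blast
    qed
    show ?thesis
      using trace_class_if_pairing_le[OF bounded_clinear_diff[OF bX bT] E le] by blast
  qed
  have "trace_class (\<lambda>f. X N1 f - T f)" using close[OF N1] by blast
  then have tT: "trace_class T" using trace_class_diff[OF X[of N1]] by fastforce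
  moreover have "(\<lambda>n. trace_norm (\<lambda>f. X n f - T f)) \<longlonglongrightarrow> 0"
  proof (rule LIMSEQ_I)
    fix e :: real assume e: "e > 0"
    obtain N where N: "\<And>m n. m \<ge> N \<Longrightarrow> n \<ge> N \<Longrightarrow> trace_norm (\<lambda>f. X m f - X n f) < e / 2"
      using cau[of "e / 2"] e by auto
    have "norm (trace_norm (\<lambda>f. X n f - T f) - 0) < e" if "n \<ge> N" for n
      using close[OF N that] trace_norm_nonneg[OF trace_class_diff[OF X tT], of n] e by simp
    then show "\<exists>N. \<forall>n\<ge>N. norm (trace_norm (\<lambda>f. X n f - T f) - 0) < e" by blast
  qed
  ultimately show ?thesis by blast
qed

lemma cbanach_space_S1: "cbanach_space S1_space"
proof
  fix S T U :: "'a op" and c c' and X :: "nat \<Rightarrow> 'a op"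
  show "vzero S1_space \<in> (car S1_space :: 'a op set)" by (simp add: trace_norm_zero)
  show "vadd S1_space S T \<in> car S1_space" if "S \<in> car S1_space" "T \<in> car S1_space"
    using that by (simp add: trace_class_add)
  show "vscale S1_space c S \<in> car S1_space" if "S \<in> car S1_space"
    using that by (simp add: trace_class_scaleC_le)
  show "vnorm S1_space S = 0 \<longleftrightarrow> S = vzero S1_space" if "S \<in> car S1_space"
  proof
    assume "vnorm S1_space S = 0"
    then have "S u = 0" for u using norm_le_trace_norm[of S u] that by simp
    then show "S = vzero S1_space" by (simp add: fun_eq_iff)
  qed (simp add: trace_norm_zero)
  show "vnorm S1_space (vscale S1_space c S) = cmod c * vnorm S1_space S" if "S \<in> car S1_space"
    using that by (simp add: trace_norm_scaleC)
  show "vnorm S1_space (vadd S1_space S T) \<le> vnorm S1_space S + vnorm S1_space T"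
    if "S \<in> car S1_space" "T \<in> car S1_space"
    using that by (simp add: trace_class_add)
  show "\<exists>l\<in>car S1_space. vlim S1_space X l" if "range X \<subseteq> car S1_space" "vcauchy S1_space X"
    using that S1_complete[of X] unfolding vlim_def vcauchy_def vdist_S1_space by auto
qed (simp_all add: algebra_simps scaleC_add_right scaleC_add_left scaleC_minus1)

section \<open>Finite rank approximation\<close>

text \<open>The approximant is T composed with the projection onto the span of \<open>F\<close>.
  Pairings with the difference only see basis vectors outside \<open>F\<close>, and
  \<open>trace_pairing_bound\<close> makes them as small as the root of the tail of the
  trace.\<close>

lemma trace_norm_finite_rank_approx:
  fixes T :: "('n::finite) op"
  assumes T: "trace_class T" and E: "is_onb E" and \<epsilon>: "\<epsilon> > 0"
  obtains F where "finite F" "F \<subseteq> E" "trace_norm (\<lambda>f. T f - (\<Sum>e\<in>F. rank_one (T e) e f)) < \<epsilon>"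
proof -
  note bT = trace_class_bounded_clinear[OF T]
  interpret T: bounded_linear T using bT by (rule bounded_clinear_bounded_linear)
  note P = positive_abs_op[OF bT]
  have oE: "orthonormal E" using E by (rule is_onb_orthonormal)
  have hs: "((\<lambda>e. inner (abs_op T e) e) has_sum trace_norm T) E" by (rule has_sum_trace_norm[OF T E])
  define \<tau> where "\<tau> = trace_norm T"
  have \<tau>: "0 \<le> \<tau>" using trace_norm_nonneg[OF T] by (simp add: \<tau>_def)
  \<comment> \<open>Chosen so that sqrt \<delta> * sqrt \<tau> is at most \<epsilon> / 2; the added
    1 covers \<tau> = 0.\<close>
  define \<delta> where "\<delta> = \<epsilon>\<^sup>2 / (4 * (\<tau> + 1))"
  have \<delta>: "\<delta> > 0" "\<delta> * \<tau> \<le> (\<epsilon> / 2)\<^sup>2"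
    using \<epsilon> \<tau> by (auto simp: \<delta>_def power2_eq_square field_simps)
  obtain F where F: "finite F" "F \<subseteq> E" "dist (\<Sum>e\<in>F. inner (abs_op T e) e) (trace_norm T) \<le> \<delta>"
    using has_sum_finite_approximation[OF hs \<delta>(1)] by blast
  have tail: "(\<Sum>e\<in>G. inner (abs_op T e) e) \<le> \<delta>" if G: "finite G" "G \<subseteq> E" "G \<inter> F = {}" for G
  proof -
    have "(\<Sum>e\<in>G. inner (abs_op T e) e) + (\<Sum>e\<in>F. inner (abs_op T e) e) = (\<Sum>e\<in>G \<union> F. inner (abs_op T e) e)"
      using G F by (simp add: sum.union_disjoint)
    also have "\<dots> \<le> trace_norm T"
      using G F by (intro sum_abs_op_le_trace_norm[OF T] orthonormal_subset[OF oE]) auto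
    finally show ?thesis using F(3) by (simp add: dist_real_def)
  qed
  define S where "S f = (\<Sum>e\<in>F. rank_one (T e) e f)" for f
  have TS: "S f = T (proj_sum F f)" for f
    by (simp add: S_def rank_one_def proj_sum_def T.sum bounded_clinear_scaleC[OF bT])
  have SE: "S e = (if e \<in> F then T e else 0)" if "e \<in> E" for e
  proof -
    have "S e = (\<Sum>e'\<in>F. if e' = e then T e else 0)"
      unfolding S_def rank_one_def
      by (intro sum.cong) (use F that oE in \<open>auto simp: orthonormal_def subset_iff\<close>)
    then show ?thesis using F by simp
  qed
  have bS: "bounded_clinear S"
    unfolding S_def
  proof (induction F rule: infinite_finite_induct)
    case (insert e F)
    then show ?case using bounded_clinear_add[OF bounded_clinear_rank_one insert(3)] by simp
  qed (simp_all add: bounded_clinear_zero)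
  have le: "cmod (\<Sum>e\<in>G. cinner (V (T e - S e)) e) \<le> \<epsilon> / 2" if V: "contr V" and G: "finite G" "G \<subseteq> E" for V G
  proof -
    interpret V: bounded_linear V using V by (simp add: contr_def bounded_clinear_bounded_linear)
    have "(\<Sum>e\<in>G. cinner (V (T e - S e)) e) = (\<Sum>e\<in>G - F. cinner (V (T e)) e)"
      by (rule sum.mono_neutral_cong_right) (use G SE in \<open>auto simp: V.zero subset_iff\<close>)
    also have "cmod \<dots> \<le> sqrt (\<Sum>e\<in>G - F. inner (abs_op T e) e) * sqrt (trace_norm T)"
      using G by (intro trace_pairing_bound[OF T V] orthonormal_subset[OF oE]) auto
    also have "\<dots> \<le> sqrt \<delta> * sqrt (trace_norm T)"
      using G \<tau> by (intro mult_right_mono real_sqrt_le_mono tail) (auto simp: \<tau>_def)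
    also have "\<dots> \<le> sqrt ((\<epsilon> / 2)\<^sup>2)"
      using \<delta>(2) by (simp only: real_sqrt_mult[symmetric] \<tau>_def real_sqrt_le_iff)
    also have "\<dots> = \<epsilon> / 2" using \<epsilon> by simp
    finally show ?thesis .
  qed
  have "trace_norm (\<lambda>f. T f - S f) \<le> \<epsilon> / 2"
    by (rule trace_class_if_pairing_le(2)[OF bounded_clinear_diff[OF bT bS] E le])
  then have "trace_norm (\<lambda>f. T f - S f) < \<epsilon>" using \<epsilon> by simp
  then show thesis using that[OF F(1,2)] by (simp add: S_def)
qed

section \<open>The Jordan decomposition\<close>

text \<open>Finite real measures. Boundedness is stated as one constant for all Borel sets, the form
  in which it passes to the positive part.\<close>

definition signed_cmeas :: "('a::euclidean_space set \<Rightarrow> real) \<Rightarrow> bool" where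
  "signed_cmeas u \<longleftrightarrow>
     (\<forall>A :: nat \<Rightarrow> 'a set. range A \<subseteq> sets borel \<longrightarrow> disjoint_family A \<longrightarrow> (\<lambda>n. u (A n)) sums u (\<Union>n. A n)) \<and>
     (\<exists>C. \<forall>B\<in>sets borel. \<bar>u B\<bar> \<le> C)"

lemma signed_cmeas_sums:
  "signed_cmeas u \<Longrightarrow> range A \<subseteq> sets borel \<Longrightarrow> disjoint_family A \<Longrightarrow> (\<lambda>n. u (A n)) sums u (\<Union>n. A n)"
  by (auto simp: signed_cmeas_def)

lemma signed_cmeas_empty: assumes "signed_cmeas u" shows "u {} = 0"
proof -
  have "(\<lambda>n::nat. u {}) sums u (\<Union>n::nat. {})"
    by (rule signed_cmeas_sums[OF assms, of "\<lambda>_. {}"]) (auto simp: disjoint_family_on_def)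
  then have "(\<lambda>n::nat. u {}) \<longlonglongrightarrow> 0" by (intro summable_LIMSEQ_zero) (rule sums_summable)
  then show ?thesis by (simp add: LIMSEQ_const_iff)
qed

lemma signed_cmeas_Un:
  assumes "signed_cmeas u" "A \<in> sets borel" "B \<in> sets borel" "A \<inter> B = {}"
  shows "u (A \<union> B) = u A + u B"
proof -
  have "(\<lambda>n. u (binaryset A B n)) sums u (\<Union>n. binaryset A B n)"
    using assms by (intro signed_cmeas_sums)
      (auto simp: range_binaryset_eq disjoint_family_on_def binaryset_def)
  moreover have "(\<lambda>n. u (binaryset A B n)) sums (u A + u B)"
    by (rule binaryset_sums[of u A B]) (rule signed_cmeas_empty[OF assms(1)])
  ultimately show ?thesis by (metis UN_binaryset_eq sums_unique2)
qed

lemma signed_cmeas_uminus: "signed_cmeas u \<Longrightarrow> signed_cmeas (\<lambda>A. - u A)"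
  unfolding signed_cmeas_def by (auto intro: sums_minus)

lemma ennreal_sum_le: "ennreal (\<Sum>i\<in>I. a i) \<le> (\<Sum>i\<in>I. ennreal (a i))"
proof (induction I rule: infinite_finite_induct)
  case (insert i I)
  have "ennreal (a i + (\<Sum>i\<in>I. a i)) \<le> ennreal (max 0 (a i) + max 0 (\<Sum>i\<in>I. a i))"
    by (intro ennreal_leI) auto
  also have "\<dots> = ennreal (max 0 (a i)) + ennreal (max 0 (\<Sum>i\<in>I. a i))" by (rule ennreal_plus) auto
  also have "\<dots> = ennreal (a i) + ennreal (\<Sum>i\<in>I. a i)" by (simp add: ennreal_max_0)
  also have "\<dots> \<le> ennreal (a i) + (\<Sum>i\<in>I. ennreal (a i))" by (intro add_left_mono insert.IH)
  finally show ?case using insert by simp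
qed auto

lemma sets_pos_part [measurable_cong, simp]: "sets (pos_part u) = sets borel"
  by (simp add: pos_part_def sets.sigma_sets_eq[of borel, simplified])

lemma space_pos_part [simp]: "space (pos_part u) = UNIV"
  by (simp add: pos_part_def)

text \<open>\<open>measure_of\<close> takes the intended values only for a countably additive set
  function. Joining competitors from disjoint sets gives superadditivity; cutting a competitor
  \<open>A\<close> along the sets \<open>B i\<close> gives the reverse inequality.\<close>

lemma emeasure_pos_part:
  assumes u: "signed_cmeas u" and B: "B \<in> sets borel"
  shows "emeasure (pos_part u) B = (SUP A \<in> {A \<in> sets borel. A \<subseteq> B}. ennreal (u A))"
proof -
  define p where "p B = (SUP A \<in> {A \<in> sets borel. A \<subseteq> B}. ennreal (u A))" for B
  have pI: "ennreal (u A) \<le> p B" if "A \<in> sets borel" "A \<subseteq> B" for A B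
    unfolding p_def by (rule SUP_upper) (use that in auto)
  have p_mono: "p B \<le> p B'" if "B \<subseteq> B'" for B B'
    unfolding p_def by (rule SUP_subset_mono) (use that in auto)
  have super2: "p B1 + p B2 \<le> p (B1 \<union> B2)" if "B1 \<inter> B2 = {}" for B1 B2
  proof -
    \<comment> \<open>\<open>ennreal\<close> sends negative values to 0: in that case one of the
      sets may be dropped, otherwise their disjoint union is a competitor.\<close>
    have *: "ennreal (u A1) + ennreal (u A2) \<le> p (B1 \<union> B2)"
      if A: "A1 \<in> sets borel" "A2 \<in> sets borel" "A1 \<subseteq> B1" "A2 \<subseteq> B2" for A1 A2
    proof (cases "u A1 \<ge> 0 \<and> u A2 \<ge> 0")
      case True
      have "A1 \<inter> A2 = {}" using A \<open>B1 \<inter> B2 = {}\<close> by auto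
      then have "ennreal (u A1) + ennreal (u A2) = ennreal (u (A1 \<union> A2))"
        using True A by (simp add: signed_cmeas_Un[OF u] ennreal_plus)
      also have "\<dots> \<le> p (B1 \<union> B2)" using A by (intro pI) auto
      finally show ?thesis .
    next
      case False
      then have "ennreal (u A1) = 0 \<or> ennreal (u A2) = 0" by (auto simp: ennreal_neg)
      moreover have "A1 \<subseteq> B1 \<union> B2" "A2 \<subseteq> B1 \<union> B2" using A by auto
      ultimately show ?thesis using pI[of A1 "B1 \<union> B2"] pI[of A2 "B1 \<union> B2"] A by auto
    qed
    have ne: "{A \<in> sets borel. A \<subseteq> B} \<noteq> {}" for B :: "'a set" by auto
    have "p B1 + p B2 = (SUP A1\<in>{A \<in> sets borel. A \<subseteq> B1}. ennreal (u A1) + p B2)"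
      unfolding p_def[of B1] by (rule ennreal_SUP_add_left[symmetric, OF ne])
    also have "\<dots> = (SUP A1\<in>{A \<in> sets borel. A \<subseteq> B1}. SUP A2\<in>{A \<in> sets borel. A \<subseteq> B2}. ennreal (u A1) + ennreal (u A2))"
      unfolding p_def[of B2] by (intro SUP_cong refl ennreal_SUP_add_right ne)
    also have "\<dots> \<le> p (B1 \<union> B2)" by (intro SUP_least) (auto intro: *)
    finally show ?thesis .
  qed
  have "countably_additive (sets borel) p"
  proof (rule countably_additiveI)
    fix B :: "nat \<Rightarrow> 'a set" assume B: "range B \<subseteq> sets borel" "disjoint_family B" "(\<Union>n. B n) \<in> sets borel"
    have "(\<Sum>i<n. p (B i)) \<le> p (\<Union>i<n. B i)" for n
    proof (induction n)
      case (Suc n)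
      have "(\<Sum>i<Suc n. p (B i)) \<le> p (\<Union>i<n. B i) + p (B n)"
        unfolding sum.lessThan_Suc by (intro add_right_mono Suc.IH)
      also have "\<dots> \<le> p ((\<Union>i<n. B i) \<union> B n)"
      proof (rule super2)
        have "B i \<inter> B n = {}" if "i < n" for i
          using disjoint_family_onD[OF B(2), of i n] that by simp
        then show "(\<Union>i<n. B i) \<inter> B n = {}" by blast
      qed
      finally show ?case by (simp add: lessThan_Suc Un_commute)
    qed simp
    then have "(\<Sum>i<n. p (B i)) \<le> p (\<Union>n. B n)" for n
      by (rule order_trans[OF _ p_mono]) blast
    then have 1: "(\<Sum>i. p (B i)) \<le> p (\<Union>n. B n)"
      unfolding suminf_eq_SUP by (rule SUP_least)
    have "p (\<Union>n. B n) \<le> (\<Sum>i. p (B i))" unfolding p_def[of "\<Union>n. B n"]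
    proof (rule SUP_least)
      fix A assume A: "A \<in> {A \<in> sets borel. A \<subseteq> (\<Union>n. B n)}"
      have AB: "(\<Union>i. A \<inter> B i) = A" using A by auto
      have "(\<lambda>i. u (A \<inter> B i)) sums u (\<Union>i. A \<inter> B i)"
        by (rule signed_cmeas_sums[OF u]) (use A B in \<open>auto simp: disjoint_family_on_def\<close>)
      then have "(\<lambda>n. ennreal (\<Sum>i<n. u (A \<inter> B i))) \<longlonglongrightarrow> ennreal (u A)"
        unfolding sums_def AB by (rule tendsto_ennrealI)
      moreover have "ennreal (\<Sum>i<n. u (A \<inter> B i)) \<le> (\<Sum>i. p (B i))" for n
      proof -
        have "ennreal (\<Sum>i<n. u (A \<inter> B i)) \<le> (\<Sum>i<n. ennreal (u (A \<inter> B i)))" by (rule ennreal_sum_le)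
        also have "\<dots> \<le> (\<Sum>i<n. p (B i))" by (intro sum_mono pI) (use A B in auto)
        also have "\<dots> \<le> (\<Sum>i. p (B i))" by (rule sum_le_suminf) auto
        finally show ?thesis .
      qed
      ultimately show "ennreal (u A) \<le> (\<Sum>i. p (B i))" using LIMSEQ_le_const2 by blast
    qed
    with 1 show "(\<Sum>i. p (B i)) = p (\<Union>n. B n)" by (rule antisym)
  qed
  moreover have "positive (sets borel) p"
    unfolding positive_def p_def by (auto simp: signed_cmeas_empty[OF u] intro!: SUP_eqI)
  moreover have "sigma_algebra UNIV (sets (borel :: 'a measure))"
    using sets.sigma_algebra_axioms[of "borel :: 'a measure"] by simp
  ultimately have "emeasure (measure_of UNIV (sets borel) p) B = p B"
    using B by (intro emeasure_measure_of_sigma)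
  then show ?thesis by (simp add: pos_part_def p_def[abs_def])
qed

lemma finite_measure_pos_part:
  assumes u: "signed_cmeas u" shows "finite_measure (pos_part u)"
proof (rule finite_measureI)
  obtain C where C: "\<And>B. B \<in> sets borel \<Longrightarrow> \<bar>u B\<bar> \<le> C" using u by (auto simp: signed_cmeas_def)
  have "emeasure (pos_part u) UNIV \<le> ennreal C"
    by (subst emeasure_pos_part[OF u]) (auto intro!: SUP_least ennreal_leI abs_le_D1[OF C])
  then show "emeasure (pos_part u) (space (pos_part u)) \<noteq> \<infinity>"
    using ennreal_less_top[of C] by (auto simp: top_unique)
qed

text \<open>For a competitor A inside B, u A = u B - u (B - A) is at most u B plus the negative part
  of B. Taking the supremum gives one inequality, and the same argument for -u gives the
  other.\<close>

lemma measure_pos_part_diff: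
  assumes u: "signed_cmeas u" and B: "B \<in> sets borel"
  shows "measure (pos_part u) B - measure (pos_part (\<lambda>A. - u A)) B = u B"
proof -
  interpret p: finite_measure "pos_part u" by (rule finite_measure_pos_part[OF u])
  interpret n: finite_measure "pos_part (\<lambda>A. - u A)"
    by (rule finite_measure_pos_part[OF signed_cmeas_uminus[OF u]])
  have le: "measure (pos_part v) B \<le> v B + measure (pos_part (\<lambda>A. - v A)) B" if v: "signed_cmeas v" for v
  proof -
    interpret p: finite_measure "pos_part v" by (rule finite_measure_pos_part[OF v])
    interpret n: finite_measure "pos_part (\<lambda>A. - v A)"
      by (rule finite_measure_pos_part[OF signed_cmeas_uminus[OF v]])
    have vn: "- v A \<le> measure (pos_part (\<lambda>A. - v A)) B" if "A \<in> sets borel" "A \<subseteq> B" for A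
    proof -
      have "ennreal (- v A) \<le> emeasure (pos_part (\<lambda>A. - v A)) B"
        unfolding emeasure_pos_part[OF signed_cmeas_uminus[OF v] B]
        by (rule SUP_upper) (use that in auto)
      then show ?thesis by (simp add: n.emeasure_eq_measure)
    qed
    have "emeasure (pos_part v) B \<le> ennreal (v B + measure (pos_part (\<lambda>A. - v A)) B)"
      unfolding emeasure_pos_part[OF v B]
    proof (intro SUP_least ennreal_leI)
      fix A assume A: "A \<in> {A \<in> sets borel. A \<subseteq> B}"
      have "v (A \<union> (B - A)) = v A + v (B - A)"
        by (rule signed_cmeas_Un[OF v]) (use A B in auto)
      moreover have "A \<union> (B - A) = B" using A by auto
      ultimately show "v A \<le> v B + measure (pos_part (\<lambda>A. - v A)) B"
        using vn[of "B - A"] A B by (simp add: sets.Diff)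
    qed
    moreover have "0 \<le> v B + measure (pos_part (\<lambda>A. - v A)) B" using vn[of B] B by simp
    ultimately show ?thesis by (simp add: p.emeasure_eq_measure)
  qed
  show ?thesis using le[OF u] le[OF signed_cmeas_uminus[OF u]] by simp
qed

section \<open>Variation\<close>

lemma bounded_cmeas_sums:
  "bounded_cmeas \<mu> \<Longrightarrow> range A \<subseteq> sets borel \<Longrightarrow> disjoint_family A \<Longrightarrow> (\<lambda>n. \<mu> (A n)) sums \<mu> (\<Union>n. A n)"
  by (auto simp: bounded_cmeas_def)

text \<open>\<open>variation\<close> ranges over countable partitions of the whole space, so the
  finite family is completed by the complement of its union at index n and by empty sets
  beyond.\<close>

lemma sum_cmod_le_tv_norm:
  fixes n :: nat
  assumes \<mu>: "bounded_cmeas \<mu>" and A: "\<And>i. i < n \<Longrightarrow> A i \<in> sets borel" "disjoint_family_on A {..<n}"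
  shows "(\<Sum>i<n. cmod (\<mu> (A i))) \<le> tv_norm \<mu>"
proof -
  define B where "B i = (if i < n then A i else if i = n then - (\<Union>j<n. A j) else {})" for i :: nat
  have B: "range B \<subseteq> sets borel" "disjoint_family B" "(\<Union>i. B i) = UNIV"
  proof -
    have "(\<Union>j<n. A j) \<in> sets borel" using A(1) by (intro sets.finite_UN) auto
    then have "- (\<Union>j<n. A j) \<in> sets borel" using sets.compl_sets[of _ borel] by (simp add: Compl_eq_Diff_UNIV)
    then show "range B \<subseteq> sets borel" using A(1) unfolding B_def by auto
    show "disjoint_family B" using A(2) by (auto simp: disjoint_family_on_def B_def)
    have "x \<in> (\<Union>i. B i)" for x
    proof (cases "\<exists>i<n. x \<in> A i")
      case True then show ?thesis by (auto simp: B_def)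
    next
      case False then have "x \<in> B n" by (auto simp: B_def)
      then show ?thesis by blast
    qed
    then show "(\<Union>i. B i) = UNIV" by blast
  qed
  have "ennreal (\<Sum>i<n. cmod (\<mu> (A i))) = (\<Sum>i<n. ennreal (cmod (\<mu> (B i))))"
    by (subst sum_ennreal) (auto simp: B_def)
  also have "\<dots> \<le> (\<Sum>i. ennreal (cmod (\<mu> (B i))))" by (rule sum_le_suminf) auto
  also have "\<dots> \<le> variation \<mu> UNIV"
    unfolding variation_def by (rule SUP_upper) (use B in auto)
  also have "\<dots> = ennreal (tv_norm \<mu>)" using \<mu> by (simp add: tv_norm_def bounded_cmeas_def)
  finally show ?thesis by (simp add: tv_norm_def)
qed

lemma tv_norm_nonneg: "0 \<le> tv_norm \<mu>"
  by (simp add: tv_norm_def)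

lemma cmod_le_tv_norm:
  assumes \<mu>: "bounded_cmeas \<mu>" shows "cmod (\<mu> B) \<le> tv_norm \<mu>"
proof (cases "B \<in> sets borel")
  case True
  then show ?thesis using sum_cmod_le_tv_norm[OF \<mu>, of "Suc 0" "\<lambda>_. B"] by (simp add: disjoint_family_on_def)
next
  case False
  then show ?thesis using \<mu> by (simp add: bounded_cmeas_def tv_norm_nonneg)
qed

lemma variation_leI:
  fixes \<mu> :: "'a::euclidean_space cmeas"
  assumes "\<And>(n :: nat) A. (\<And>i :: nat. A i \<in> sets borel) \<Longrightarrow> disjoint_family A \<Longrightarrow> (\<Sum>i<n. cmod (\<mu> (A i))) \<le> C"
  shows "variation \<mu> UNIV \<le> ennreal C"
  unfolding variation_def
proof (rule SUP_least)
  fix A :: "nat \<Rightarrow> 'a set"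
  assume A: "A \<in> {A. range A \<subseteq> sets borel \<and> disjoint_family A \<and> \<Union> (range A) = UNIV}"
  show "(\<Sum>n. ennreal (cmod (\<mu> (A n)))) \<le> ennreal C"
    unfolding suminf_eq_SUP
  proof (rule SUP_least)
    fix n
    have "(\<Sum>i<n. ennreal (cmod (\<mu> (A i)))) = ennreal (\<Sum>i<n. cmod (\<mu> (A i)))" by (subst sum_ennreal) auto
    also have "\<dots> \<le> ennreal C" using A by (intro ennreal_leI assms) auto
    finally show "(\<Sum>i<n. ennreal (cmod (\<mu> (A i)))) \<le> ennreal C" .
  qed
qed

section \<open>Integration against a complex measure\<close>

definition bdd_borel :: "('a::euclidean_space \<Rightarrow> complex) \<Rightarrow> bool" where
  "bdd_borel f \<longleftrightarrow> f \<in> borel_measurable borel \<and> (\<exists>C. \<forall>x. cmod (f x) \<le> C)"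

lemma bdd_borel_measurable: "bdd_borel f \<Longrightarrow> f \<in> borel_measurable borel"
  by (simp add: bdd_borel_def)

lemma bdd_borelI: "f \<in> borel_measurable borel \<Longrightarrow> (\<And>x. cmod (f x) \<le> C) \<Longrightarrow> bdd_borel f"
  by (auto simp: bdd_borel_def)

lemma bdd_borel_indicator: "B \<in> sets borel \<Longrightarrow> bdd_borel (indicator B)"
  by (rule bdd_borelI[of _ 1]) (auto simp: indicator_def)

lemma bdd_borel_const: "bdd_borel (\<lambda>x. c)"
  by (rule bdd_borelI[of _ "cmod c"]) auto

lemma bdd_borel_add:
  assumes "bdd_borel f" "bdd_borel g" shows "bdd_borel (\<lambda>x. f x + g x)"
proof -
  obtain C D where "\<And>x. cmod (f x) \<le> C" "\<And>x. cmod (g x) \<le> D" using assms by (auto simp: bdd_borel_def)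
  then have "cmod (f x + g x) \<le> C + D" for x by (meson add_mono norm_triangle_le)
  then show ?thesis using assms by (intro bdd_borelI) (auto simp: bdd_borel_def)
qed

lemma bdd_borel_mult:
  assumes "bdd_borel f" "bdd_borel g" shows "bdd_borel (\<lambda>x. f x * g x)"
proof -
  obtain C D where "\<And>x. cmod (f x) \<le> C" "\<And>x. cmod (g x) \<le> D" using assms by (auto simp: bdd_borel_def)
  then have "cmod (f x * g x) \<le> C * D" for x
    unfolding norm_mult by (intro mult_mono order_trans[OF norm_ge_zero]) auto
  then show ?thesis using assms by (intro bdd_borelI) (auto simp: bdd_borel_def)
qed

lemma bdd_borel_scale: "bdd_borel f \<Longrightarrow> bdd_borel (\<lambda>x. c * f x)"
  by (intro bdd_borel_mult bdd_borel_const)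

lemma bdd_borel_diff: "bdd_borel f \<Longrightarrow> bdd_borel g \<Longrightarrow> bdd_borel (\<lambda>x. f x - g x)"
  using bdd_borel_add[of f "\<lambda>x. (-1) * g x"] bdd_borel_scale[of g "-1"] by simp

lemma bdd_borel_sum: "(\<And>i. i \<in> I \<Longrightarrow> bdd_borel (f i)) \<Longrightarrow> bdd_borel (\<lambda>x. \<Sum>i\<in>I. f i x)"
  by (induction I rule: infinite_finite_induct) (auto intro: bdd_borel_const bdd_borel_add)

lemma bdd_borel_translate: assumes "bdd_borel f" shows "bdd_borel (\<lambda>y. f (x + y))"
proof -
  have [measurable]: "f \<in> borel_measurable borel" using assms by (rule bdd_borel_measurable)
  show ?thesis using assms by (auto simp: bdd_borel_def)
qed

lemma bdd_borel_limit:
  assumes "\<And>i. bdd_borel (s i)" "\<And>i x. cmod (s i x) \<le> C" "\<And>x. (\<lambda>i. s i x) \<longlonglongrightarrow> f x"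
  shows "bdd_borel f"
proof (rule bdd_borelI)
  show "f \<in> borel_measurable borel"
    by (rule borel_measurable_LIMSEQ_metric[of s]) (auto simp: assms bdd_borel_measurable)
  show "cmod (f x) \<le> C" for x
    using LIMSEQ_le_const2[OF tendsto_norm[OF assms(3)[of x]]] assms(2) by blast
qed

text \<open>Simple functions converging to f can be chosen with modulus at most twice that of f. The
  uniform bound is kept in the limit case because dominated convergence against a finite measure
  needs it.\<close>

lemma bdd_borel_induct [consumes 1, case_names indicator add scale lim]:
  assumes f: "bdd_borel f"
    and ind: "\<And>B. B \<in> sets borel \<Longrightarrow> P (indicator B)"
    and add: "\<And>f g. bdd_borel f \<Longrightarrow> bdd_borel g \<Longrightarrow> P f \<Longrightarrow> P g \<Longrightarrow> P (\<lambda>x. f x + g x)"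
    and scale: "\<And>c f. bdd_borel f \<Longrightarrow> P f \<Longrightarrow> P (\<lambda>x. c * f x)"
    and lim: "\<And>s f C. (\<And>i. bdd_borel (s i)) \<Longrightarrow> (\<And>i. P (s i)) \<Longrightarrow> (\<And>i x. cmod (s i x) \<le> C) \<Longrightarrow>
      (\<And>x. (\<lambda>i. s i x) \<longlonglongrightarrow> f x) \<Longrightarrow> P f"
  shows "P f"
proof -
  obtain C where C: "\<And>x. cmod (f x) \<le> C" using f by (auto simp: bdd_borel_def)
  obtain s where s: "\<And>i. simple_function borel (s i)" "\<And>x. (\<lambda>i. s i x) \<longlonglongrightarrow> f x"
    "\<And>i x. dist (s i x) 0 \<le> 2 * dist (f x) 0"
    using borel_measurable_implies_sequence_metric[OF bdd_borel_measurable[OF f], of 0] by auto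
  have sb: "cmod (s i x) \<le> 2 * C" for i x using s(3)[of i x] C[of x] by simp
  have zero: "P (\<lambda>x. 0)" using scale[OF bdd_borel_indicator ind, of "{}" 0] by simp
  have sums: "bdd_borel (\<lambda>x. \<Sum>y\<in>I. y * indicator (B y) x) \<and> P (\<lambda>x. \<Sum>y\<in>I. y * indicator (B y) x)"
    if "finite I" "\<And>y. y \<in> I \<Longrightarrow> B y \<in> sets borel" for I and B :: "complex \<Rightarrow> 'a set"
    using that
  proof (induction I)
    case empty then show ?case using zero by (simp add: bdd_borel_const)
  next
    case (insert y I)
    have b: "bdd_borel (\<lambda>x. y * indicator (B y) x)" "P (\<lambda>x. y * indicator (B y) x)"
      using insert(4) by (auto intro!: bdd_borel_scale bdd_borel_indicator scale ind)
    have "P (\<lambda>x. y * indicator (B y) x + (\<Sum>y\<in>I. y * indicator (B y) x))"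
      using insert b by (intro add) auto
    moreover have "bdd_borel (\<lambda>x. y * indicator (B y) x + (\<Sum>y\<in>I. y * indicator (B y) x))"
      using insert b by (intro bdd_borel_add) auto
    ultimately show ?case unfolding sum.insert[OF insert(1,2)] by (rule conjI[rotated])
  qed
  have eq: "s i = (\<lambda>x. \<Sum>y\<in>range (s i). y * indicator (s i -` {y}) x)" for i
  proof
    fix x
    have "(\<Sum>y\<in>range (s i). y * indicator (s i -` {y}) x) = (\<Sum>y\<in>range (s i). if y = s i x then s i x else 0)"
      by (intro sum.cong) (auto simp: indicator_def)
    then show "s i x = (\<Sum>y\<in>range (s i). y * indicator (s i -` {y}) x)"
      using simple_functionD(1)[OF s(1)[of i]] by simp
  qed
  have "bdd_borel (s i) \<and> P (s i)" for i
  proof -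
    have "finite (range (s i))" "\<And>y. s i -` {y} \<in> sets borel"
      using simple_functionD[OF s(1)[of i]] by auto
    from sums[of "range (s i)" "\<lambda>y. s i -` {y}", OF this] show ?thesis by (simp only: eq[of i, symmetric])
  qed
  then show ?thesis using lim[of s "2 * C" f] sb s(2) by blast
qed

text \<open>The Jordan parts of the real and imaginary parts, indexed by the unit c with which they
  enter the measure: \<mu> is the sum of c times \<open>jpart \<mu> c\<close>. One argument then
  treats all four.\<close>

definition jpart :: "'a::euclidean_space cmeas \<Rightarrow> complex \<Rightarrow> 'a measure" where
  "jpart \<mu> c = pos_part (\<lambda>A. Re (cnj c * \<mu> A))"

abbreviation "units4 \<equiv> {1, -1, \<i>, -\<i>}"

lemma sum_units4: "(\<Sum>c\<in>units4. g c) = g 1 + g (-1) + (g \<i> + g (-\<i>))"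
  by (simp add: complex_eq_iff add.assoc)

lemma cm_integral_jpart: "cm_integral \<mu> f = (\<Sum>c\<in>units4. c * (LINT x|jpart \<mu> c. f x))"
  unfolding sum_units4 by (simp add: cm_integral_def jpart_def algebra_simps)

lemma sets_jpart [measurable_cong, simp]: "sets (jpart \<mu> c) = sets borel"
  by (simp add: jpart_def)

lemma space_jpart [simp]: "space (jpart \<mu> c) = UNIV"
  by (simp add: jpart_def)

lemma signed_cmeas_Re:
  assumes \<mu>: "bounded_cmeas \<mu>" shows "signed_cmeas (\<lambda>A. Re (c * \<mu> A))"
  unfolding signed_cmeas_def
proof (intro conjI allI impI)
  fix A :: "nat \<Rightarrow> 'a set" assume "range A \<subseteq> sets borel" "disjoint_family A"
  from bounded_cmeas_sums[OF \<mu> this]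
  show "(\<lambda>n. Re (c * \<mu> (A n))) sums Re (c * \<mu> (\<Union>n. A n))" by (intro sums_Re sums_mult)
next
  have "\<bar>Re (c * \<mu> B)\<bar> \<le> cmod c * tv_norm \<mu>" for B
    by (rule order_trans[OF abs_Re_le_cmod]) (simp add: norm_mult mult_left_mono cmod_le_tv_norm[OF \<mu>])
  then show "\<exists>C. \<forall>B\<in>sets borel. \<bar>Re (c * \<mu> B)\<bar> \<le> C" by blast
qed

lemma finite_measure_jpart: "bounded_cmeas \<mu> \<Longrightarrow> finite_measure (jpart \<mu> c)"
  unfolding jpart_def by (intro finite_measure_pos_part signed_cmeas_Re)

lemma integrable_jpart:
  assumes "bounded_cmeas \<mu>" "bdd_borel f" shows "integrable (jpart \<mu> c) f"
proof -
  interpret finite_measure "jpart \<mu> c" by (rule finite_measure_jpart[OF assms(1)])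
  show ?thesis using assms(2) unfolding bdd_borel_def
    by (auto intro!: integrable_const_bound simp: measurable_def)
qed

lemma cm_integral_add:
  assumes "bounded_cmeas \<mu>" "bdd_borel f" "bdd_borel g"
  shows "cm_integral \<mu> (\<lambda>x. f x + g x) = cm_integral \<mu> f + cm_integral \<mu> g"
  using integrable_jpart[OF assms(1,2)] integrable_jpart[OF assms(1,3)]
  by (simp add: cm_integral_jpart sum.distrib distrib_left del: sum.insert)

lemma cm_integral_scale: "cm_integral \<mu> (\<lambda>x. c * f x) = c * cm_integral \<mu> f"
  by (simp add: cm_integral_jpart sum_distrib_left mult.left_commute del: sum.insert)

lemma integral_indicator_jpart:
  assumes \<mu>: "bounded_cmeas \<mu>" and B: "B \<in> sets borel"
  shows "(LINT x|jpart \<mu> c. indicator B x) = complex_of_real (measure (jpart \<mu> c) B)"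
proof -
  interpret finite_measure "jpart \<mu> c" by (rule finite_measure_jpart[OF \<mu>])
  have "(LINT x|jpart \<mu> c. indicator B x) = (LINT x|jpart \<mu> c. complex_of_real (indicator B x))"
    by (intro Bochner_Integration.integral_cong) (auto simp: indicator_def)
  also have "\<dots> = complex_of_real (measure (jpart \<mu> c) B)"
    using B by (simp add: integral_complex_of_real)
  finally show ?thesis .
qed

lemma cmeas_eq_jparts:
  assumes \<mu>: "bounded_cmeas \<mu>" and B: "B \<in> sets borel"
  shows "\<mu> B = (\<Sum>c\<in>units4. c * complex_of_real (measure (jpart \<mu> c) B))"
proof -
  have "measure (jpart \<mu> 1) B - measure (jpart \<mu> (-1)) B = Re (\<mu> B)"
    "measure (jpart \<mu> \<i>) B - measure (jpart \<mu> (-\<i>)) B = Im (\<mu> B)"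
    using measure_pos_part_diff[OF signed_cmeas_Re[OF \<mu>, of 1] B]
      measure_pos_part_diff[OF signed_cmeas_Re[OF \<mu>, of "-\<i>"] B]
    by (simp_all add: jpart_def)
  then show ?thesis unfolding sum_units4 by (simp add: complex_eq_iff)
qed

lemma cm_integral_indicator:
  assumes \<mu>: "bounded_cmeas \<mu>" and B: "B \<in> sets borel"
  shows "cm_integral \<mu> (indicator B) = \<mu> B"
  unfolding cm_integral_jpart integral_indicator_jpart[OF assms] cmeas_eq_jparts[OF assms] ..

lemma cm_integral_limit:
  assumes \<mu>: "bounded_cmeas \<mu>" and s: "\<And>i. bdd_borel (s i)" "\<And>i x. cmod (s i x) \<le> C"
    "\<And>x. (\<lambda>i. s i x) \<longlonglongrightarrow> f x"
  shows "(\<lambda>i. cm_integral \<mu> (s i)) \<longlonglongrightarrow> cm_integral \<mu> f"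
  unfolding cm_integral_jpart
proof (intro tendsto_sum tendsto_mult tendsto_const)
  fix c
  interpret finite_measure "jpart \<mu> c" by (rule finite_measure_jpart[OF \<mu>])
  have m: "bdd_borel f" by (rule bdd_borel_limit[OF s])
  show "(\<lambda>i. LINT x|jpart \<mu> c. s i x) \<longlonglongrightarrow> (LINT x|jpart \<mu> c. f x)"
    by (rule integral_dominated_convergence[where w = "\<lambda>_. C"])
      (use s m in \<open>auto simp: bdd_borel_measurable cong: measurable_cong_sets\<close>)
qed

text \<open>This loses a constant against the total variation, but it sees where the integrand is small.\<close>

lemma cmod_cm_integral_le_jparts:
  assumes \<mu>: "bounded_cmeas \<mu>" and f: "bdd_borel f" and R: "R \<in> sets borel"
    and le: "\<And>x. cmod (f x) \<le> a + b * indicator R x"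
  shows "cmod (cm_integral \<mu> f)
    \<le> a * (\<Sum>c\<in>units4. measure (jpart \<mu> c) UNIV) + b * (\<Sum>c\<in>units4. measure (jpart \<mu> c) R)"
proof -
  have "cmod (cm_integral \<mu> f)
      \<le> (\<Sum>c\<in>units4. a * measure (jpart \<mu> c) UNIV + b * measure (jpart \<mu> c) R)"
    unfolding cm_integral_jpart
  proof (rule sum_norm_le)
    fix c assume "c \<in> units4"
    interpret finite_measure "jpart \<mu> c" by (rule finite_measure_jpart[OF \<mu>])
    have "cmod (c * (LINT x|jpart \<mu> c. f x)) = cmod (LINT x|jpart \<mu> c. f x)"
      using \<open>c \<in> units4\<close> by (auto simp: norm_mult)
    also have "\<dots> \<le> (LINT x|jpart \<mu> c. cmod (f x))" by (rule integral_norm_bound)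
    also have "\<dots> \<le> (LINT x|jpart \<mu> c. a + b * indicator R x)"
      using R by (intro integral_mono le integrable_norm integrable_jpart[OF \<mu> f]) (auto simp: emeasure_eq_measure)
    also have "\<dots> = a * measure (jpart \<mu> c) UNIV + b * measure (jpart \<mu> c) R"
      using R by (subst Bochner_Integration.integral_add) (auto simp: emeasure_eq_measure)
    finally show "cmod (c * (LINT x|jpart \<mu> c. f x)) \<le> a * measure (jpart \<mu> c) UNIV + b * measure (jpart \<mu> c) R" .
  qed
  then show ?thesis by (simp add: sum.distrib sum_distrib_left del: sum.insert)
qed

lemma cm_integral_sum:
  assumes "bounded_cmeas \<mu>" "\<And>i. i \<in> I \<Longrightarrow> bdd_borel (f i)"
  shows "cm_integral \<mu> (\<lambda>x. \<Sum>i\<in>I. f i x) = (\<Sum>i\<in>I. cm_integral \<mu> (f i))"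
  using assms(2)
proof (induction I rule: infinite_finite_induct)
  case (insert i I)
  then show ?case by (simp add: cm_integral_add[OF assms(1)] bdd_borel_sum)
qed (simp_all add: cm_integral_jpart)

lemma cm_integral_diff:
  assumes "bounded_cmeas \<mu>" "bdd_borel f" "bdd_borel g"
  shows "cm_integral \<mu> (\<lambda>x. f x - g x) = cm_integral \<mu> f - cm_integral \<mu> g"
  using cm_integral_add[OF assms(1,2) bdd_borel_scale[OF assms(3), of "-1"]] cm_integral_scale[of \<mu> "-1" g]
  by simp

text \<open>The point is that \<open>\<delta>\<close> does not depend on the partition and \<open>N\<close> does not depend on the integrand.\<close>

lemma partition_approx:
  fixes \<mu> :: "'a::euclidean_space cmeas"
  assumes \<mu>: "bounded_cmeas \<mu>" and \<epsilon>: "\<epsilon> > 0"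
  obtains \<delta> where "\<delta> > 0"
    "\<And>A :: nat \<Rightarrow> 'a set. range A \<subseteq> sets borel \<Longrightarrow> disjoint_family A \<Longrightarrow> (\<Union>i. A i) = UNIV \<Longrightarrow>
      \<exists>N. \<forall>f z. bdd_borel f \<longrightarrow> (\<forall>x. cmod (f x) \<le> C) \<longrightarrow> (\<forall>i. \<forall>x\<in>A i. cmod (f x - z i) \<le> \<delta>) \<longrightarrow>
        cmod (cm_integral \<mu> f - (\<Sum>i<N. z i * \<mu> (A i))) \<le> \<epsilon>"
proof -
  define M where "M = (\<Sum>c\<in>units4. measure (jpart \<mu> c) UNIV)"
  have M: "M \<ge> 0" unfolding M_def by (intro sum_nonneg) simp
  define \<delta> where "\<delta> = \<epsilon> / (2 * (M + 1))"
  have \<delta>: "\<delta> > 0" using \<epsilon> M by (simp add: \<delta>_def)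
  show thesis
  proof (rule that[OF \<delta>])
    fix A :: "nat \<Rightarrow> 'a set"
    assume A': "range A \<subseteq> sets borel" "disjoint_family A" "(\<Union>i. A i) = UNIV"
    then have A: "\<And>i. A i \<in> sets borel" "disjoint_family A" "(\<Union>i. A i) = UNIV" by auto
    have \<delta>M: "\<delta> * M \<le> \<epsilon> / 2"
    proof -
      have "\<delta> * M \<le> \<delta> * (M + 1)" using \<delta> by simp
      also have "\<dots> = \<epsilon> / 2" using M by (simp add: \<delta>_def field_simps)
      finally show ?thesis .
    qed
    \<comment> \<open>Only finitely many pieces are kept. On the tail the step function is 0 and f
      is merely bounded, but the tails decrease to the empty set, so their Jordan measures vanish in
      the limit. This choice of N involves \<mu>, the pieces and the bound, not f.\<close>
    define R where "R n = (\<Union>i\<in>{n..}. A i)" for n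
    have R: "R n \<in> sets borel" for n unfolding R_def using A(1) by auto
    have "(\<lambda>n. (\<bar>C\<bar> + 1) * (\<Sum>c\<in>units4. measure (jpart \<mu> c) (R n))) \<longlonglongrightarrow> (\<bar>C\<bar> + 1) * (\<Sum>c\<in>units4. 0)"
    proof (intro tendsto_mult tendsto_sum tendsto_const)
      fix c
      interpret finite_measure "jpart \<mu> c" by (rule finite_measure_jpart[OF \<mu>])
      have "(\<Inter>n. R n) = {}"
      proof -
        have False if "x \<in> (\<Inter>n. R n)" for x
        proof -
          obtain i where i: "x \<in> A i" using A(3) by blast
          have "x \<in> R (Suc i)" using that by blast
          then obtain j where "j \<ge> Suc i" "x \<in> A j" by (auto simp: R_def)
          then show False using A(2) i unfolding disjoint_family_on_def by (metis IntI Suc_n_not_le_n UNIV_I empty_iff)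
        qed
        then show ?thesis by blast
      qed
      moreover have "(\<lambda>n. measure (jpart \<mu> c) (R n)) \<longlonglongrightarrow> measure (jpart \<mu> c) (\<Inter>n. R n)"
      proof (rule finite_Lim_measure_decseq)
        show "decseq R" unfolding decseq_def R_def by (intro allI impI UN_mono) auto
      qed (use R in auto)
      ultimately show "(\<lambda>n. measure (jpart \<mu> c) (R n)) \<longlonglongrightarrow> 0" by simp
    qed
    from order_tendstoD(2)[OF this, of "\<epsilon> / 2"]
    have "eventually (\<lambda>n. (\<bar>C\<bar> + 1) * (\<Sum>c\<in>units4. measure (jpart \<mu> c) (R n)) < \<epsilon> / 2) sequentially"
      using \<epsilon> by (simp del: sum.insert)
    then obtain N where N: "(\<bar>C\<bar> + 1) * (\<Sum>c\<in>units4. measure (jpart \<mu> c) (R N)) < \<epsilon> / 2"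
      by (auto simp: eventually_sequentially simp del: sum.insert)
    show "\<exists>N. \<forall>f z. bdd_borel f \<longrightarrow> (\<forall>x. cmod (f x) \<le> C) \<longrightarrow> (\<forall>i. \<forall>x\<in>A i. cmod (f x - z i) \<le> \<delta>) \<longrightarrow>
          cmod (cm_integral \<mu> f - (\<Sum>i<N. z i * \<mu> (A i))) \<le> \<epsilon>"
    proof (intro exI[of _ N] allI impI)
      fix f z
      assume f: "bdd_borel f" "\<forall>x. cmod (f x) \<le> C" and fz: "\<forall>i. \<forall>x\<in>A i. cmod (f x - z i) \<le> \<delta>"
      define g where "g x = (\<Sum>i<N. z i * indicator (A i) x)" for x
      have gb: "bdd_borel g" unfolding g_def
        by (intro bdd_borel_sum bdd_borel_scale bdd_borel_indicator A(1))
      have gi: "cm_integral \<mu> g = (\<Sum>i<N. z i * \<mu> (A i))"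
        unfolding g_def
        by (subst cm_integral_sum[OF \<mu>])
          (auto simp: cm_integral_scale cm_integral_indicator[OF \<mu>] A(1) intro!: bdd_borel_scale bdd_borel_indicator)
      have "cmod (f x - g x) \<le> \<delta> + (\<bar>C\<bar> + 1) * indicator (R N) x" for x
      proof -
        obtain i where i: "x \<in> A i" using A(3) by blast
        have other: "x \<notin> A j" if "j \<noteq> i" for j
          using A(2) i that unfolding disjoint_family_on_def by blast
        have "g x = (\<Sum>j<N. if j = i then z i else 0)"
          unfolding g_def by (intro sum.cong) (use i other in \<open>auto simp: indicator_def\<close>)
        then have g: "g x = (if i < N then z i else 0)" by simp
        show ?thesis
        proof (cases "i < N")
          case True
          then show ?thesis using fz i by (auto simp: g indicator_def intro: add_increasing2)
        next
          case False
          then have "x \<in> R N" using i by (auto simp: R_def)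
          then show ?thesis using f(2)[rule_format, of x] False \<delta> by (simp add: g)
        qed
      qed
      from cmod_cm_integral_le_jparts[OF \<mu> bdd_borel_diff[OF f(1) gb] R this]
      show "cmod (cm_integral \<mu> f - (\<Sum>i<N. z i * \<mu> (A i))) \<le> \<epsilon>"
        using N \<delta>M unfolding cm_integral_diff[OF \<mu> f(1) gb] gi M_def by linarith
    qed
  qed
qed

text \<open>Lindelof's theorem in the form used for two covers: balls in the range for the sharp
  integral bound, balls in the domain for the discretisation.\<close>

lemma ex_countable_subcover:
  fixes U :: "'b::second_countable_topology \<Rightarrow> 'b set"
  assumes "\<And>z. open (U z)" "\<And>z. z \<in> U z"
  shows "\<exists>q :: nat \<Rightarrow> 'b. \<forall>x. \<exists>n. x \<in> U (q n)"
proof -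
  obtain F where F: "F \<subseteq> range U" "countable F" "\<Union>F = \<Union>(range U)"
    using Lindelof[of "range U"] assms(1) by blast
  have "\<Union>F = UNIV" using F(3) assms(2) by blast
  then have ne: "F \<noteq> {}" by auto
  have "\<forall>n. \<exists>z. from_nat_into F n = U z" using from_nat_into[OF ne] F(1) by blast
  from choice[OF this] obtain q where q: "\<forall>n. from_nat_into F n = U (q n)" ..
  have "\<exists>n. x \<in> U (q n)" for x
  proof -
    have "x \<in> \<Union>F" using \<open>\<Union>F = UNIV\<close> by simp
    then obtain S where S: "S \<in> F" "x \<in> S" by (rule UnionE)
    obtain n where "from_nat_into F n = S" using from_nat_into_surj[OF F(2) S(1)] ..
    then show ?thesis using q S(2) by (intro exI[of _ n]) simp
  qed
  then show ?thesis by blast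
qed

text \<open>The Jordan parts alone would lose a constant. On pieces where f hardly oscillates the
  integral is close to a sum of z i * \<mu> (A i) with values z i bounded by C, and such a sum is
  bounded by C times the variation.\<close>

lemma cmod_cm_integral_le:
  assumes \<mu>: "bounded_cmeas \<mu>" and f: "bdd_borel f" and C: "\<And>x. cmod (f x) \<le> C"
  shows "cmod (cm_integral \<mu> f) \<le> tv_norm \<mu> * C"
proof (rule field_le_epsilon)
  fix \<epsilon> :: real assume \<epsilon>: "\<epsilon> > 0"
  have fm[measurable]: "f \<in> borel_measurable borel" using f by (rule bdd_borel_measurable)
  have C0: "0 \<le> C" using C norm_ge_zero order_trans by blast
  have "\<exists>(A :: nat \<Rightarrow> 'a set) z. range A \<subseteq> sets borel \<and> disjoint_family A \<and> (\<Union>i. A i) = UNIV \<and>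
      (\<forall>i. cmod (z i) \<le> C) \<and> (\<forall>i. \<forall>x\<in>A i. cmod (f x - z i) \<le> \<delta>)" if \<delta>: "\<delta> > 0" for \<delta>
  proof -
    obtain q :: "nat \<Rightarrow> complex" where q: "\<And>x. \<exists>n. x \<in> ball (q n) (\<delta> / 2)"
      using ex_countable_subcover[of "\<lambda>z :: complex. ball z (\<delta> / 2)"] \<delta> by auto
    define B where "B n = f -` ball (q n) (\<delta> / 2)" for n
    define A where "A = disjointed B"
    \<comment> \<open>Values attained by f, and 0 on empty pieces, so that the bound C is inherited
      exactly.\<close>
    define z where "z i = (if A i = {} then 0 else f (SOME x. x \<in> A i))" for i
    have "B n \<in> sets borel" for n
      unfolding B_def using measurable_sets_borel[OF fm, of "ball (q n) (\<delta> / 2)"] by simp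
    then have "range A \<subseteq> sets borel" unfolding A_def
      using sets.range_disjointed_sets[of B borel] by blast
    moreover have "disjoint_family A" unfolding A_def by (rule disjoint_family_disjointed)
    moreover have "(\<Union>i. A i) = UNIV" unfolding A_def UN_disjointed_eq using q by (auto simp: B_def)
    moreover have "cmod (z i) \<le> C" for i using C C0 by (simp add: z_def)
    moreover have "cmod (f x - z i) \<le> \<delta>" if x: "x \<in> A i" for i x
    proof -
      define y where "y = (SOME x. x \<in> A i)"
      have "y \<in> A i" unfolding y_def using x by (rule someI)
      then have "dist (q i) (f x) < \<delta> / 2" "dist (q i) (f y) < \<delta> / 2"
        using x disjointed_subset[of B i] by (auto simp: A_def B_def)
      then have "dist (f x) (f y) < \<delta>" using dist_triangle_half_r by blast
      then show ?thesis using x by (auto simp: z_def y_def dist_norm)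
    qed
    ultimately show ?thesis by blast
  qed
  moreover obtain \<delta> where "\<delta> > 0" and \<delta>: "\<And>A :: nat \<Rightarrow> 'a set. range A \<subseteq> sets borel \<Longrightarrow> disjoint_family A \<Longrightarrow>
      (\<Union>i. A i) = UNIV \<Longrightarrow> \<exists>N. \<forall>f z. bdd_borel f \<longrightarrow> (\<forall>x. cmod (f x) \<le> C) \<longrightarrow>
        (\<forall>i. \<forall>x\<in>A i. cmod (f x - z i) \<le> \<delta>) \<longrightarrow> cmod (cm_integral \<mu> f - (\<Sum>i<N. z i * \<mu> (A i))) \<le> \<epsilon>"
    by (rule partition_approx[OF \<mu> \<epsilon>, of C]) blast
  ultimately obtain A :: "nat \<Rightarrow> 'a set" and z where A: "range A \<subseteq> sets borel" "disjoint_family A" "(\<Union>i. A i) = UNIV"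
    and z: "\<And>i. cmod (z i) \<le> C" "\<And>i x. x \<in> A i \<Longrightarrow> cmod (f x - z i) \<le> \<delta>"
    by metis
  obtain N where N: "cmod (cm_integral \<mu> f - (\<Sum>i<N. z i * \<mu> (A i))) \<le> \<epsilon>"
    using \<delta>[OF A] f C z(2) by blast
  have "cmod (\<Sum>i<N. z i * \<mu> (A i)) \<le> (\<Sum>i<N. C * cmod (\<mu> (A i)))"
    by (rule sum_norm_le) (simp add: norm_mult mult_right_mono z(1))
  also have "\<dots> = C * (\<Sum>i<N. cmod (\<mu> (A i)))" by (simp add: sum_distrib_left)
  also have "\<dots> \<le> C * tv_norm \<mu>"
    using A C0 by (intro mult_left_mono sum_cmod_le_tv_norm[OF \<mu>]) (auto simp: disjoint_family_on_def)
  finally show "cmod (cm_integral \<mu> f) \<le> tv_norm \<mu> * C + \<epsilon>"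
    using N norm_triangle_sub[of "cm_integral \<mu> f" "\<Sum>i<N. z i * \<mu> (A i)"] by (simp add: mult.commute)
qed

section \<open>Bounded measures as functionals\<close>

text \<open>Bounded complex measures seen as linear functionals: bounded by K and continuous under
  bounded pointwise convergence of sequences. New measures are built by exhibiting such a
  functional.\<close>

definition meas_functional :: "(('a::euclidean_space \<Rightarrow> complex) \<Rightarrow> complex) \<Rightarrow> real \<Rightarrow> bool" where
  "meas_functional L K \<longleftrightarrow>
     (\<forall>f g. bdd_borel f \<longrightarrow> bdd_borel g \<longrightarrow> L (\<lambda>x. f x + g x) = L f + L g) \<and>
     (\<forall>c f. bdd_borel f \<longrightarrow> L (\<lambda>x. c * f x) = c * L f) \<and>
     (\<forall>f C. bdd_borel f \<longrightarrow> (\<forall>x. cmod (f x) \<le> C) \<longrightarrow> cmod (L f) \<le> K * C) \<and>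
     (\<forall>s f C. (\<forall>i :: nat. bdd_borel (s i)) \<longrightarrow> (\<forall>i x. cmod (s i x) \<le> C) \<longrightarrow>
        (\<forall>x. (\<lambda>i. s i x) \<longlonglongrightarrow> f x) \<longrightarrow> (\<lambda>i. L (s i)) \<longlonglongrightarrow> L f)"

lemma meas_functionalI:
  assumes "\<And>f g. bdd_borel f \<Longrightarrow> bdd_borel g \<Longrightarrow> L (\<lambda>x. f x + g x) = L f + L g"
    and "\<And>c f. bdd_borel f \<Longrightarrow> L (\<lambda>x. c * f x) = c * L f"
    and "\<And>f C. bdd_borel f \<Longrightarrow> (\<And>x. cmod (f x) \<le> C) \<Longrightarrow> cmod (L f) \<le> K * C"
    and "\<And>(s :: nat \<Rightarrow> 'a::euclidean_space \<Rightarrow> complex) f C. (\<And>i. bdd_borel (s i)) \<Longrightarrow> (\<And>i x. cmod (s i x) \<le> C) \<Longrightarrow>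
        (\<And>x. (\<lambda>i. s i x) \<longlonglongrightarrow> f x) \<Longrightarrow> (\<lambda>i. L (s i)) \<longlonglongrightarrow> L f"
  shows "meas_functional L K"
  unfolding meas_functional_def
proof (intro conjI allI impI)
  fix s :: "nat \<Rightarrow> 'a \<Rightarrow> complex" and f C
  assume "\<forall>i. bdd_borel (s i)" "\<forall>i x. cmod (s i x) \<le> C" "\<forall>x. (\<lambda>i. s i x) \<longlonglongrightarrow> f x"
  then show "(\<lambda>i. L (s i)) \<longlonglongrightarrow> L f" using assms(4)[of s C f] by blast
qed (use assms(1-3) in auto)

lemma
  assumes "meas_functional L K"
  shows meas_functional_add: "bdd_borel f \<Longrightarrow> bdd_borel g \<Longrightarrow> L (\<lambda>x. f x + g x) = L f + L g"
    and meas_functional_scale: "bdd_borel f \<Longrightarrow> L (\<lambda>x. c * f x) = c * L f"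
    and meas_functional_bound: "bdd_borel f \<Longrightarrow> (\<And>x. cmod (f x) \<le> C) \<Longrightarrow> cmod (L f) \<le> K * C"
    and meas_functional_limit: "(\<And>i. bdd_borel (s i)) \<Longrightarrow> (\<And>i x. cmod (s i x) \<le> C) \<Longrightarrow>
      (\<And>x. (\<lambda>i. s i x) \<longlonglongrightarrow> f x) \<Longrightarrow> (\<lambda>i. L (s i)) \<longlonglongrightarrow> L f"
  using assms unfolding meas_functional_def by (blast, blast, blast, blast)

lemma meas_functional_cm_integral:
  "bounded_cmeas \<mu> \<Longrightarrow> meas_functional (cm_integral \<mu>) (tv_norm \<mu>)"
  by (rule meas_functionalI)
    (auto simp: cm_integral_add cm_integral_scale intro: cmod_cm_integral_le, rule cm_integral_limit)

definition cmeas_of :: "(('a::euclidean_space \<Rightarrow> complex) \<Rightarrow> complex) \<Rightarrow> 'a cmeas" where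
  "cmeas_of L B = (if B \<in> sets borel then L (indicator B) else 0)"

lemma meas_functional_sum:
  assumes L: "meas_functional L K" and f: "\<And>i. i \<in> I \<Longrightarrow> bdd_borel (f i)"
  shows "L (\<lambda>x. \<Sum>i\<in>I. f i x) = (\<Sum>i\<in>I. L (f i))"
proof -
  have z: "L (\<lambda>x. 0) = 0" using meas_functional_scale[OF L bdd_borel_const[of 0], of 0] by simp
  show ?thesis using f
    by (induction I rule: infinite_finite_induct) (auto simp: z meas_functional_add[OF L] bdd_borel_sum)
qed

text \<open>The representation theorem for these functionals. The limit clause gives countable
  additivity, suitable unimodular combinations of indicators give the variation bound, and induction
  over bounded Borel functions recovers L.\<close>

lemma
  fixes L :: "('a::euclidean_space \<Rightarrow> complex) \<Rightarrow> complex"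
  assumes L: "meas_functional L K"
  shows bounded_cmeas_of: "bounded_cmeas (cmeas_of L)"
    and tv_norm_cmeas_of: "tv_norm (cmeas_of L) \<le> K"
    and cm_integral_cmeas_of: "bdd_borel f \<Longrightarrow> cm_integral (cmeas_of L) f = L f"
proof -
  let ?\<mu> = "cmeas_of L"
  have sums: "(\<lambda>n. ?\<mu> (A n)) sums ?\<mu> (\<Union>n. A n)"
    if A: "range A \<subseteq> sets borel" "disjoint_family A" for A :: "nat \<Rightarrow> 'a set"
  proof -
    have A': "\<And>i. A i \<in> sets borel" using A(1) by auto
    define s where "s n x = (\<Sum>i<n. indicator (A i) x :: complex)" for n x
    have s: "s n x = indicator (\<Union>i<n. A i) x" for n x
    proof (cases "\<exists>i<n. x \<in> A i")
      case True
      then obtain i where i: "i < n" "x \<in> A i" by blast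
      then have "x \<notin> A j" if "j \<noteq> i" for j using A(2) that disjoint_family_onD[OF A(2), of i j] by auto
      then have "s n x = (\<Sum>j<n. if j = i then 1 else 0)"
        unfolding s_def using i by (intro sum.cong) (auto simp: indicator_def)
      also have "\<dots> = indicator (\<Union>i<n. A i) x" using i by (auto simp: indicator_def)
      finally show ?thesis .
    next
      case False
      then show ?thesis by (auto simp: s_def indicator_def)
    qed
    have "(\<lambda>n. L (s n)) \<longlonglongrightarrow> L (indicator (\<Union>n. A n))"
    proof (rule meas_functional_limit[OF L])
      show "bdd_borel (s n)" for n unfolding s_def by (intro bdd_borel_sum bdd_borel_indicator A')
      show "cmod (s n x) \<le> 1" for n x unfolding s by (simp add: indicator_def)
      show "(\<lambda>n. s n x) \<longlonglongrightarrow> indicator (\<Union>n. A n) x" for x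
        unfolding s by (rule LIMSEQ_indicator_UN)
    qed
    moreover have "L (s n) = (\<Sum>i<n. ?\<mu> (A i))" for n
      unfolding s_def
      by (subst meas_functional_sum[OF L]) (auto simp: cmeas_of_def A' bdd_borel_indicator)
    ultimately show ?thesis using A' by (simp add: sums_def cmeas_of_def sets.countable_UN)
  qed
  have var: "variation ?\<mu> UNIV \<le> ennreal K"
  proof (rule variation_leI)
    fix n and A :: "nat \<Rightarrow> 'a set" assume A: "\<And>i. A i \<in> sets borel" "disjoint_family A"
    \<comment> \<open>Conjugate phases turn the sum of moduli into one value of L at a function
      bounded by 1.\<close>
    define c where "c i = cnj (sgn (?\<mu> (A i)))" for i
    have "cnj (sgn z) * z = complex_of_real (cmod z)" for z :: complex
    proof (cases "z = 0")
      case False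
      then show ?thesis using complex_norm_square[of z]
        by (simp add: sgn_eq field_simps power2_eq_square)
    qed simp
    then have "complex_of_real (\<Sum>i<n. cmod (?\<mu> (A i))) = (\<Sum>i<n. c i * L (indicator (A i)))"
      using A by (simp add: c_def cmeas_of_def)
    also have "\<dots> = L (\<lambda>x. \<Sum>i<n. c i * indicator (A i) x)"
      using A by (subst meas_functional_sum[OF L])
        (auto simp: meas_functional_scale[OF L] bdd_borel_indicator intro: bdd_borel_scale)
    finally have "cmod (complex_of_real (\<Sum>i<n. cmod (?\<mu> (A i)))) = cmod (L (\<lambda>x. \<Sum>i<n. c i * indicator (A i) x))"
      by (rule arg_cong)
    then have eq: "(\<Sum>i<n. cmod (?\<mu> (A i))) = cmod (L (\<lambda>x. \<Sum>i<n. c i * indicator (A i) x))"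
      unfolding norm_of_real by (simp add: sum_nonneg)
    have "cmod (L (\<lambda>x. \<Sum>i<n. c i * indicator (A i) x)) \<le> K * 1"
    proof (rule meas_functional_bound[OF L])
      show "bdd_borel (\<lambda>x. \<Sum>i<n. c i * indicator (A i) x)"
        using A by (intro bdd_borel_sum bdd_borel_scale bdd_borel_indicator)
      fix x
      show "cmod (\<Sum>i<n. c i * indicator (A i) x) \<le> 1"
      proof (cases "\<exists>i<n. x \<in> A i")
        case True
        then obtain i where i: "i < n" "x \<in> A i" by blast
        then have "x \<notin> A j" if "j \<noteq> i" for j using that disjoint_family_onD[OF A(2), of i j] by auto
        then have "(\<Sum>j<n. c j * indicator (A j) x) = (\<Sum>j<n. if j = i then c i else 0)"
          using i by (intro sum.cong) (auto simp: indicator_def)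
        also have "\<dots> = c i" using i by simp
        finally show ?thesis by (simp add: c_def norm_sgn)
      next
        case False
        then have "(\<Sum>j<n. c j * indicator (A j) x) = 0" by (intro sum.neutral) auto
        then show ?thesis by simp
      qed
    qed
    then show "(\<Sum>i<n. cmod (?\<mu> (A i))) \<le> K" using eq by simp
  qed
  have "variation ?\<mu> UNIV < \<infinity>"
    unfolding infinity_ennreal_def by (rule le_less_trans[OF var ennreal_less_top])
  then show b: "bounded_cmeas ?\<mu>"
    unfolding bounded_cmeas_def using sums by (auto simp: cmeas_of_def)
  \<comment> \<open>The zero function is bounded by 1, so K is nonnegative; \<open>ennreal\<close>
    would cut a negative K to 0.\<close>
  have "cmod (L (\<lambda>x. 0)) \<le> K * 1" by (rule meas_functional_bound[OF L bdd_borel_const]) simp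
  then have "0 \<le> K" using norm_ge_zero[of "L (\<lambda>x. 0)"] by linarith
  then show "tv_norm ?\<mu> \<le> K" using enn2real_mono[OF var ennreal_less_top] by (simp add: tv_norm_def)
  show "bdd_borel f \<Longrightarrow> cm_integral ?\<mu> f = L f"
  proof (induction f rule: bdd_borel_induct)
    case (indicator B) then show ?case using cm_integral_indicator[OF b indicator] by (simp add: cmeas_of_def[of L B])
  next
    case (add f g) then show ?case by (simp add: cm_integral_add[OF b] meas_functional_add[OF L])
  next
    case (scale c f) then show ?case by (simp add: cm_integral_scale meas_functional_scale[OF L])
  next
    case (lim s f C)
    have "(\<lambda>i. cm_integral ?\<mu> (s i)) \<longlonglongrightarrow> cm_integral ?\<mu> f"
      by (rule cm_integral_limit[OF b]) (use lim in auto)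
    moreover have "(\<lambda>i. cm_integral ?\<mu> (s i)) \<longlonglongrightarrow> L f"
    proof -
      have "cm_integral ?\<mu> (s i) = L (s i)" for i using lim by auto
      moreover have "(\<lambda>i. L (s i)) \<longlonglongrightarrow> L f"
        by (rule meas_functional_limit[OF L]) (use lim in auto)
      ultimately show ?thesis by simp
    qed
    ultimately show ?case by (rule LIMSEQ_unique)
  qed
qed

lemma cmeas_of_cm_integral: "bounded_cmeas \<mu> \<Longrightarrow> cmeas_of (cm_integral \<mu>) = \<mu>"
  by (auto simp: cmeas_of_def fun_eq_iff cm_integral_indicator bounded_cmeas_def)

lemma cmeas_eqI:
  assumes "bounded_cmeas \<mu>" "bounded_cmeas \<nu>" "\<And>f. bdd_borel f \<Longrightarrow> cm_integral \<mu> f = cm_integral \<nu> f"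
  shows "\<mu> = \<nu>"
proof -
  have "cmeas_of (cm_integral \<mu>) = cmeas_of (cm_integral \<nu>)"
    using assms(3) by (auto simp: cmeas_of_def fun_eq_iff bdd_borel_indicator)
  then show ?thesis using assms by (simp add: cmeas_of_cm_integral)
qed

section \<open>Vector space operations on measures\<close>

lemma meas_functional_plus:
  assumes "meas_functional L K" "meas_functional L' K'"
  shows "meas_functional (\<lambda>f. L f + L' f) (K + K')"
proof (rule meas_functionalI)
  fix f :: "'a \<Rightarrow> complex" and C assume "bdd_borel f" "\<And>x. cmod (f x) \<le> C"
  then show "cmod (L f + L' f) \<le> (K + K') * C"
    using norm_triangle_mono[OF meas_functional_bound[OF assms(1)] meas_functional_bound[OF assms(2)]]
    by (simp add: distrib_right)
next
  fix s :: "nat \<Rightarrow> 'a \<Rightarrow> complex" and f C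
  assume s: "\<And>i. bdd_borel (s i)" "\<And>i x. cmod (s i x) \<le> C" "\<And>x. (\<lambda>i. s i x) \<longlonglongrightarrow> f x"
  show "(\<lambda>i. L (s i) + L' (s i)) \<longlonglongrightarrow> L f + L' f"
    by (intro tendsto_add meas_functional_limit[OF assms(1) s] meas_functional_limit[OF assms(2) s])
qed (auto simp: meas_functional_add[OF assms(1)] meas_functional_add[OF assms(2)] distrib_left
    meas_functional_scale[OF assms(1)] meas_functional_scale[OF assms(2)])

lemma meas_functional_cmult:
  assumes "meas_functional L K"
  shows "meas_functional (\<lambda>f. c * L f) (cmod c * K)"
proof (rule meas_functionalI)
  fix f :: "'a \<Rightarrow> complex" and C assume "bdd_borel f" "\<And>x. cmod (f x) \<le> C"
  then show "cmod (c * L f) \<le> cmod c * K * C"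
    using meas_functional_bound[OF assms] by (simp add: norm_mult mult_left_mono mult.assoc)
next
  fix s :: "nat \<Rightarrow> 'a \<Rightarrow> complex" and f C
  assume s: "\<And>i. bdd_borel (s i)" "\<And>i x. cmod (s i x) \<le> C" "\<And>x. (\<lambda>i. s i x) \<longlonglongrightarrow> f x"
  show "(\<lambda>i. c * L (s i)) \<longlonglongrightarrow> c * L f"
    by (intro tendsto_mult tendsto_const meas_functional_limit[OF assms s])
qed (auto simp: meas_functional_add[OF assms] distrib_left meas_functional_scale[OF assms])

lemma
  assumes \<mu>: "bounded_cmeas \<mu>" and \<nu>: "bounded_cmeas \<nu>"
  shows bounded_cmeas_add: "bounded_cmeas (\<lambda>B. \<mu> B + \<nu> B)"
    and tv_norm_add: "tv_norm (\<lambda>B. \<mu> B + \<nu> B) \<le> tv_norm \<mu> + tv_norm \<nu>"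
    and cm_integral_add_measure: "bdd_borel f \<Longrightarrow>
      cm_integral (\<lambda>B. \<mu> B + \<nu> B) f = cm_integral \<mu> f + cm_integral \<nu> f"
proof -
  note L = meas_functional_plus[OF meas_functional_cm_integral[OF \<mu>] meas_functional_cm_integral[OF \<nu>]]
  have "cmeas_of (\<lambda>f. cm_integral \<mu> f + cm_integral \<nu> f) = (\<lambda>B. \<mu> B + \<nu> B)"
    using \<mu> \<nu> by (auto simp: cmeas_of_def fun_eq_iff cm_integral_indicator bounded_cmeas_def)
  then show "bounded_cmeas (\<lambda>B. \<mu> B + \<nu> B)" "tv_norm (\<lambda>B. \<mu> B + \<nu> B) \<le> tv_norm \<mu> + tv_norm \<nu>"
    "bdd_borel f \<Longrightarrow> cm_integral (\<lambda>B. \<mu> B + \<nu> B) f = cm_integral \<mu> f + cm_integral \<nu> f"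
    using bounded_cmeas_of[OF L] tv_norm_cmeas_of[OF L] cm_integral_cmeas_of[OF L] by simp_all
qed

lemma
  assumes \<mu>: "bounded_cmeas \<mu>"
  shows bounded_cmeas_scale: "bounded_cmeas (\<lambda>B. c * \<mu> B)"
    and tv_norm_scale_le: "tv_norm (\<lambda>B. c * \<mu> B) \<le> cmod c * tv_norm \<mu>"
    and cm_integral_scale_measure: "bdd_borel f \<Longrightarrow> cm_integral (\<lambda>B. c * \<mu> B) f = c * cm_integral \<mu> f"
proof -
  note L = meas_functional_cmult[OF meas_functional_cm_integral[OF \<mu>], of c]
  have "cmeas_of (\<lambda>f. c * cm_integral \<mu> f) = (\<lambda>B. c * \<mu> B)"
    using \<mu> by (auto simp: cmeas_of_def fun_eq_iff cm_integral_indicator bounded_cmeas_def)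
  then show "bounded_cmeas (\<lambda>B. c * \<mu> B)" "tv_norm (\<lambda>B. c * \<mu> B) \<le> cmod c * tv_norm \<mu>"
    "bdd_borel f \<Longrightarrow> cm_integral (\<lambda>B. c * \<mu> B) f = c * cm_integral \<mu> f"
    using bounded_cmeas_of[OF L] tv_norm_cmeas_of[OF L] cm_integral_cmeas_of[OF L] by simp_all
qed

lemma bounded_cmeas_zero: "bounded_cmeas (\<lambda>B :: 'a::euclidean_space set. 0)"
  using variation_leI[of "\<lambda>B :: 'a set. 0" 0] by (simp add: bounded_cmeas_def)

lemma tv_norm_zero: "tv_norm (\<lambda>B :: 'a::euclidean_space set. 0) = 0"
  using tv_norm_scale_le[OF bounded_cmeas_zero[where 'a = 'a], of 0]
    tv_norm_nonneg[of "\<lambda>B :: 'a set. 0"] by simp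

lemma tv_norm_scale:
  assumes \<mu>: "bounded_cmeas \<mu>" shows "tv_norm (\<lambda>B. c * \<mu> B) = cmod c * tv_norm \<mu>"
proof (cases "c = 0")
  case True then show ?thesis by (simp add: tv_norm_zero)
next
  case False
  have "tv_norm (\<lambda>B. (1 / c) * (c * \<mu> B)) \<le> cmod (1 / c) * tv_norm (\<lambda>B. c * \<mu> B)"
    by (rule tv_norm_scale_le[OF bounded_cmeas_scale[OF \<mu>]])
  then have "tv_norm \<mu> \<le> tv_norm (\<lambda>B. c * \<mu> B) / cmod c"
    using False by (simp add: norm_divide)
  then have "cmod c * tv_norm \<mu> \<le> tv_norm (\<lambda>B. c * \<mu> B)" using False by (simp add: field_simps)
  then show ?thesis using tv_norm_scale_le[OF \<mu>, of c] by simp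
qed

text \<open>Total variation as the dual norm over bounded Borel functions: distances of measures are
  estimated through integrals, without partitions.\<close>

lemma tv_norm_diff_leI:
  fixes \<mu> \<nu> :: "'a::euclidean_space cmeas"
  assumes \<mu>: "bounded_cmeas \<mu>" and \<nu>: "bounded_cmeas \<nu>"
    and le: "\<And>f C. bdd_borel f \<Longrightarrow> (\<And>x. cmod (f x) \<le> C) \<Longrightarrow> cmod (cm_integral \<mu> f - cm_integral \<nu> f) \<le> K * C"
  shows "tv_norm (\<lambda>B. \<mu> B - \<nu> B) \<le> K"
proof -
  note bd = bounded_cmeas_add[OF \<mu> bounded_cmeas_scale[OF \<nu>, of "-1"]]
  have L: "cm_integral (\<lambda>B. \<mu> B + -1 * \<nu> B) f = cm_integral \<mu> f - cm_integral \<nu> f" if "bdd_borel f" for f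
    using that by (simp only: cm_integral_add_measure[OF \<mu> bounded_cmeas_scale[OF \<nu>]]
      cm_integral_scale_measure[OF \<nu>]) simp
  have F: "meas_functional (cm_integral (\<lambda>B. \<mu> B + -1 * \<nu> B)) K"
  proof (rule meas_functionalI)
    fix f :: "'a \<Rightarrow> complex" and C assume f: "bdd_borel f" "\<And>x. cmod (f x) \<le> C"
    show "cmod (cm_integral (\<lambda>B. \<mu> B + -1 * \<nu> B) f) \<le> K * C" unfolding L[OF f(1)] by (rule le[OF f])
  qed (rule cm_integral_add[OF bd] cm_integral_scale cm_integral_limit[OF bd]; assumption)+
  show ?thesis using tv_norm_cmeas_of[OF F] cmeas_of_cm_integral[OF bd] by simp
qed

lemma bounded_cmeas_diff:
  assumes "bounded_cmeas \<mu>" "bounded_cmeas \<nu>" shows "bounded_cmeas (\<lambda>B. \<mu> B - \<nu> B)"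
  using bounded_cmeas_add[OF assms(1) bounded_cmeas_scale[OF assms(2), of "-1"]] by simp

lemma cm_integral_diff_measure:
  assumes "bounded_cmeas \<mu>" "bounded_cmeas \<nu>" "bdd_borel f"
  shows "cm_integral (\<lambda>B. \<mu> B - \<nu> B) f = cm_integral \<mu> f - cm_integral \<nu> f"
  using cm_integral_add_measure[OF assms(1) bounded_cmeas_scale[OF assms(2), of "-1"] assms(3)]
    cm_integral_scale_measure[OF assms(2,3), of "-1"] by simp

section \<open>The Banach algebra of bounded measures\<close>

text \<open>Makes the inner integral of a convolution an admissible integrand. Measurability is that
  of a parametrised integral over each finite Jordan part.\<close>

lemma bdd_borel_cm_integral_translate:
  fixes f :: "'a::euclidean_space \<Rightarrow> complex"
  assumes \<nu>: "bounded_cmeas \<nu>" and f: "bdd_borel f"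
  shows "bdd_borel (\<lambda>x. cm_integral \<nu> (\<lambda>y. f (x + y)))"
proof -
  have [measurable]: "f \<in> borel_measurable borel" using f by (rule bdd_borel_measurable)
  obtain C where C: "\<And>x. cmod (f x) \<le> C" using f by (auto simp: bdd_borel_def)
  show ?thesis
  proof (rule bdd_borelI)
    show "cmod (cm_integral \<nu> (\<lambda>y. f (x + y))) \<le> tv_norm \<nu> * C" for x
      by (rule cmod_cm_integral_le[OF \<nu> bdd_borel_translate[OF f] C])
    have "(\<lambda>x. LINT y|jpart \<nu> c. f (x + y)) \<in> borel_measurable borel" for c
    proof -
      interpret finite_measure "jpart \<nu> c" by (rule finite_measure_jpart[OF \<nu>])
      have "(\<lambda>(x, y). f (x + y)) \<in> borel_measurable (borel \<Otimes>\<^sub>M borel)" by measurable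
      also have "borel_measurable (borel \<Otimes>\<^sub>M borel) = borel_measurable (borel \<Otimes>\<^sub>M jpart \<nu> c)"
        by (intro measurable_cong_sets sets_pair_measure_cong) auto
      finally show ?thesis by (rule borel_measurable_lebesgue_integral)
    qed
    then show "(\<lambda>x. cm_integral \<nu> (\<lambda>y. f (x + y))) \<in> borel_measurable borel"
      unfolding cm_integral_jpart by measurable
  qed
qed

text \<open>The iterated integral is a bounded functional, hence a measure, and agrees with
  \<open>cm_conv\<close> on indicators. Once its formula holds for all bounded Borel functions,
  associativity and bilinearity of convolution are rewriting.\<close>

lemma
  fixes \<mu> \<nu> :: "'a::euclidean_space cmeas"
  assumes \<mu>: "bounded_cmeas \<mu>" and \<nu>: "bounded_cmeas \<nu>"
  shows bounded_cmeas_conv: "bounded_cmeas (cm_conv \<mu> \<nu>)"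
    and tv_norm_conv: "tv_norm (cm_conv \<mu> \<nu>) \<le> tv_norm \<mu> * tv_norm \<nu>"
    and cm_integral_conv: "bdd_borel f \<Longrightarrow>
      cm_integral (cm_conv \<mu> \<nu>) f = cm_integral \<mu> (\<lambda>x. cm_integral \<nu> (\<lambda>y. f (x + y)))"
proof -
  let ?L = "\<lambda>f. cm_integral \<mu> (\<lambda>x. cm_integral \<nu> (\<lambda>y. f (x + y)))"
  note t = bdd_borel_translate and b = bdd_borel_cm_integral_translate[OF \<nu>]
  have L: "meas_functional ?L (tv_norm \<mu> * tv_norm \<nu>)"
  proof (rule meas_functionalI)
    fix f g :: "'a \<Rightarrow> complex" assume "bdd_borel f" "bdd_borel g"
    then show "?L (\<lambda>x. f x + g x) = ?L f + ?L g"
      by (simp add: cm_integral_add[OF \<nu> t t] cm_integral_add[OF \<mu> b b])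
  next
    fix f :: "'a \<Rightarrow> complex" and C assume f: "bdd_borel f" "\<And>x. cmod (f x) \<le> C"
    show "cmod (?L f) \<le> tv_norm \<mu> * tv_norm \<nu> * C"
      unfolding mult.assoc
      by (rule cmod_cm_integral_le[OF \<mu> b[OF f(1)]]) (rule cmod_cm_integral_le[OF \<nu> t[OF f(1)] f(2)])
  next
    fix s :: "nat \<Rightarrow> 'a \<Rightarrow> complex" and f C
    assume s: "\<And>i. bdd_borel (s i)" "\<And>i x. cmod (s i x) \<le> C" "\<And>x. (\<lambda>i. s i x) \<longlonglongrightarrow> f x"
    show "(\<lambda>i. ?L (s i)) \<longlonglongrightarrow> ?L f"
    proof (rule cm_integral_limit[OF \<mu>])
      show "cmod (cm_integral \<nu> (\<lambda>y. s i (x + y))) \<le> tv_norm \<nu> * C" for i x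
        by (rule cmod_cm_integral_le[OF \<nu> t[OF s(1)] s(2)])
      show "(\<lambda>i. cm_integral \<nu> (\<lambda>y. s i (x + y))) \<longlonglongrightarrow> cm_integral \<nu> (\<lambda>y. f (x + y))" for x
        by (rule cm_integral_limit[OF \<nu> t[OF s(1)] s(2) s(3)])
    qed (rule b[OF s(1)])
  qed (simp add: cm_integral_scale)
  have "cmeas_of ?L = cm_conv \<mu> \<nu>" by (auto simp: cmeas_of_def cm_conv_def fun_eq_iff)
  then show "bounded_cmeas (cm_conv \<mu> \<nu>)" "tv_norm (cm_conv \<mu> \<nu>) \<le> tv_norm \<mu> * tv_norm \<nu>"
    "bdd_borel f \<Longrightarrow> cm_integral (cm_conv \<mu> \<nu>) f = ?L f"
    using bounded_cmeas_of[OF L] tv_norm_cmeas_of[OF L] cm_integral_cmeas_of[OF L] by simp_all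
qed

lemma
  shows bounded_cmeas_dirac: "bounded_cmeas (dirac z)"
    and cm_integral_dirac: "bdd_borel f \<Longrightarrow> cm_integral (dirac z) f = f z"
proof -
  have L: "meas_functional (\<lambda>f. f z) 1" by (rule meas_functionalI) auto
  have "cmeas_of (\<lambda>f. f z) = dirac z" by (auto simp: cmeas_of_def dirac_def fun_eq_iff)
  then show "bounded_cmeas (dirac z)" "bdd_borel f \<Longrightarrow> cm_integral (dirac z) f = f z"
    using bounded_cmeas_of[OF L] cm_integral_cmeas_of[OF L] by simp_all
qed

lemma M_algebra_simps [simp]:
  "car M_algebra = {\<mu>. bounded_cmeas \<mu>}" "vzero M_algebra = (\<lambda>_. 0)" "vadd M_algebra = (\<lambda>\<mu> \<nu> B. \<mu> B + \<nu> B)"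
  "vscale M_algebra = (\<lambda>c \<mu> B. c * \<mu> B)" "vnorm M_algebra = tv_norm" "amult M_algebra = cm_conv"
  by (auto simp: M_algebra_def)

lemma vdist_M_algebra: "vdist M_algebra \<mu> \<nu> = tv_norm (\<lambda>B. \<mu> B - \<nu> B)"
  by (simp add: vdist_def)

text \<open>Integrals of a fixed test function form a Cauchy sequence. Their limit is a functional
  of the required kind; its sequential continuity holds because the convergence is uniform over test
  functions with a common bound.\<close>

lemma M_complete:
  fixes X :: "nat \<Rightarrow> ('a::euclidean_space) cmeas"
  assumes X: "\<And>n. bounded_cmeas (X n)"
    and cau: "\<And>e. e > 0 \<Longrightarrow> \<exists>N. \<forall>m\<ge>N. \<forall>n\<ge>N. tv_norm (\<lambda>B. X m B - X n B) < e"
  shows "\<exists>\<mu>. bounded_cmeas \<mu> \<and> (\<lambda>n. tv_norm (\<lambda>B. X n B - \<mu> B)) \<longlonglongrightarrow> 0"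
proof -
  have d: "cmod (cm_integral (X m) f - cm_integral (X n) f) \<le> tv_norm (\<lambda>B. X m B - X n B) * C"
    if "bdd_borel f" "\<And>x. cmod (f x) \<le> C" for m n f C
    using cmod_cm_integral_le[OF bounded_cmeas_diff[OF X X] that] cm_integral_diff_measure[OF X X that(1)]
    by simp
  have "convergent (\<lambda>n. cm_integral (X n) f)" if f: "bdd_borel f" for f
  proof (rule Cauchy_convergent, rule CauchyI)
    fix e :: real assume e: "e > 0"
    obtain C where C: "\<And>x. cmod (f x) \<le> C" using f by (auto simp: bdd_borel_def)
    have C1: "\<bar>C\<bar> + 1 > 0" by simp
    obtain N where N: "\<And>m n. m \<ge> N \<Longrightarrow> n \<ge> N \<Longrightarrow> tv_norm (\<lambda>B. X m B - X n B) < e / (\<bar>C\<bar> + 1)"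
      using cau[OF divide_pos_pos[OF e C1]] by blast
    have "norm (cm_integral (X m) f - cm_integral (X n) f) < e" if "m \<ge> N" "n \<ge> N" for m n
    proof -
      have "cmod (f x) \<le> \<bar>C\<bar> + 1" for x using C[of x] by simp
      then have "cmod (cm_integral (X m) f - cm_integral (X n) f) \<le> tv_norm (\<lambda>B. X m B - X n B) * (\<bar>C\<bar> + 1)"
        by (rule d[OF f])
      also have "\<dots> < e / (\<bar>C\<bar> + 1) * (\<bar>C\<bar> + 1)" by (intro mult_strict_right_mono N that C1)
      also have "\<dots> = e" using C1 by simp
      finally show ?thesis .
    qed
    then show "\<exists>N. \<forall>m\<ge>N. \<forall>n\<ge>N. norm (cm_integral (X m) f - cm_integral (X n) f) < e" by blast
  qed
  then have lim: "(\<lambda>n. cm_integral (X n) f) \<longlonglongrightarrow> lim (\<lambda>n. cm_integral (X n) f)" if "bdd_borel f" for f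
    using that by (simp add: convergent_LIMSEQ_iff)
  define L where "L f = lim (\<lambda>n. cm_integral (X n) f)" for f
  have close: "cmod (cm_integral (X n) f - L f) \<le> e * C"
    if N: "\<And>m n. m \<ge> N \<Longrightarrow> n \<ge> N \<Longrightarrow> tv_norm (\<lambda>B. X m B - X n B) < e" and n: "n \<ge> N"
      and f: "bdd_borel f" "\<And>x. cmod (f x) \<le> C" for e N n f C
  proof -
    have C0: "0 \<le> C" using f(2) norm_ge_zero order_trans by blast
    have "(\<lambda>m. cmod (cm_integral (X n) f - cm_integral (X m) f)) \<longlonglongrightarrow> cmod (cm_integral (X n) f - L f)"
      unfolding L_def by (intro tendsto_norm tendsto_diff tendsto_const lim f)
    moreover have "cmod (cm_integral (X n) f - cm_integral (X m) f) \<le> e * C" if "m \<ge> N" for m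
      using d[OF f, of n m] mult_right_mono[OF less_imp_le[OF N[OF n that]] C0] by linarith
    ultimately show ?thesis using LIMSEQ_le_const2 by blast
  qed
  obtain N1 where N1: "\<And>m n. m \<ge> N1 \<Longrightarrow> n \<ge> N1 \<Longrightarrow> tv_norm (\<lambda>B. X m B - X n B) < 1"
    using cau[OF zero_less_one] by blast
  have L: "meas_functional L (tv_norm (X N1) + 1)"
  proof (rule meas_functionalI)
    fix f g :: "'a \<Rightarrow> complex" assume fg: "bdd_borel f" "bdd_borel g"
    have "(\<lambda>n. cm_integral (X n) (\<lambda>x. f x + g x)) \<longlonglongrightarrow> L f + L g"
      unfolding L_def cm_integral_add[OF X fg] by (intro tendsto_add lim fg)
    then show "L (\<lambda>x. f x + g x) = L f + L g" unfolding L_def by (rule limI)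
  next
    fix c and f :: "'a \<Rightarrow> complex" assume f: "bdd_borel f"
    have "(\<lambda>n. cm_integral (X n) (\<lambda>x. c * f x)) \<longlonglongrightarrow> c * L f"
      unfolding L_def cm_integral_scale by (intro tendsto_mult tendsto_const lim f)
    then show "L (\<lambda>x. c * f x) = c * L f" unfolding L_def by (rule limI)
  next
    fix f :: "'a \<Rightarrow> complex" and C assume f: "bdd_borel f" "\<And>x. cmod (f x) \<le> C"
    have "cmod (L f) \<le> cmod (cm_integral (X N1) f) + cmod (cm_integral (X N1) f - L f)"
      by (metis norm_minus_commute norm_triangle_sub)
    then show "cmod (L f) \<le> (tv_norm (X N1) + 1) * C"
      using cmod_cm_integral_le[OF X f, of N1] close[where N = N1 and n = N1, OF N1 order_refl f] by (simp add: distrib_right)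
  next
    fix s :: "nat \<Rightarrow> 'a \<Rightarrow> complex" and f C
    assume s: "\<And>i. bdd_borel (s i)" "\<And>i x. cmod (s i x) \<le> C" "\<And>x. (\<lambda>i. s i x) \<longlonglongrightarrow> f x"
    have f: "bdd_borel f" by (rule bdd_borel_limit[OF s])
    have fC: "cmod (f x) \<le> C" for x
      using LIMSEQ_le_const2[OF tendsto_norm[OF s(3)[of x]]] s(2) by blast
    have C0: "0 \<le> C" using fC norm_ge_zero order_trans by blast
    show "(\<lambda>i. L (s i)) \<longlonglongrightarrow> L f"
    proof (rule LIMSEQ_I)
      fix e :: real assume e: "e > 0"
      \<comment> \<open>Three errors of e / 3: replacing L by \<open>X N\<close> at both ends, and
        the continuity of \<open>X N\<close>. The denominator has C + 1 because C may be 0.\<close>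
      define e' where "e' = e / (3 * (C + 1))"
      have e': "e' > 0" using e C0 by (simp add: e'_def)
      have e'C: "e' * C \<le> e / 3"
      proof -
        have "e' * C \<le> e' * (C + 1)" using e' by simp
        also have "\<dots> = e / 3" using C0 by (simp add: e'_def field_simps)
        finally show ?thesis .
      qed
      obtain N where N: "\<And>m n. m \<ge> N \<Longrightarrow> n \<ge> N \<Longrightarrow> tv_norm (\<lambda>B. X m B - X n B) < e'"
        using cau[OF e'] by blast
      have "(\<lambda>i. cm_integral (X N) (s i)) \<longlonglongrightarrow> cm_integral (X N) f" by (rule cm_integral_limit[OF X s])
      then obtain K where K: "\<And>i. i \<ge> K \<Longrightarrow> cmod (cm_integral (X N) (s i) - cm_integral (X N) f) < e / 3"
        using LIMSEQ_D[of _ _ "e / 3"] e by (metis divide_pos_pos zero_less_numeral)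
      have "norm (L (s i) - L f) < e" if "i \<ge> K" for i
      proof -
        have "L (s i) - L f = - (cm_integral (X N) (s i) - L (s i)) + (cm_integral (X N) (s i) - cm_integral (X N) f)
          + (cm_integral (X N) f - L f)" by simp
        then have "cmod (L (s i) - L f) \<le> cmod (cm_integral (X N) (s i) - L (s i))
          + cmod (cm_integral (X N) (s i) - cm_integral (X N) f) + cmod (cm_integral (X N) f - L f)"
          by (metis norm_minus_cancel norm_triangle_mono norm_triangle_ineq order_refl)
        then show ?thesis
          using close[where N = N and n = N, OF N order_refl s(1)[of i] s(2)[of i]]
            close[where N = N and n = N, OF N order_refl f fC] K[OF that] e'C by simp
      qed
      then show "\<exists>K. \<forall>i\<ge>K. norm (L (s i) - L f) < e" by blast
    qed
  qed
  note b = bounded_cmeas_of[OF L]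
  have "(\<lambda>n. tv_norm (\<lambda>B. X n B - cmeas_of L B)) \<longlonglongrightarrow> 0"
  proof (rule LIMSEQ_I)
    fix e :: real assume e: "e > 0"
    then have e2: "e / 2 > 0" by simp
    obtain N where N: "\<And>m n. m \<ge> N \<Longrightarrow> n \<ge> N \<Longrightarrow> tv_norm (\<lambda>B. X m B - X n B) < e / 2"
      using cau[OF e2] by blast
    have "norm (tv_norm (\<lambda>B. X n B - cmeas_of L B) - 0) < e" if "n \<ge> N" for n
    proof -
      have "tv_norm (\<lambda>B. X n B - cmeas_of L B) \<le> e / 2"
      proof (rule tv_norm_diff_leI[OF X b])
        fix f :: "'a \<Rightarrow> complex" and C assume f: "bdd_borel f" "\<And>x. cmod (f x) \<le> C"
        show "cmod (cm_integral (X n) f - cm_integral (cmeas_of L) f) \<le> e / 2 * C"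
          unfolding cm_integral_cmeas_of[OF L f(1)] by (rule close[where N = N and n = n, OF N that f])
      qed
      then show ?thesis using tv_norm_nonneg[of "\<lambda>B. X n B - cmeas_of L B"] e by simp
    qed
    then show "\<exists>N. \<forall>n\<ge>N. norm (tv_norm (\<lambda>B. X n B - cmeas_of L B) - 0) < e" by blast
  qed
  with b show ?thesis by blast
qed

lemma cbanach_algebra_M: "cbanach_algebra (M_algebra :: ('a::euclidean_space) cmeas cnormed_alg)"
proof
  fix \<mu> \<nu> \<rho> :: "'a cmeas" and c c' and X :: "nat \<Rightarrow> 'a cmeas"
  show "vzero M_algebra \<in> (car M_algebra :: 'a cmeas set)" by (simp add: bounded_cmeas_zero)
  show "vadd M_algebra \<mu> \<nu> \<in> car M_algebra" if "\<mu> \<in> car M_algebra" "\<nu> \<in> car M_algebra"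
    using that by (simp add: bounded_cmeas_add)
  show "vscale M_algebra c \<mu> \<in> car M_algebra" if "\<mu> \<in> car M_algebra"
    using that by (simp add: bounded_cmeas_scale)
  show "vnorm M_algebra \<mu> = 0 \<longleftrightarrow> \<mu> = vzero M_algebra" if "\<mu> \<in> car M_algebra"
  proof
    assume "vnorm M_algebra \<mu> = 0"
    then have "\<mu> B = 0" for B using cmod_le_tv_norm[of \<mu> B] that by simp
    then show "\<mu> = vzero M_algebra" by (simp add: fun_eq_iff)
  qed (simp add: tv_norm_zero)
  show "vnorm M_algebra (vscale M_algebra c \<mu>) = cmod c * vnorm M_algebra \<mu>" if "\<mu> \<in> car M_algebra"
    using that by (simp add: tv_norm_scale)
  show "vnorm M_algebra (vadd M_algebra \<mu> \<nu>) \<le> vnorm M_algebra \<mu> + vnorm M_algebra \<nu>"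
    if "\<mu> \<in> car M_algebra" "\<nu> \<in> car M_algebra"
    using that by (simp add: tv_norm_add)
  show "\<exists>l\<in>car M_algebra. vlim M_algebra X l" if "range X \<subseteq> car M_algebra" "vcauchy M_algebra X"
    using that M_complete[of X] unfolding vlim_def vcauchy_def vdist_M_algebra by auto
  note t = bdd_borel_translate and b = bdd_borel_cm_integral_translate
  show "bilinear_on M_algebra M_algebra M_algebra (amult (M_algebra :: 'a cmeas cnormed_alg))"
    unfolding bilinear_on_def
  proof (intro conjI ballI allI)
    fix \<mu> \<mu>' \<nu> \<nu>' :: "'a cmeas" and c
    assume "\<mu> \<in> car M_algebra" "\<nu> \<in> car M_algebra"
    then have bm: "bounded_cmeas \<mu>" "bounded_cmeas \<nu>" by auto
    show "amult M_algebra \<mu> \<nu> \<in> car M_algebra" using bm by (simp add: bounded_cmeas_conv)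
    show "amult M_algebra (vscale M_algebra c \<mu>) \<nu> = vscale M_algebra c (amult M_algebra \<mu> \<nu>)"
      using bm by (auto intro!: cmeas_eqI bounded_cmeas_conv bounded_cmeas_scale
        simp: cm_integral_conv cm_integral_scale_measure bounded_cmeas_scale bounded_cmeas_conv b)
    show "amult M_algebra \<mu> (vscale M_algebra c \<nu>) = vscale M_algebra c (amult M_algebra \<mu> \<nu>)"
      using bm by (auto intro!: cmeas_eqI bounded_cmeas_conv bounded_cmeas_scale
        simp: cm_integral_conv cm_integral_scale_measure bounded_cmeas_scale bounded_cmeas_conv t cm_integral_scale)
    show "amult M_algebra (vadd M_algebra \<mu> \<mu>') \<nu> = vadd M_algebra (amult M_algebra \<mu> \<nu>) (amult M_algebra \<mu>' \<nu>)"
      if "\<mu>' \<in> car M_algebra"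
      using bm that by (auto intro!: cmeas_eqI bounded_cmeas_conv bounded_cmeas_add
        simp: cm_integral_conv cm_integral_add_measure bounded_cmeas_add bounded_cmeas_conv b)
    show "amult M_algebra \<mu> (vadd M_algebra \<nu> \<nu>') = vadd M_algebra (amult M_algebra \<mu> \<nu>) (amult M_algebra \<mu> \<nu>')"
      if "\<nu>' \<in> car M_algebra"
      using bm that by (auto intro!: cmeas_eqI bounded_cmeas_conv bounded_cmeas_add
        simp: cm_integral_conv cm_integral_add_measure bounded_cmeas_add bounded_cmeas_conv t b cm_integral_add)
  qed
  show "amult M_algebra (amult M_algebra \<mu> \<nu>) \<rho> = amult M_algebra \<mu> (amult M_algebra \<nu> \<rho>)"
    if "\<mu> \<in> car M_algebra" "\<nu> \<in> car M_algebra" "\<rho> \<in> car M_algebra"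
    using that by (auto intro!: cmeas_eqI bounded_cmeas_conv
      simp: cm_integral_conv bounded_cmeas_conv t b add.assoc)
  show "vnorm M_algebra (amult M_algebra \<mu> \<nu>) \<le> vnorm M_algebra \<mu> * vnorm M_algebra \<nu>"
    if "\<mu> \<in> car M_algebra" "\<nu> \<in> car M_algebra"
    using that by (simp add: tv_norm_conv)
qed (simp_all add: algebra_simps)

section \<open>Discretisation\<close>

text \<open>Equicontinuity provides one countable cover by balls on which every H of the family
  stays within \<delta> of its value at the centre. The nodes are these centres, even where a centre
  lies outside its disjointed piece, and the weights are the measures of the pieces.\<close>

lemma discretisation:
  fixes \<mu> :: "'a::euclidean_space cmeas" and \<H> :: "('a \<Rightarrow> complex) set"
  assumes \<mu>: "bounded_cmeas \<mu>" and \<epsilon>: "\<epsilon> > 0"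
    and bdd: "\<And>H. H \<in> \<H> \<Longrightarrow> bdd_borel H" "\<And>H x. H \<in> \<H> \<Longrightarrow> cmod (H x) \<le> C"
    and equi: "\<And>z \<delta>. \<delta> > 0 \<Longrightarrow> \<exists>r>0. \<forall>w. dist z w < r \<longrightarrow> (\<forall>H\<in>\<H>. cmod (H w - H z) \<le> \<delta>)"
  shows "\<exists>N z c. \<forall>H\<in>\<H>. cmod (cm_integral \<mu> H - (\<Sum>i<N::nat. c i * H (z i))) \<le> \<epsilon>"
proof -
  obtain \<delta> where "\<delta> > 0" and \<delta>: "\<And>A :: nat \<Rightarrow> 'a set. range A \<subseteq> sets borel \<Longrightarrow> disjoint_family A \<Longrightarrow>
      (\<Union>i. A i) = UNIV \<Longrightarrow> \<exists>N. \<forall>f z. bdd_borel f \<longrightarrow> (\<forall>x. cmod (f x) \<le> C) \<longrightarrow>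
        (\<forall>i. \<forall>x\<in>A i. cmod (f x - z i) \<le> \<delta>) \<longrightarrow> cmod (cm_integral \<mu> f - (\<Sum>i<N. z i * \<mu> (A i))) \<le> \<epsilon>"
    by (rule partition_approx[OF \<mu> \<epsilon>, of C]) blast
  have "\<forall>z. \<exists>r>0. \<forall>w. dist z w < r \<longrightarrow> (\<forall>H\<in>\<H>. cmod (H w - H z) \<le> \<delta>)" using equi[OF \<open>\<delta> > 0\<close>] by blast
  from choice[OF this] obtain r
    where r: "\<And>z. r z > 0" "\<And>z w H. dist z w < r z \<Longrightarrow> H \<in> \<H> \<Longrightarrow> cmod (H w - H z) \<le> \<delta>" by blast
  obtain q :: "nat \<Rightarrow> 'a" where q: "\<forall>x. \<exists>n. x \<in> ball (q n) (r (q n))"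
    using ex_countable_subcover[of "\<lambda>z. ball z (r z)"] r(1) by auto
  define A where "A = disjointed (\<lambda>n. ball (q n) (r (q n)))"
  have A: "range A \<subseteq> sets borel" "disjoint_family A" "(\<Union>i. A i) = UNIV"
  proof -
    show "range A \<subseteq> sets borel" unfolding A_def by (rule sets.range_disjointed_sets) auto
    show "disjoint_family A" unfolding A_def by (rule disjoint_family_disjointed)
    show "(\<Union>i. A i) = UNIV" unfolding A_def UN_disjointed_eq using q by blast
  qed
  obtain N where N: "\<forall>f z. bdd_borel f \<longrightarrow> (\<forall>x. cmod (f x) \<le> C) \<longrightarrow>
        (\<forall>i. \<forall>x\<in>A i. cmod (f x - z i) \<le> \<delta>) \<longrightarrow> cmod (cm_integral \<mu> f - (\<Sum>i<N. z i * \<mu> (A i))) \<le> \<epsilon>"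
    using \<delta>[OF A] by blast
  have "cmod (cm_integral \<mu> H - (\<Sum>i<N. H (q i) * \<mu> (A i))) \<le> \<epsilon>" if H: "H \<in> \<H>" for H
  proof (rule N[rule_format, OF bdd(1)[OF H] bdd(2)[OF H]])
    fix i x assume "x \<in> A i"
    then have "dist (q i) x < r (q i)"
      using disjointed_subset[of "\<lambda>n. ball (q n) (r (q n))" i] by (auto simp: A_def)
    then show "cmod (H x - H (q i)) \<le> \<delta>" using r(2) H by blast
  qed
  then show ?thesis by (intro exI[of _ N] exI[of _ q] exI[of _ "\<lambda>i. \<mu> (A i)"]) (simp add: mult.commute)
qed

section \<open>The ideal \<open>L\<^sup>1\<close>\<close>

lemma
  fixes g :: "'a::euclidean_space \<Rightarrow> complex"
  assumes g: "integrable lborel g"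
  shows bounded_cmeas_density: "bounded_cmeas (density_cmeas g)"
    and cm_integral_density: "bdd_borel f \<Longrightarrow> cm_integral (density_cmeas g) f = (LINT x|lborel. g x * f x)"
proof -
  let ?L = "\<lambda>f. LINT x|lborel. g x * f x"
  have gm[measurable]: "g \<in> borel_measurable borel" using borel_measurable_integrable[OF g] by simp
  have int: "integrable lborel (\<lambda>x. g x * f x)" if f: "bdd_borel f" for f
  proof -
    have [measurable]: "f \<in> borel_measurable borel" using f by (rule bdd_borel_measurable)
    obtain C where C: "\<And>x. cmod (f x) \<le> C" using f by (auto simp: bdd_borel_def)
    have "cmod (g x * f x) \<le> norm (C * cmod (g x))" for x
      using mult_right_mono[OF order_trans[OF C abs_ge_self], of "cmod (g x)" x]
      by (simp add: norm_mult abs_mult mult.commute)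
    then show ?thesis
      by (intro Bochner_Integration.integrable_bound[OF integrable_mult_right[OF integrable_norm[OF g]]] AE_I2)
        auto
  qed
  have L: "meas_functional ?L (LINT x|lborel. cmod (g x))"
  proof (rule meas_functionalI)
    fix f :: "'a \<Rightarrow> complex" and C assume f: "bdd_borel f" "\<And>x. cmod (f x) \<le> C"
    have "cmod (?L f) \<le> (LINT x|lborel. cmod (g x * f x))" by (rule integral_norm_bound)
    also have "\<dots> \<le> (LINT x|lborel. cmod (g x) * C)"
      using g f by (intro integral_mono integrable_norm int) (auto simp: norm_mult mult_left_mono)
    finally show "cmod (?L f) \<le> (LINT x|lborel. cmod (g x)) * C" by simp
  next
    fix s :: "nat \<Rightarrow> 'a \<Rightarrow> complex" and f C
    assume s: "\<And>i. bdd_borel (s i)" "\<And>i x. cmod (s i x) \<le> C" "\<And>x. (\<lambda>i. s i x) \<longlonglongrightarrow> f x"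
    have [measurable]: "f \<in> borel_measurable borel" "\<And>i. s i \<in> borel_measurable borel"
      using bdd_borel_measurable[OF bdd_borel_limit[OF s]] bdd_borel_measurable[OF s(1)] by auto
    show "(\<lambda>i. ?L (s i)) \<longlonglongrightarrow> ?L f"
    proof (rule integral_dominated_convergence[where w = "\<lambda>x. C * cmod (g x)"])
      show "AE x in lborel. (\<lambda>i. g x * s i x) \<longlonglongrightarrow> g x * f x" by (intro AE_I2 tendsto_mult tendsto_const s(3))
      show "AE x in lborel. norm (g x * s i x) \<le> C * cmod (g x)" for i
        by (intro AE_I2) (simp add: norm_mult mult.commute[of C] mult_left_mono s(2))
    qed (use g in auto)
  qed (auto simp: distrib_left int mult.left_commute[of "g _"])
  have "cmeas_of ?L = density_cmeas g"
    by (auto simp: cmeas_of_def density_cmeas_def fun_eq_iff set_lebesgue_integral_def indicator_def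
      intro!: Bochner_Integration.integral_cong)
  then show "bounded_cmeas (density_cmeas g)" "bdd_borel f \<Longrightarrow> cm_integral (density_cmeas g) f = ?L f"
    using bounded_cmeas_of[OF L] cm_integral_cmeas_of[OF L] by simp_all
qed

lemma density_cmeas_null:
  assumes "N \<in> null_sets lborel" shows "density_cmeas g N = 0"
proof -
  have "AE x in lborel. x \<notin> N" using assms by (rule AE_not_in)
  then have "(LINT x|lborel. indicator N x *\<^sub>R g x) = 0"
    by (intro integral_eq_zero_AE) (auto elim!: eventually_mono simp: indicator_def)
  then show ?thesis by (simp add: density_cmeas_def set_lebesgue_integral_def)
qed

text \<open>Radon-Nikodym for each Jordan part. Absolute continuity passes to these parts because
  all Borel subsets of a null set are null, so the supremum defining the positive part is 0.\<close>

lemma density_cmeas_if_null: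
  fixes \<mu> :: "'a::euclidean_space cmeas"
  assumes \<mu>: "bounded_cmeas \<mu>" and null: "\<And>N. N \<in> null_sets lborel \<Longrightarrow> \<mu> N = 0"
  shows "\<exists>g. integrable lborel g \<and> \<mu> = density_cmeas g"
proof -
  have "\<exists>k. integrable lborel k \<and> (\<forall>B\<in>sets borel. measure (jpart \<mu> c) B = (LINT x|lborel. indicator B x * k x))" for c
  proof -
    interpret finite_measure "jpart \<mu> c" by (rule finite_measure_jpart[OF \<mu>])
    have "absolutely_continuous lborel (jpart \<mu> c)"
      unfolding absolutely_continuous_def
    proof
      fix N :: "'a set" assume N: "N \<in> null_sets lborel"
      then have Nb: "N \<in> sets borel" by auto
      have "emeasure (jpart \<mu> c) N \<le> 0"
        unfolding jpart_def emeasure_pos_part[OF signed_cmeas_Re[OF \<mu>] Nb]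
      proof (rule SUP_least)
        fix A assume "A \<in> {A \<in> sets borel. A \<subseteq> N}"
        then have "A \<in> null_sets lborel" using N by (intro null_sets_subset[OF N]) auto
        then show "ennreal (Re (cnj c * \<mu> A)) \<le> 0" using null by simp
      qed
      then show "N \<in> null_sets (jpart \<mu> c)" using Nb by auto
    qed
    then obtain h where h: "h \<in> borel_measurable lborel" "density lborel h = jpart \<mu> c"
      using sigma_finite_measure.Radon_Nikodym[OF sigma_finite_lborel, of "jpart \<mu> c"] by auto
    have [measurable]: "h \<in> borel_measurable borel" using h(1) by simp
    have em: "emeasure (jpart \<mu> c) B = (\<integral>\<^sup>+ x. h x * indicator B x \<partial>lborel)" if "B \<in> sets borel" for B
      unfolding h(2)[symmetric] using that by (simp add: emeasure_density)
    have "(\<integral>\<^sup>+ x. h x \<partial>lborel) \<noteq> \<infinity>" using em[of UNIV] emeasure_finite[of UNIV] by simp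
    then have fin: "AE x in lborel. h x \<noteq> \<infinity>" by (intro nn_integral_noteq_infinite) auto
    \<comment> \<open>The derivative may be infinite on a null set; \<open>enn2real\<close> puts 0
      there.\<close>
    define k where "k x = enn2real (h x)" for x
    have [measurable]: "k \<in> borel_measurable borel" unfolding k_def by measurable
    have eq: "(\<integral>\<^sup>+ x. h x * indicator B x \<partial>lborel) = (\<integral>\<^sup>+ x. ennreal (indicator B x * k x) \<partial>lborel)" for B
      by (rule nn_integral_cong_AE)
        (use fin in \<open>eventually_elim, auto simp: k_def indicator_def ennreal_enn2real_if\<close>)
    have ki: "integrable lborel (\<lambda>x. indicator B x * k x)" if B[measurable]: "B \<in> sets borel" for B
    proof (rule integrableI_nonneg)
      have "(\<integral>\<^sup>+ x. ennreal (indicator B x * k x) \<partial>lborel) = emeasure (jpart \<mu> c) B" using em[OF B] eq by simp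
      then show "(\<integral>\<^sup>+ x. ennreal (indicator B x * k x) \<partial>lborel) < \<infinity>"
        by (simp add: emeasure_eq_measure)
    qed (auto simp: k_def)
    have "measure (jpart \<mu> c) B = (LINT x|lborel. indicator B x * k x)" if B[measurable]: "B \<in> sets borel" for B
    proof -
      have "(LINT x|lborel. indicator B x * k x) = enn2real (\<integral>\<^sup>+ x. ennreal (indicator B x * k x) \<partial>lborel)"
        by (rule integral_eq_nn_integral) (auto simp: k_def)
      then show ?thesis using em[OF B] eq by (simp add: measure_def)
    qed
    moreover have "integrable lborel k" using ki[of UNIV] by simp
    ultimately show ?thesis by blast
  qed
  then obtain k where k: "\<And>c. integrable lborel (k c)"
    "\<And>c B. B \<in> sets borel \<Longrightarrow> measure (jpart \<mu> c) B = (LINT x|lborel. indicator B x * k c x)"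
    by metis
  define g where "g x = (\<Sum>c\<in>units4. c * complex_of_real (k c x))" for x
  have g: "integrable lborel g" unfolding g_def using k(1) by (intro Bochner_Integration.integrable_sum integrable_mult_right) auto
  have "\<mu> B = density_cmeas g B" if B: "B \<in> sets borel" for B
  proof -
    have ik: "integrable lborel (\<lambda>x. complex_of_real (indicator B x * k c x))" for c
      using integrable_mult_indicator[of B lborel "k c"] B k(1)[of c] by (intro integrable_of_real) simp
    have "density_cmeas g B = (LINT x|lborel. (\<Sum>c\<in>units4. c * complex_of_real (indicator B x * k c x)))"
      unfolding density_cmeas_def set_lebesgue_integral_def g_def using B
      by (auto simp: indicator_def scaleR_sum_right intro!: Bochner_Integration.integral_cong sum.cong)
    also have "\<dots> = (\<Sum>c\<in>units4. c * complex_of_real (measure (jpart \<mu> c) B))"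
      unfolding k(2)[OF B]
      by (subst Bochner_Integration.integral_sum) (auto intro: ik simp: integral_complex_of_real simp del: of_real_mult sum.insert)
    also have "\<dots> = \<mu> B" by (rule cmeas_eq_jparts[OF \<mu> B, symmetric])
    finally show ?thesis by simp
  qed
  moreover have "\<mu> B = density_cmeas g B" if "B \<notin> sets borel" for B
    using \<mu> that by (simp add: bounded_cmeas_def density_cmeas_def)
  ultimately show ?thesis using g by blast
qed

text \<open>Vanishing on null sets is visibly preserved by sums, convolution and norm limits, which
  is less evident for a set of densities.\<close>

lemma car_L1_algebra:
  "car (L1_algebra :: ('a::euclidean_space) cmeas cnormed_alg) = {\<mu>. bounded_cmeas \<mu> \<and> (\<forall>N\<in>null_sets lborel. \<mu> N = 0)}"
proof -
  have "car (L1_algebra :: 'a cmeas cnormed_alg) = density_cmeas ` {f. integrable lborel f}"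
    by (simp add: L1_algebra_def)
  also have "\<dots> = {\<mu>. bounded_cmeas \<mu> \<and> (\<forall>N\<in>null_sets lborel. \<mu> N = 0)}"
    using density_cmeas_if_null by (auto simp: bounded_cmeas_density density_cmeas_null)
  finally show ?thesis .
qed

lemma L1_algebra_simps [simp]:
  "vzero L1_algebra = (\<lambda>_. 0)" "vadd L1_algebra = (\<lambda>\<mu> \<nu> B. \<mu> B + \<nu> B)"
  "vscale L1_algebra = (\<lambda>c \<mu> B. c * \<mu> B)" "vnorm L1_algebra = tv_norm" "amult L1_algebra = cm_conv"
  by (auto simp: L1_algebra_def)

lemma vdist_L1_algebra: "vdist L1_algebra \<mu> \<nu> = tv_norm (\<lambda>B. \<mu> B - \<nu> B)"
  by (simp add: vdist_def)

lemma null_sets_lborel_translate: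
  fixes N :: "'a::euclidean_space set"
  assumes "N \<in> null_sets lborel" shows "{y. x + y \<in> N} \<in> null_sets lborel"
proof -
  have N: "N \<in> sets borel" using assms by auto
  have m: "(+) x \<in> measurable lborel borel" by simp
  have e: "(+) x -` N = {y. x + y \<in> N}" by auto
  have "{y. x + y \<in> N} \<in> sets borel"
    using measurable_sets[OF m N] by (simp add: e)
  moreover have "emeasure lborel {y. x + y \<in> N} = emeasure (distr lborel borel ((+) x)) N"
    using N by (simp add: emeasure_distr e)
  ultimately show ?thesis using assms by (simp add: lborel_distr_plus null_sets_def)
qed

text \<open>The ideal property. By translation invariance of Lebesgue measure the inner integral is
  over a null set for every x.\<close>

lemma cm_conv_null:
  assumes \<mu>: "bounded_cmeas \<mu>" and \<nu>: "bounded_cmeas \<nu>" and null: "\<And>N. N \<in> null_sets lborel \<Longrightarrow> \<nu> N = 0"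
    and N: "N \<in> null_sets lborel"
  shows "cm_conv \<mu> \<nu> N = 0"
proof -
  have "cm_integral \<nu> (\<lambda>y. indicator N (x + y)) = 0" for x
  proof -
    have t: "{y. x + y \<in> N} \<in> null_sets lborel" by (rule null_sets_lborel_translate[OF N])
    have "(\<lambda>y. indicator N (x + y) :: complex) = indicator {y. x + y \<in> N}" by (auto simp: indicator_def)
    then show ?thesis using cm_integral_indicator[OF \<nu>, of "{y. x + y \<in> N}"] null[OF t] t by auto
  qed
  then show ?thesis by (simp add: cm_conv_def cm_integral_jpart)
qed

lemma cbanach_algebra_L1: "cbanach_algebra (L1_algebra :: ('a::euclidean_space) cmeas cnormed_alg)"
proof -
  let ?L = "L1_algebra :: 'a cmeas cnormed_alg" and ?M = "M_algebra :: 'a cmeas cnormed_alg"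
  interpret M: cbanach_algebra ?M by (rule cbanach_algebra_M)
  have sub: "\<mu> \<in> car ?M" if "\<mu> \<in> car ?L" for \<mu> using that by (simp add: car_L1_algebra)
  show ?thesis
  proof
    fix \<mu> \<nu> \<rho> :: "'a cmeas" and c c' and X :: "nat \<Rightarrow> 'a cmeas"
    show "vzero ?L \<in> car ?L" by (simp add: car_L1_algebra bounded_cmeas_zero)
    show "vadd ?L \<mu> \<nu> \<in> car ?L" if "\<mu> \<in> car ?L" "\<nu> \<in> car ?L"
      using that by (simp add: car_L1_algebra bounded_cmeas_add)
    show "vscale ?L c \<mu> \<in> car ?L" if "\<mu> \<in> car ?L"
      using that by (simp add: car_L1_algebra bounded_cmeas_scale)
    show "vnorm ?L \<mu> = 0 \<longleftrightarrow> \<mu> = vzero ?L" if "\<mu> \<in> car ?L" using M.norm_zero_iff[OF sub[OF that]] by simp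
    show "vnorm ?L (vscale ?L c \<mu>) = cmod c * vnorm ?L \<mu>" if "\<mu> \<in> car ?L"
      using M.norm_scale[OF sub[OF that]] by simp
    show "vnorm ?L (vadd ?L \<mu> \<nu>) \<le> vnorm ?L \<mu> + vnorm ?L \<nu>" if "\<mu> \<in> car ?L" "\<nu> \<in> car ?L"
      using M.norm_triangle[OF sub[OF that(1)] sub[OF that(2)]] by simp
    show "\<exists>l\<in>car ?L. vlim ?L X l" if X: "range X \<subseteq> car ?L" "vcauchy ?L X"
    proof -
      have b: "bounded_cmeas (X n)" and nl: "N \<in> null_sets lborel \<Longrightarrow> X n N = 0" for n N
        using X(1) by (auto simp: car_L1_algebra)
      obtain l where l: "bounded_cmeas l" "(\<lambda>n. tv_norm (\<lambda>B. X n B - l B)) \<longlonglongrightarrow> 0"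
        using M_complete[of X] b X(2) unfolding vcauchy_def vdist_L1_algebra by auto
      have "l N = 0" if N: "N \<in> null_sets lborel" for N
      proof -
        have "cmod (l N) \<le> tv_norm (\<lambda>B. X n B - l B)" for n
          using cmod_le_tv_norm[OF bounded_cmeas_diff[OF b l(1)], of n N] nl[OF N] by simp
        then have "cmod (l N) \<le> 0" using LIMSEQ_le_const[OF l(2)] by blast
        then show ?thesis by simp
      qed
      then show ?thesis using l unfolding vlim_def vdist_L1_algebra car_L1_algebra by blast
    qed
    show "bilinear_on ?L ?L ?L (amult ?L)"
    proof -
      have "amult ?L \<mu> \<nu> \<in> car ?L" if "\<mu> \<in> car ?L" "\<nu> \<in> car ?L" for \<mu> \<nu>
        using that by (simp add: car_L1_algebra bounded_cmeas_conv cm_conv_null)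
      then show ?thesis using M.mult_bilinear sub unfolding bilinear_on_def
        by (simp add: car_L1_algebra)
    qed
    show "amult ?L (amult ?L \<mu> \<nu>) \<rho> = amult ?L \<mu> (amult ?L \<nu> \<rho>)"
      if "\<mu> \<in> car ?L" "\<nu> \<in> car ?L" "\<rho> \<in> car ?L"
      using M.mult_assoc[OF that[THEN sub]] by simp
    show "vnorm ?L (amult ?L \<mu> \<nu>) \<le> vnorm ?L \<mu> * vnorm ?L \<nu>" if "\<mu> \<in> car ?L" "\<nu> \<in> car ?L"
      using M.norm_mult[OF that[THEN sub]] by simp
  qed (simp_all add: algebra_simps)
qed

section \<open>Continuity of translation in \<open>L\<^sup>1\<close>\<close>

definition translation_modulus :: "('a::euclidean_space \<Rightarrow> complex) \<Rightarrow> 'a \<Rightarrow> real" where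
  "translation_modulus f z = (LINT y|lborel. cmod (f (y - z) - f y))"

lemma
  fixes f :: "'a::euclidean_space \<Rightarrow> 'b::{banach, second_countable_topology}"
  assumes f: "integrable lborel f"
  shows integrable_lborel_translate: "integrable lborel (\<lambda>y. f (y - z))"
    and integral_lborel_translate: "(LINT y|lborel. f (y - z)) = (LINT y|lborel. f y)"
proof -
  have [measurable]: "f \<in> borel_measurable borel" using borel_measurable_integrable[OF f] by simp
  have "integrable (distr lborel borel ((+) (- z))) f" using f by (simp add: lborel_distr_plus)
  then show "integrable lborel (\<lambda>y. f (y - z))" by (subst (asm) integrable_distr_eq) auto
  have "(LINT y|lborel. f y) = integral\<^sup>L (distr lborel borel ((+) (- z))) f" by (simp add: lborel_distr_plus)
  then show "(LINT y|lborel. f (y - z)) = (LINT y|lborel. f y)" by (simp add: integral_distr)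
qed

text \<open>The difference f - g enters twice, once translated, hence the factor 2.\<close>

lemma translation_modulus_triangle:
  assumes f: "integrable lborel f" and g: "integrable lborel g"
  shows "translation_modulus f z \<le> translation_modulus g z + 2 * (LINT y|lborel. cmod (f y - g y))"
proof -
  have d: "integrable lborel (\<lambda>y. cmod (f y - g y))" using f g by auto
  have "translation_modulus f z
      \<le> (LINT y|lborel. cmod (f (y - z) - g (y - z)) + (cmod (g (y - z) - g y) + cmod (f y - g y)))"
    unfolding translation_modulus_def
  proof (rule integral_mono)
    fix y
    have "f (y - z) - f y = (f (y - z) - g (y - z)) + ((g (y - z) - g y) + (g y - f y))" by simp
    then show "cmod (f (y - z) - f y) \<le> cmod (f (y - z) - g (y - z)) + (cmod (g (y - z) - g y) + cmod (f y - g y))"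
      using norm_triangle_ineq[of "f (y - z) - g (y - z)" "(g (y - z) - g y) + (g y - f y)"]
        norm_triangle_ineq[of "g (y - z) - g y" "g y - f y"] by (simp add: norm_minus_commute)
  qed (use f g in \<open>auto intro!: integrable_lborel_translate Bochner_Integration.integrable_add integrable_norm Bochner_Integration.integrable_diff\<close>)
  also have "\<dots> = (LINT y|lborel. cmod (f (y - z) - g (y - z))) + (translation_modulus g z + (LINT y|lborel. cmod (f y - g y)))"
  proof -
    have "integrable lborel (\<lambda>y. cmod (f (y - z) - g (y - z)))" by (rule integrable_lborel_translate[OF d])
    moreover have "integrable lborel (\<lambda>y. cmod (g (y - z) - g y))"
      by (intro integrable_norm Bochner_Integration.integrable_diff integrable_lborel_translate[OF g] g)
    ultimately show ?thesis unfolding translation_modulus_def using d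
      by (simp only: Bochner_Integration.integral_add Bochner_Integration.integrable_add)
  qed
  also have "(LINT y|lborel. cmod (f (y - z) - g (y - z))) = (LINT y|lborel. cmod (f y - g y))"
    by (rule integral_lborel_translate[OF d])
  finally show ?thesis by simp
qed

lemma translation_modulus_nonneg: "0 \<le> translation_modulus f z"
  by (simp add: translation_modulus_def)

text \<open>The modulus of a difference of indicators is their sum minus twice their product, so
  only the product has to converge. Inside U openness makes it eventually 1, outside it is 0, and
  the boundary of U causes no exception.\<close>

lemma translation_modulus_open:
  fixes U :: "'a::euclidean_space set" and z :: "nat \<Rightarrow> 'a"
  assumes U: "open U" "emeasure lborel U < \<infinity>" and z: "z \<longlonglongrightarrow> 0"
  shows "(\<lambda>n. translation_modulus (indicator U) (z n)) \<longlonglongrightarrow> 0"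
proof -
  have [measurable]: "U \<in> sets borel" using U by auto
  have iU: "integrable lborel (indicator U :: 'a \<Rightarrow> real)" using U by simp
  have iP: "integrable lborel (\<lambda>y. indicator U y * indicator U (y - w) :: real)" for w :: 'a
    by (rule Bochner_Integration.integrable_bound[OF iU]) (auto simp: indicator_def)
  have eq: "translation_modulus (indicator U) w
      = 2 * (LINT y|lborel. indicator U y :: real) - 2 * (LINT y|lborel. indicator U y * indicator U (y - w))" for w
  proof -
    have "translation_modulus (indicator U) w
        = (LINT y|lborel. (indicator U (y - w) + indicator U y :: real) - 2 * (indicator U y * indicator U (y - w)))"
      unfolding translation_modulus_def
      by (rule Bochner_Integration.integral_cong) (auto simp: indicator_def)
    also have "\<dots> = (LINT y|lborel. indicator U (y - w) :: real) + (LINT y|lborel. indicator U y :: real)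
        - 2 * (LINT y|lborel. indicator U y * indicator U (y - w))"
      using iU iP[of w] integrable_lborel_translate[OF iU, of w] by simp
    also have "(LINT y|lborel. indicator U (y - w) :: real) = (LINT y|lborel. indicator U y :: real)"
      by (rule integral_lborel_translate[OF iU])
    finally show ?thesis by simp
  qed
  have "(\<lambda>n. LINT y|lborel. indicator U y * indicator U (y - z n) :: real) \<longlonglongrightarrow> (LINT y|lborel. indicator U y :: real)"
  proof (rule integral_dominated_convergence[OF _ _ iU])
    show "AE y in lborel. (\<lambda>n. indicator U y * indicator U (y - z n) :: real) \<longlonglongrightarrow> indicator U y"
    proof (rule AE_I2)
      fix y
      show "(\<lambda>n. indicator U y * indicator U (y - z n) :: real) \<longlonglongrightarrow> indicator U y"
      proof (cases "y \<in> U")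
        case True
        have "(\<lambda>n. y - z n) \<longlonglongrightarrow> y - 0" by (intro tendsto_diff tendsto_const z)
        then have "eventually (\<lambda>n. y - z n \<in> U) sequentially"
          using U(1) True by (simp add: tendsto_def)
        then have "eventually (\<lambda>n. indicator U y = (indicator U y * indicator U (y - z n) :: real)) sequentially"
          by eventually_elim (use True in simp)
        then show ?thesis by (rule Lim_transform_eventually[OF tendsto_const])
      qed simp
    qed
  qed (auto simp: indicator_def)
  then have "(\<lambda>n. translation_modulus (indicator U) (z n))
      \<longlonglongrightarrow> 2 * (LINT y|lborel. indicator U y :: real) - 2 * (LINT y|lborel. indicator U y :: real)"
    unfolding eq by (intro tendsto_diff tendsto_mult tendsto_const)
  then show ?thesis by simp
qed

lemma integrable_indicator_complex:
  assumes "A \<in> sets lborel" "emeasure lborel A < \<infinity>"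
  shows "integrable lborel (indicator A :: 'a::euclidean_space \<Rightarrow> complex)"
proof -
  have "(indicator A :: 'a \<Rightarrow> complex) = (\<lambda>x. complex_of_real (indicator A x))"
    by (auto simp: indicator_def)
  then show ?thesis using assms by simp
qed

text \<open>Outer regularity leads from open sets to Borel sets of finite measure, and induction
  over integrable functions does the rest.\<close>

lemma translation_modulus_tendsto:
  fixes f :: "'a::euclidean_space \<Rightarrow> complex"
  assumes "integrable lborel f" and z: "z \<longlonglongrightarrow> 0"
  shows "(\<lambda>n. translation_modulus f (z n)) \<longlonglongrightarrow> 0"
proof -
  \<comment> \<open>The property is closed under approximation in mean; the error e / 4 counts twice
    by the triangle inequality, leaving e / 2 for g.\<close>
  have approx: "(\<lambda>n. translation_modulus f (z n)) \<longlonglongrightarrow> 0"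
    if f: "integrable lborel f" and g: "\<And>e. e > 0 \<Longrightarrow> \<exists>g. integrable lborel g \<and>
      (LINT y|lborel. cmod (f y - g y)) < e \<and> (\<lambda>n. translation_modulus g (z n)) \<longlonglongrightarrow> 0" for f
  proof (rule LIMSEQ_I)
    fix e :: real assume e: "e > 0"
    then obtain g where g: "integrable lborel g" "(LINT y|lborel. cmod (f y - g y)) < e / 4"
      "(\<lambda>n. translation_modulus g (z n)) \<longlonglongrightarrow> 0" using g[of "e / 4"] by auto
    obtain N where N: "\<And>n. n \<ge> N \<Longrightarrow> translation_modulus g (z n) < e / 2"
      using order_tendstoD(2)[OF g(3), of "e / 2"] e by (auto simp: eventually_sequentially)
    have "norm (translation_modulus f (z n) - 0) < e" if "n \<ge> N" for n
      using translation_modulus_triangle[OF f g(1), of "z n"] N[OF that] g(2)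
        translation_modulus_nonneg[of f "z n"] by simp
    then show "\<exists>N. \<forall>n\<ge>N. norm (translation_modulus f (z n) - 0) < e" by blast
  qed
  show ?thesis using assms(1)
  proof (induction f rule: integrable_induct)
    case (base A c)
    then have A[measurable]: "A \<in> sets borel" and fA: "emeasure lborel A < \<infinity>" by auto
    have iA: "integrable lborel (indicator A :: 'a \<Rightarrow> complex)" using fA by (intro integrable_indicator_complex) auto
    have "(\<lambda>n. translation_modulus (indicator A) (z n)) \<longlonglongrightarrow> 0"
    proof (rule approx[OF iA])
      fix e :: real assume e: "e > 0"
      obtain U where U: "open U" "A \<subseteq> U" "emeasure lborel (U - A) < ennreal e"
        using outer_regular_lborel[OF A, of e] e by blast
      have Um[measurable]: "U \<in> sets borel" using U by auto
      have "emeasure lborel U \<le> emeasure lborel A + emeasure lborel (U - A)"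
        using emeasure_subadditive[of A lborel "U - A"] U(2) by (simp add: Un_absorb1)
      also have "\<dots> < \<infinity>" using fA U(3) ennreal_less_top[of e] by (simp add: less_trans)
      finally have fU: "emeasure lborel U < \<infinity>" .
      have "(LINT y|lborel. cmod (indicator A y - indicator U y)) = (LINT y|lborel. indicator (U - A) y :: real)"
        by (rule Bochner_Integration.integral_cong) (use U(2) in \<open>auto simp: indicator_def\<close>)
      also have "\<dots> = measure lborel (U - A)" by simp
      also have "\<dots> < e"
      proof -
        have "emeasure lborel (U - A) \<noteq> top" using less_trans[OF U(3) ennreal_less_top] by simp
        then show ?thesis using U(3) by (simp add: emeasure_eq_ennreal_measure ennreal_less_iff)
      qed
      finally have "(LINT y|lborel. cmod (indicator A y - indicator U y)) < e" .
      moreover have "integrable lborel (indicator U :: 'a \<Rightarrow> complex)" using fU by (intro integrable_indicator_complex) auto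
      ultimately show "\<exists>g. integrable lborel g \<and> (LINT y|lborel. cmod (indicator A y - g y)) < e \<and>
          (\<lambda>n. translation_modulus g (z n)) \<longlonglongrightarrow> 0"
        using translation_modulus_open[OF U(1) fU z] by blast
    qed
    then have "(\<lambda>n. cmod c * translation_modulus (indicator A) (z n)) \<longlonglongrightarrow> cmod c * 0"
      by (intro tendsto_mult tendsto_const)
    moreover have "translation_modulus (\<lambda>x. indicator A x *\<^sub>R c) w = cmod c * translation_modulus (indicator A) w" for w
    proof -
      have "cmod (indicator A (y - w) *\<^sub>R c - indicator A y *\<^sub>R c) = cmod c * cmod (indicator A (y - w) - indicator A y)" for y
        by (auto simp: indicator_def)
      then show ?thesis by (simp add: translation_modulus_def)
    qed
    ultimately show ?case by simp
  next
    case (add f g)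
    have "translation_modulus (\<lambda>x. f x + g x) w \<le> translation_modulus f w + translation_modulus g w" for w
    proof -
      have "translation_modulus (\<lambda>x. f x + g x) w \<le> (LINT y|lborel. cmod (f (y - w) - f y) + cmod (g (y - w) - g y))"
        unfolding translation_modulus_def
      proof (rule integral_mono)
        show "cmod (f (y - w) + g (y - w) - (f y + g y)) \<le> cmod (f (y - w) - f y) + cmod (g (y - w) - g y)" for y
          using norm_triangle_ineq[of "f (y - w) - f y" "g (y - w) - g y"] by (simp add: algebra_simps)
      qed (use add(1,2) in \<open>auto intro!: integrable_lborel_translate Bochner_Integration.integrable_add integrable_norm Bochner_Integration.integrable_diff\<close>)
      also have "\<dots> = translation_modulus f w + translation_modulus g w"
        unfolding translation_modulus_def using add(1,2)
        by (subst Bochner_Integration.integral_add)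
          (auto intro!: integrable_lborel_translate integrable_norm Bochner_Integration.integrable_diff)
      finally show ?thesis .
    qed
    note le = this
    have l: "(\<lambda>n. translation_modulus f (z n) + translation_modulus g (z n)) \<longlonglongrightarrow> 0"
      using tendsto_add[OF add(3,4)] by simp
    show ?case
      by (rule tendsto_sandwich[OF _ _ tendsto_const l]) (simp_all add: le translation_modulus_nonneg)
  next
    case (lim f s)
    show ?case
    proof (rule approx[OF lim(4)])
      fix e :: real assume e: "e > 0"
      have [measurable]: "f \<in> borel_measurable borel" "\<And>i. s i \<in> borel_measurable borel"
        using borel_measurable_integrable[OF lim(4)] borel_measurable_integrable[OF lim(1)] by auto
      have "(\<lambda>i. LINT y|lborel. cmod (f y - s i y)) \<longlonglongrightarrow> (LINT y|(lborel :: 'a measure). (0 :: real))"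
      proof (rule integral_dominated_convergence[where w = "\<lambda>y. 3 * cmod (f y)"])
        show "AE y in lborel. (\<lambda>i. cmod (f y - s i y)) \<longlonglongrightarrow> 0"
        proof (rule AE_I2)
          fix y
          have "(\<lambda>i. f y - s i y) \<longlonglongrightarrow> f y - f y" by (intro tendsto_diff tendsto_const lim(2)) simp
          then show "(\<lambda>i. cmod (f y - s i y)) \<longlonglongrightarrow> 0" by (simp add: tendsto_norm_zero)
        qed
        have "cmod (f y - s i y) \<le> 3 * cmod (f y)" for i y
          using norm_triangle_ineq4[of "f y" "s i y"] lim(3)[of y i] by simp
        then show "AE y in lborel. norm (cmod (f y - s i y)) \<le> 3 * cmod (f y)" for i by simp
      qed (use lim(4) in auto)
      then have "eventually (\<lambda>i. (LINT y|lborel. cmod (f y - s i y)) < e) sequentially"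
        using e by (intro order_tendstoD(2)) auto
      then obtain i where "(LINT y|lborel. cmod (f y - s i y)) < e" by (auto simp: eventually_sequentially)
      then show "\<exists>g. integrable lborel g \<and> (LINT y|lborel. cmod (f y - g y)) < e \<and>
          (\<lambda>n. translation_modulus g (z n)) \<longlonglongrightarrow> 0" using lim(1,5) by blast
    qed
  qed
qed

lemma translation_modulus_small:
  fixes f :: "'a::euclidean_space \<Rightarrow> complex"
  assumes f: "integrable lborel f" and e: "e > 0"
  shows "\<exists>r>0. \<forall>z. norm z < r \<longrightarrow> translation_modulus f z < e"
proof (rule ccontr)
  assume "\<not> ?thesis"
  then have "\<forall>n. \<exists>z. norm z < 1 / real (Suc n) \<and> \<not> translation_modulus f z < e" by simp
  from choice[OF this] obtain z where z: "\<And>n. norm (z n) < 1 / real (Suc n)" "\<And>n. \<not> translation_modulus f (z n) < e"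
    by blast
  have "z \<longlonglongrightarrow> 0"
    by (rule LIMSEQ_norm_0) (use z(1) in simp)
  from order_tendstoD(2)[OF translation_modulus_tendsto[OF f this] e] show False
    using z(2) by (auto simp: eventually_sequentially)
qed

text \<open>A change of variables moves the translation from the test function to g. The bound is
  uniform over the unit ball of test functions, which is the equicontinuity that the discretisation
  asks for.\<close>

lemma cm_integral_density_translate_diff:
  fixes g :: "'a::euclidean_space \<Rightarrow> complex"
  assumes g: "integrable lborel g" and \<phi>: "bdd_borel \<phi>" "\<And>x. cmod (\<phi> x) \<le> 1"
  shows "cmod (cm_integral (density_cmeas g) (\<lambda>y. \<phi> (w + y)) - cm_integral (density_cmeas g) (\<lambda>y. \<phi> (z + y)))
    \<le> translation_modulus g (w - z)"
proof -
  have [measurable]: "g \<in> borel_measurable borel" "\<phi> \<in> borel_measurable borel"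
    using borel_measurable_integrable[OF g] bdd_borel_measurable[OF \<phi>(1)] by auto
  have int: "integrable lborel (\<lambda>y. g (y - v) * \<phi> y)" for v
    by (rule Bochner_Integration.integrable_bound[OF integrable_lborel_translate[OF g, of v]])
      (auto simp: norm_mult intro!: mult_left_le \<phi>(2))
  have int': "integrable lborel (\<lambda>y. g y * \<phi> (v + y))" for v
    by (rule Bochner_Integration.integrable_bound[OF g]) (auto simp: norm_mult intro!: mult_left_le \<phi>(2))
  have eq: "cm_integral (density_cmeas g) (\<lambda>y. \<phi> (v + y)) = (LINT y|lborel. g (y - v) * \<phi> y)" for v
    using integral_lborel_translate[OF int', of v v]
    by (simp add: cm_integral_density[OF g bdd_borel_translate[OF \<phi>(1)]])
  have "cmod (cm_integral (density_cmeas g) (\<lambda>y. \<phi> (w + y)) - cm_integral (density_cmeas g) (\<lambda>y. \<phi> (z + y)))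
      = cmod (LINT y|lborel. g (y - w) * \<phi> y - g (y - z) * \<phi> y)"
    unfolding eq by (simp add: int)
  also have "\<dots> \<le> (LINT y|lborel. cmod (g (y - w) * \<phi> y - g (y - z) * \<phi> y))" by (rule integral_norm_bound)
  also have "\<dots> \<le> (LINT y|lborel. cmod (g (y - w) - g (y - z)))"
  proof (rule integral_mono)
    show "cmod (g (y - w) * \<phi> y - g (y - z) * \<phi> y) \<le> cmod (g (y - w) - g (y - z))" for y
      unfolding left_diff_distrib[symmetric] norm_mult by (rule mult_left_le[OF \<phi>(2)]) simp
  qed (rule integrable_norm Bochner_Integration.integrable_diff int integrable_lborel_translate[OF g])+
  also have "\<dots> = (LINT y|lborel. cmod (g (y - z - (w - z)) - g (y - z)))" by (simp add: algebra_simps)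
  also have "\<dots> = translation_modulus g (w - z)"
    unfolding translation_modulus_def
    by (rule integral_lborel_translate[of "\<lambda>y. cmod (g (y - (w - z)) - g y)" z])
      (intro integrable_norm Bochner_Integration.integrable_diff integrable_lborel_translate[OF g] g)
  finally show ?thesis .
qed

section \<open>Time-frequency shifts\<close>

definition character :: "'a::real_inner \<Rightarrow> 'a \<Rightarrow> complex" where
  "character \<omega> t = exp (2 * complex_of_real pi * \<i> * complex_of_real (\<omega> \<bullet> t))"

lemma norm_character [simp]: "cmod (character \<omega> t) = 1"
  by (simp add: character_def)

lemma character_mult_cnj [simp]: "character \<omega> t * cnj (character \<omega> t) = 1"
  using complex_norm_square[of "character \<omega> t"] by simp

lemma character_add_left: "character (\<omega> + \<omega>') t = character \<omega> t * character \<omega>' t"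
  by (simp add: character_def inner_add_left algebra_simps flip: exp_add)

lemma character_diff_right: "character \<omega> (t - x) = character \<omega> t * character (- \<omega>) x"
  by (simp add: character_def inner_diff_right algebra_simps flip: exp_add)

lemma continuous_character: "continuous_on UNIV (character \<omega>)"
  unfolding character_def by (intro continuous_intros)

lemma borel_measurable_character [measurable]:
  "character \<omega> \<in> borel_measurable (borel :: 'a::euclidean_space measure)"
  by (intro borel_measurable_continuous_onI continuous_character)

lemma tendsto_character: "\<omega> \<longlonglongrightarrow> \<omega>' \<Longrightarrow> (\<lambda>n. character (\<omega> n) t) \<longlonglongrightarrow> character \<omega>' t"
  unfolding character_def by (intro tendsto_intros)

lemma rep_tf_shift_AE:
  "AE t in lborel. rep_L2 (tf_shift (x, \<omega>) f) t = character \<omega> t * rep_L2 f (t - x)"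
proof -
  let ?g = "\<lambda>t. character \<omega> t * rep_L2 f (t - x)"
  have eq: "tf_shift (x, \<omega>) f = abs_L2 ?g"
    by (simp add: tf_shift_def character_def)
  have [measurable]: "(\<lambda>t. rep_L2 f (t - x)) \<in> borel_measurable borel"
    using sq_integrable_translate[OF sq_integrable_rep[of f], of x] by (simp add: sq_integrable_def)
  have "sq_integrable ?g"
    using sq_integrable_translate[OF sq_integrable_rep[of f], of x] by (simp add: sq_integrable_def norm_mult)
  then have "L2_rel (rep_L2 (abs_L2 ?g)) ?g"
    using Quotient3_rep_abs[OF Quotient3_L2, of ?g] by (simp add: L2_rel_def)
  then show ?thesis by (simp add: eq L2_rel_def)
qed

lemma tf_shift_add: "tf_shift z (f + g) = tf_shift z f + tf_shift z g"
proof -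
  obtain x \<omega> where z: "z = (x, \<omega>)" by force
  show ?thesis unfolding eq_L2_iff_AE z
    using rep_tf_shift_AE[of x \<omega> "f + g"] rep_tf_shift_AE[of x \<omega> f] rep_tf_shift_AE[of x \<omega> g]
      rep_add_AE[of "tf_shift (x, \<omega>) f" "tf_shift (x, \<omega>) g"] AE_lborel_translate[OF rep_add_AE[of f g], of x]
    by eventually_elim (simp add: distrib_left)
qed

lemma tf_shift_scaleC: "tf_shift z (c *\<^sub>C f) = c *\<^sub>C tf_shift z f"
proof -
  obtain x \<omega> where z: "z = (x, \<omega>)" by force
  show ?thesis unfolding eq_L2_iff_AE z
    using rep_tf_shift_AE[of x \<omega> "c *\<^sub>C f"] rep_tf_shift_AE[of x \<omega> f]
      rep_scaleC_AE[of c "tf_shift (x, \<omega>) f"] AE_lborel_translate[OF rep_scaleC_AE[of c f], of x]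
    by eventually_elim simp
qed

lemma cinner_tf_shift [simp]: "cinner (tf_shift z f) (tf_shift z g) = cinner f g"
proof -
  obtain x \<omega> where z: "z = (x, \<omega>)" by force
  have int: "integrable lborel (\<lambda>t. rep_L2 f t * cnj (rep_L2 g t))"
    by (intro sq_integrable_mult_cnj) auto
  have "cinner (tf_shift z f) (tf_shift z g) = (LINT t|lborel. rep_L2 f (t - x) * cnj (rep_L2 g (t - x)))"
    unfolding cinner_rep
  proof (rule integral_cong_AE)
    show "AE t in lborel. rep_L2 (tf_shift z f) t * cnj (rep_L2 (tf_shift z g) t) = rep_L2 f (t - x) * cnj (rep_L2 g (t - x))"
      using rep_tf_shift_AE[of x \<omega> f] rep_tf_shift_AE[of x \<omega> g] unfolding z
    proof eventually_elim
      case (elim t)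
      have "character \<omega> t * a * cnj (character \<omega> t * b) = (character \<omega> t * cnj (character \<omega> t)) * (a * cnj b)" for a b
        by (simp add: mult_ac)
      then show ?case using elim by simp
    qed
    show "(\<lambda>t. rep_L2 (tf_shift z f) t * cnj (rep_L2 (tf_shift z g) t)) \<in> borel_measurable lborel"
      using borel_measurable_integrable[OF sq_integrable_mult_cnj[OF sq_integrable_rep sq_integrable_rep]] by simp
    show "(\<lambda>t. rep_L2 f (t - x) * cnj (rep_L2 g (t - x))) \<in> borel_measurable lborel"
      using borel_measurable_integrable[OF integrable_lborel_translate[OF int, of x]] by simp
  qed
  also have "\<dots> = cinner f g" unfolding cinner_rep by (rule integral_lborel_translate[OF int])
  finally show ?thesis .
qed

lemma norm_tf_shift [simp]: "norm (tf_shift z f) = norm f"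
  by (simp add: norm_L2_def flip: Re_cinner)

lemma bounded_clinear_tf_shift: "bounded_clinear (tf_shift z)"
  by (rule bounded_clinearI[where K = 1]) (auto simp: tf_shift_add tf_shift_scaleC)

lemma contr_tf_shift: "contr (tf_shift z)"
  by (simp add: contr_def bounded_clinear_tf_shift)

text \<open>The inner modulation is evaluated at t - x, which leaves a phase: the shifts form a
  projective representation only.\<close>

lemma tf_shift_compose:
  "tf_shift (x, \<omega>) (tf_shift (y, \<eta>) f) = character (- \<eta>) x *\<^sub>C tf_shift ((x, \<omega>) + (y, \<eta>)) f"
proof -
  have "AE t in lborel. rep_L2 (tf_shift (y, \<eta>) f) (t - x) = character \<eta> (t - x) * rep_L2 f (t - x - y)"
    by (rule AE_lborel_translate[OF rep_tf_shift_AE])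
  then show ?thesis unfolding eq_L2_iff_AE add_Pair
    using rep_tf_shift_AE[of x \<omega> "tf_shift (y, \<eta>) f"] rep_tf_shift_AE[of "x + y" "\<omega> + \<eta>" f]
      rep_scaleC_AE[of "character (- \<eta>) x" "tf_shift (x + y, \<omega> + \<eta>) f"]
    by eventually_elim (simp add: character_add_left character_diff_right algebra_simps)
qed

lemma tf_shift_0: "tf_shift 0 f = f"
proof -
  have "tf_shift (0, 0) f = f" unfolding eq_L2_iff_AE
    using rep_tf_shift_AE[of 0 0 f] by eventually_elim (simp add: character_def)
  then show ?thesis by (simp add: zero_prod_def)
qed

text \<open>The value of the phase is irrelevant for conjugation, where it meets its conjugate; its
  modulus is all that is kept.\<close>

lemma ex_tf_shift_compose:
  "\<exists>c. cmod c = 1 \<and> (\<forall>f. tf_shift z (tf_shift w f) = c *\<^sub>C tf_shift (z + w) f)"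
  using tf_shift_compose[of "fst z" "snd z" "fst w" "snd w"] by (intro exI[of _ "character (- snd w) (fst z)"]) simp

lemma ex_adj_tf_shift:
  "\<exists>c. cmod c = 1 \<and> (\<forall>f. adj (tf_shift z) f = c *\<^sub>C tf_shift (- z) f)"
proof -
  obtain c where c: "cmod c = 1" "\<And>f. tf_shift z (tf_shift (- z) f) = c *\<^sub>C f"
    using ex_tf_shift_compose[of z "- z"] by (auto simp: tf_shift_0)
  have cc: "c * cnj c = 1" using complex_norm_square[of c] c(1) by simp
  have "adj (tf_shift z) = (\<lambda>g. cnj c *\<^sub>C tf_shift (- z) g)"
  proof (rule adj_eqI)
    fix f g
    have "g = tf_shift z (cnj c *\<^sub>C tf_shift (- z) g)"
      using cc by (simp add: tf_shift_scaleC c(2) mult.commute)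
    then show "cinner (tf_shift z f) g = cinner f (cnj c *\<^sub>C tf_shift (- z) g)"
      by (metis cinner_tf_shift)
  qed
  then show ?thesis using c(1) by (intro exI[of _ "cnj c"]) simp
qed

lemma unit_phase_cancel: "cmod c = 1 \<Longrightarrow> c * (cnj c * a) = a" "cmod c = 1 \<Longrightarrow> cnj c * (c * a) = a"
  using complex_norm_square[of c] by (simp_all add: mult.assoc[symmetric] mult.commute[of "cnj c"])

subsection \<open>Strong continuity\<close>

lemma cinner_rep_AE:
  assumes "AE t in lborel. rep_L2 f t = u t" "AE t in lborel. rep_L2 g t = v t"
    "u \<in> borel_measurable borel" "v \<in> borel_measurable borel"
  shows "cinner f g = (LINT t|lborel. u t * cnj (v t))"
proof -
  have [measurable]: "(\<lambda>t. cnj (v t)) \<in> borel_measurable borel" "(\<lambda>t. cnj (rep_L2 g t)) \<in> borel_measurable borel"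
    using assms by (auto intro!: borel_measurable_continuous_on[where f = cnj] continuous_intros)
  show ?thesis unfolding cinner_rep
  proof (rule integral_cong_AE)
    show "AE t in lborel. rep_L2 f t * cnj (rep_L2 g t) = u t * cnj (v t)"
      using assms(1,2) by eventually_elim simp
  qed (use assms(3) in measurable)
qed

text \<open>Cutting off where the argument or the value exceeds k gives bounded functions supported
  in a ball, hence integrable. Thus continuity of translation in mean becomes available for square
  integrable functions.\<close>

lemma ex_truncation:
  fixes f :: "('n::finite) L2"
  assumes e: "e > 0"
  shows "\<exists>g u C. norm (f - g) < e \<and> integrable lborel u \<and> (\<forall>t. cmod (u t) \<le> C) \<and> (AE t in lborel. rep_L2 g t = u t)"
proof -
  define A where "A k = {t. norm t \<le> real k \<and> cmod (rep_L2 f t) \<le> real k}" for k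
  define u where "u k t = (indicator (A k) t *\<^sub>R rep_L2 f t :: complex)" for k t
  have Am[measurable]: "A k \<in> sets borel" for k unfolding A_def by measurable
  have um[measurable]: "u k \<in> borel_measurable borel" for k unfolding u_def by measurable
  have fsq: "integrable lborel (\<lambda>t. (cmod (rep_L2 f t))\<^sup>2)" using sq_integrable_rep[of f] by (simp add: sq_integrable_def)
  have usq: "sq_integrable (u k)" for k
    unfolding sq_integrable_def
  proof
    show "integrable lborel (\<lambda>t. (cmod (u k t))\<^sup>2)"
      by (rule Bochner_Integration.integrable_bound[OF fsq]) (auto simp: u_def indicator_def)
  qed simp
  have "(\<lambda>k. LINT t|lborel. (cmod (rep_L2 f t - u k t))\<^sup>2) \<longlonglongrightarrow> (LINT t|(lborel :: (real^'n) measure). (0 :: real))"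
  proof (rule integral_dominated_convergence[OF _ _ fsq])
    show "AE t in lborel. (\<lambda>k. (cmod (rep_L2 f t - u k t))\<^sup>2) \<longlonglongrightarrow> 0"
    proof (rule AE_I2)
      fix t
      obtain K :: nat where K: "max (norm t) (cmod (rep_L2 f t)) \<le> real K" using real_arch_simple by blast
      have "eventually (\<lambda>k. 0 = (cmod (rep_L2 f t - u k t))\<^sup>2) sequentially"
        using eventually_ge_at_top[of K]
      proof eventually_elim
        case (elim k)
        then have "t \<in> A k" using K by (auto simp: A_def)
        then show ?case by (simp add: u_def)
      qed
      then show "(\<lambda>k. (cmod (rep_L2 f t - u k t))\<^sup>2) \<longlonglongrightarrow> 0" by (rule Lim_transform_eventually[OF tendsto_const])
    qed
  qed (auto simp: u_def indicator_def)
  then have "(\<lambda>k. LINT t|lborel. (cmod (rep_L2 f t - u k t))\<^sup>2) \<longlonglongrightarrow> 0" by simp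
  from order_tendstoD(2)[OF this, of "e\<^sup>2"] e
  obtain k where k: "(LINT t|lborel. (cmod (rep_L2 f t - u k t))\<^sup>2) < e\<^sup>2" by (auto simp: eventually_sequentially)
  obtain g where g: "AE t in lborel. rep_L2 g t = u k t" using ex_rep_AE[OF usq] by metis
  have "integrable lborel (u k)"
  proof (rule integrableI_bounded_set[where A = "cball 0 (real k)" and B = "real k"])
    show "emeasure lborel (cball 0 (real k) :: (real^'n) set) < \<infinity>" by (rule emeasure_lborel_cball_finite)
    show "AE t in lborel. t \<in> cball 0 (real k) \<longrightarrow> norm (u k t) \<le> real k"
      by (rule AE_I2) (auto simp: u_def A_def indicator_def)
    show "AE t in lborel. t \<notin> cball 0 (real k) \<longrightarrow> u k t = 0"
      by (rule AE_I2) (auto simp: u_def A_def indicator_def)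
  qed auto
  moreover have "\<forall>t. cmod (u k t) \<le> real k" by (auto simp: u_def A_def indicator_def)
  moreover have "norm (f - g) < e"
  proof -
    have "AE t in lborel. rep_L2 (f - g) t = rep_L2 f t - u k t"
      using rep_diff_AE[of f g] g by eventually_elim simp
    then have "cinner (f - g) (f - g) = (LINT t|lborel. (rep_L2 f t - u k t) * cnj (rep_L2 f t - u k t))"
      by (intro cinner_rep_AE) auto
    also have "\<dots> = (LINT t|lborel. complex_of_real ((cmod (rep_L2 f t - u k t))\<^sup>2))"
      by (simp only: complex_norm_square)
    also have "\<dots> = complex_of_real (LINT t|lborel. (cmod (rep_L2 f t - u k t))\<^sup>2)"
      by (rule integral_complex_of_real)
    finally have "(norm (f - g))\<^sup>2 < e\<^sup>2" using k by (simp only: cinner_self of_real_eq_iff)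
    then show ?thesis using e by (simp add: power2_less_imp_less)
  qed
  ultimately show ?thesis using g by blast
qed

text \<open>The two parameters are separated: with the translation fixed, modulations converge by
  dominated convergence; moving the translation costs at most C times the translation modulus of u,
  uniformly in the modulation.\<close>

lemma tf_shift_weak_limit_bounded:
  fixes x \<omega> :: "nat \<Rightarrow> real^'n::finite"
  assumes x: "x \<longlonglongrightarrow> x'" and \<omega>: "\<omega> \<longlonglongrightarrow> \<omega>'"
    and u: "integrable lborel u" "AE t in lborel. rep_L2 f t = u t"
    and v: "v \<in> borel_measurable borel" "\<And>t. cmod (v t) \<le> C" "AE t in lborel. rep_L2 g t = v t"
  shows "(\<lambda>n. cinner (tf_shift (x n, \<omega> n) f) g) \<longlonglongrightarrow> cinner (tf_shift (x', \<omega>') f) g"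
proof -
  have um[measurable]: "u \<in> borel_measurable borel" using borel_measurable_integrable[OF u(1)] by simp
  have [measurable]: "(\<lambda>t. cnj (v t)) \<in> borel_measurable borel"
    using v(1) by (auto intro!: borel_measurable_continuous_on[where f = cnj] continuous_intros)
  have C0: "0 \<le> C" using v(2) norm_ge_zero order_trans by blast
  have cv: "cmod (character \<eta> t * a * cnj (v t)) \<le> C * cmod a" for \<eta> t a
    using mult_right_mono[OF v(2)[of t], of "cmod a"] by (simp add: norm_mult mult.commute)
  have int: "integrable lborel (\<lambda>t. character \<eta> t * u (t - y) * cnj (v t))" for y \<eta>
  proof (rule Bochner_Integration.integrable_bound)
    show "integrable lborel (\<lambda>t. C * cmod (u (t - y)))"
      by (intro integrable_mult_right integrable_norm integrable_lborel_translate[OF u(1)])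
    have [measurable]: "(\<lambda>t. u (t - y)) \<in> borel_measurable borel"
      using borel_measurable_integrable[OF integrable_lborel_translate[OF u(1), of y]] by simp
    show "(\<lambda>t. character \<eta> t * u (t - y) * cnj (v t)) \<in> borel_measurable lborel" by measurable
    show "AE t in lborel. norm (character \<eta> t * u (t - y) * cnj (v t)) \<le> norm (C * cmod (u (t - y)))"
      using cv C0 by (intro AE_I2) (simp add: abs_mult)
  qed
  have ci: "cinner (tf_shift (y, \<eta>) f) g = (LINT t|lborel. character \<eta> t * u (t - y) * cnj (v t))" for y \<eta>
  proof (rule cinner_rep_AE)
    show "AE t in lborel. rep_L2 (tf_shift (y, \<eta>) f) t = character \<eta> t * u (t - y)"
      using rep_tf_shift_AE[of y \<eta> f] AE_lborel_translate[OF u(2), of y] by eventually_elim simp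
    have [measurable]: "(\<lambda>t. u (t - y)) \<in> borel_measurable borel"
      using borel_measurable_integrable[OF integrable_lborel_translate[OF u(1), of y]] by simp
    show "(\<lambda>t. character \<eta> t * u (t - y)) \<in> borel_measurable borel" by measurable
  qed (use v in auto)
  have 1: "(\<lambda>n. cinner (tf_shift (x', \<omega> n) f) g) \<longlonglongrightarrow> cinner (tf_shift (x', \<omega>') f) g"
    unfolding ci
  proof (rule integral_dominated_convergence[where w = "\<lambda>t. C * cmod (u (t - x'))"])
    show "integrable lborel (\<lambda>t. C * cmod (u (t - x')))"
      by (intro integrable_mult_right integrable_norm integrable_lborel_translate[OF u(1)])
    show "AE t in lborel. (\<lambda>n. character (\<omega> n) t * u (t - x') * cnj (v t)) \<longlonglongrightarrow> character \<omega>' t * u (t - x') * cnj (v t)"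
      by (intro AE_I2 tendsto_mult tendsto_const tendsto_character \<omega>)
    show "AE t in lborel. norm (character (\<omega> n) t * u (t - x') * cnj (v t)) \<le> C * cmod (u (t - x'))" for n
      by (intro AE_I2 cv)
  qed (rule borel_measurable_integrable[OF int])+
  have le: "cmod (cinner (tf_shift (x n, \<omega> n) f) g - cinner (tf_shift (x', \<omega> n) f) g) \<le> C * translation_modulus u (x n - x')" for n
  proof -
    have "cinner (tf_shift (x n, \<omega> n) f) g - cinner (tf_shift (x', \<omega> n) f) g
        = (LINT t|lborel. character (\<omega> n) t * (u (t - x n) - u (t - x')) * cnj (v t))"
      unfolding ci by (subst Bochner_Integration.integral_diff[symmetric, OF int int]) (simp add: algebra_simps)
    also have "cmod \<dots> \<le> (LINT t|lborel. cmod (character (\<omega> n) t * (u (t - x n) - u (t - x')) * cnj (v t)))"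
      by (rule integral_norm_bound)
    also have "\<dots> \<le> (LINT t|lborel. C * cmod (u (t - x n) - u (t - x')))"
    proof (rule integral_mono)
      show "integrable lborel (\<lambda>t. cmod (character (\<omega> n) t * (u (t - x n) - u (t - x')) * cnj (v t)))"
        using Bochner_Integration.integrable_diff[OF int[of "\<omega> n" "x n"] int[of "\<omega> n" x']]
        by (intro integrable_norm) (simp add: algebra_simps)
      show "integrable lborel (\<lambda>t. C * cmod (u (t - x n) - u (t - x')))"
        by (intro integrable_mult_right integrable_norm Bochner_Integration.integrable_diff integrable_lborel_translate[OF u(1)])
    qed (rule cv)
    also have "\<dots> = C * (LINT t|lborel. cmod (u (t - x' - (x n - x')) - u (t - x')))"
      by (simp add: algebra_simps)
    also have "(LINT t|lborel. cmod (u (t - x' - (x n - x')) - u (t - x'))) = translation_modulus u (x n - x')"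
      unfolding translation_modulus_def
      by (rule integral_lborel_translate[of "\<lambda>t. cmod (u (t - (x n - x')) - u t)" x'])
        (intro integrable_norm Bochner_Integration.integrable_diff integrable_lborel_translate[OF u(1)] u(1))
    finally show ?thesis .
  qed
  have "(\<lambda>n. x n - x') \<longlonglongrightarrow> 0" using x by (simp add: LIM_zero)
  then have m: "(\<lambda>n. C * translation_modulus u (x n - x')) \<longlonglongrightarrow> C * 0"
    by (intro tendsto_mult tendsto_const translation_modulus_tendsto[OF u(1)])
  have "(\<lambda>n. cinner (tf_shift (x n, \<omega> n) f) g - cinner (tf_shift (x', \<omega> n) f) g) \<longlonglongrightarrow> 0"
  proof (rule tendsto_norm_zero_cancel, rule tendsto_sandwich[OF _ _ tendsto_const])
    show "(\<lambda>n. C * translation_modulus u (x n - x')) \<longlonglongrightarrow> 0" using m by simp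
  qed (simp_all add: le)
  from tendsto_add[OF this 1] show ?thesis by simp
qed

lemma tf_shift_weak_limit:
  fixes z :: "nat \<Rightarrow> (real^'n::finite) \<times> (real^'n)"
  assumes z: "z \<longlonglongrightarrow> z'"
  shows "(\<lambda>n. cinner (tf_shift (z n) f) g) \<longlonglongrightarrow> cinner (tf_shift z' f) g"
proof (rule LIMSEQ_I)
  fix e :: real assume e: "e > 0"
  \<comment> \<open>Replacing f and g by truncations costs \<delta> (norm g + 1) + norm f \<delta> =
    e / 4 at each of the two points compared. The cap at 1 keeps \<open>norm g'\<close> below
    \<open>norm g + 1\<close>.\<close>
  define \<delta> where "\<delta> = e / (4 * (norm f + norm g + 1))"
  have \<delta>: "\<delta> > 0" using e by (auto simp: \<delta>_def intro!: divide_pos_pos add_nonneg_pos)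
  define \<delta>' where "\<delta>' = min \<delta> 1"
  have \<delta>': "\<delta>' > 0" "\<delta>' \<le> \<delta>" "\<delta>' \<le> 1" using \<delta> by (auto simp: \<delta>'_def)
  obtain f' u C where f': "norm (f - f') < \<delta>'" "integrable lborel u" "AE t in lborel. rep_L2 f' t = u t"
    using ex_truncation[OF \<delta>'(1), of f] by blast
  obtain g' v D where g': "norm (g - g') < \<delta>'" "integrable lborel v" "\<And>t. cmod (v t) \<le> D" "AE t in lborel. rep_L2 g' t = v t"
    using ex_truncation[OF \<delta>'(1), of g] by blast
  have vm: "v \<in> borel_measurable borel" using borel_measurable_integrable[OF g'(2)] by simp
  have "(\<lambda>n. cinner (tf_shift (fst (z n), snd (z n)) f') g') \<longlonglongrightarrow> cinner (tf_shift (fst z', snd z') f') g'"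
    by (rule tf_shift_weak_limit_bounded[OF tendsto_fst[OF z] tendsto_snd[OF z] f'(2,3) vm g'(3,4)])
  then have "(\<lambda>n. cinner (tf_shift (z n) f') g') \<longlonglongrightarrow> cinner (tf_shift z' f') g'" by simp
  from LIMSEQ_D[OF this, of "e / 2"] e
  obtain N where N: "\<And>n. n \<ge> N \<Longrightarrow> cmod (cinner (tf_shift (z n) f') g' - cinner (tf_shift z' f') g') < e / 2" by auto
  have d: "cmod (cinner (tf_shift w f) g - cinner (tf_shift w f') g') \<le> e / 4" for w
  proof -
    have "cinner (tf_shift w f) g - cinner (tf_shift w f') g' = cinner (tf_shift w (f - f')) g' + cinner (tf_shift w f) (g - g')"
      using tf_shift_add[of w "f - f'" f'] by (simp add: cinner_diff_right cinner_add_left)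
    then have "cmod (cinner (tf_shift w f) g - cinner (tf_shift w f') g')
        \<le> cmod (cinner (tf_shift w (f - f')) g') + cmod (cinner (tf_shift w f) (g - g'))" by (simp add: norm_triangle_ineq)
    also have "\<dots> \<le> norm (f - f') * norm g' + norm f * norm (g - g')"
      using Cauchy_Schwarz_cinner[of "tf_shift w (f - f')" g'] Cauchy_Schwarz_cinner[of "tf_shift w f" "g - g'"] by simp
    also have "\<dots> \<le> \<delta> * (norm g + 1) + norm f * \<delta>"
    proof (intro add_mono mult_mono)
      have "norm g' \<le> norm g + norm (g - g')" by (metis norm_minus_commute norm_triangle_sub)
      then show "norm g' \<le> norm g + 1" using g'(1) \<delta>' by simp
    qed (use f'(1) g'(1) \<delta>' \<delta> in auto)
    also have "\<dots> = \<delta> * (norm f + norm g + 1)" by (simp add: algebra_simps)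
    also have "\<dots> = e / 4"
    proof -
      have "e / (4 * K) * K = e / 4" if "K \<noteq> 0" for K using that by simp
      moreover have "norm f + norm g + 1 \<noteq> 0" using norm_ge_zero[of f] norm_ge_zero[of g] by linarith
      ultimately show ?thesis unfolding \<delta>_def by blast
    qed
    finally show ?thesis .
  qed
  have "norm (cinner (tf_shift (z n) f) g - cinner (tf_shift z' f) g) < e" if "n \<ge> N" for n
  proof -
    have "dist (cinner (tf_shift (z n) f) g) (cinner (tf_shift z' f) g)
        \<le> dist (cinner (tf_shift (z n) f) g) (cinner (tf_shift (z n) f') g')
          + (dist (cinner (tf_shift (z n) f') g') (cinner (tf_shift z' f') g')
            + dist (cinner (tf_shift z' f') g') (cinner (tf_shift z' f) g))"
      by (meson add_left_mono dist_triangle order_trans)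
    then show ?thesis
      using d[of "z n"] d[of z'] N[OF that]
      unfolding dist_commute[of "cinner (tf_shift z' f') g'"] by (simp add: dist_norm)
  qed
  then show "\<exists>N. \<forall>n\<ge>N. norm (cinner (tf_shift (z n) f) g - cinner (tf_shift z' f) g) < e" by blast
qed

text \<open>Weak convergence between vectors of equal norm is strong: the squared distance is twice
  the squared norm minus twice the real inner product.\<close>

lemma continuous_tf_shift:
  fixes f :: "('n::finite) L2"
  shows "continuous_on UNIV (\<lambda>z. tf_shift z f)"
  unfolding continuous_on_sequentially o_def
proof (intro allI ballI impI)
  fix z :: "nat \<Rightarrow> (real^'n) \<times> (real^'n)" and z'
  assume "(\<forall>n. z n \<in> UNIV) \<and> z \<longlonglongrightarrow> z'"
  then have "(\<lambda>n. cinner (tf_shift (z n) f) (tf_shift z' f)) \<longlonglongrightarrow> cinner (tf_shift z' f) (tf_shift z' f)"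
    using tf_shift_weak_limit by blast
  then have "(\<lambda>n. inner (tf_shift (z n) f) (tf_shift z' f)) \<longlonglongrightarrow> inner f f"
    unfolding cinner_tf_shift using tendsto_Re unfolding Re_cinner[symmetric] by blast
  then have "(\<lambda>n. 2 * (norm f)\<^sup>2 - 2 * inner (tf_shift (z n) f) (tf_shift z' f)) \<longlonglongrightarrow> 2 * (norm f)\<^sup>2 - 2 * inner f f"
    by (intro tendsto_diff tendsto_mult tendsto_const)
  moreover have "2 * (norm f)\<^sup>2 - 2 * inner (tf_shift w f) (tf_shift z' f) = (norm (tf_shift w f - tf_shift z' f))\<^sup>2" for w
  proof -
    have "inner (tf_shift v f) (tf_shift v f) = inner f f" for v by (simp flip: Re_cinner)
    then show ?thesis unfolding power2_norm_eq_inner inner_diff by (simp add: inner_commute)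
  qed
  ultimately have "(\<lambda>n. (norm (tf_shift (z n) f - tf_shift z' f))\<^sup>2) \<longlonglongrightarrow> 0" by (simp add: dot_square_norm)
  then have "(\<lambda>n. sqrt ((norm (tf_shift (z n) f - tf_shift z' f))\<^sup>2)) \<longlonglongrightarrow> sqrt 0" by (rule tendsto_real_sqrt)
  then have "(\<lambda>n. norm (tf_shift (z n) f - tf_shift z' f)) \<longlonglongrightarrow> 0" by simp
  then show "(\<lambda>n. tf_shift (z n) f) \<longlonglongrightarrow> tf_shift z' f"
    by (rule LIM_zero_cancel[OF tendsto_norm_zero_cancel])
qed

section \<open>The module action\<close>

text \<open>The matrix coefficient \<open>\<langle>\<pi>(z) S \<pi>(z)\<^sup>* u, v\<rangle>\<close>, written with \<open>\<pi>(-z)\<close> in place of \<open>\<pi>(z)\<^sup>*\<close>: the two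
  differ by a phase, which cancels.\<close>

definition coef :: "('n::finite) op \<Rightarrow> 'n L2 \<Rightarrow> 'n L2 \<Rightarrow> (real^'n) \<times> (real^'n) \<Rightarrow> complex" where
  "coef S u v z = cinner (S (tf_shift (- z) u)) (tf_shift (- z) v)"

lemma coef_eq_conj:
  assumes S: "bounded_clinear S"
  shows "coef S u v z = cinner ((tf_shift z \<circ> S \<circ> adj (tf_shift z)) u) v"
proof -
  obtain c where c: "cmod c = 1" "\<And>f. adj (tf_shift z) f = c *\<^sub>C tf_shift (- z) f"
    using ex_adj_tf_shift[of z] by blast
  have "cinner ((tf_shift z \<circ> S \<circ> adj (tf_shift z)) u) v = cinner (S (adj (tf_shift z) u)) (adj (tf_shift z) v)"
    by (simp add: cinner_adj_right[OF bounded_clinear_tf_shift])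
  also have "\<dots> = coef S u v z"
    by (simp add: coef_def c(2) bounded_clinear_scaleC[OF S] unit_phase_cancel[OF c(1)])
  finally show ?thesis by simp
qed

lemma cmod_coef_le:
  assumes "trace_class S" shows "cmod (coef S u v z) \<le> trace_norm S * norm u * norm v"
  using norm_cinner_le_trace_norm[OF assms, of "tf_shift (- z) u" "tf_shift (- z) v"]
  by (simp add: coef_def)

lemma continuous_coef:
  assumes S: "bounded_clinear S" shows "continuous_on UNIV (coef S u v)"
proof -
  have t: "continuous_on UNIV (\<lambda>z. tf_shift (- z) f)" for f :: "'a L2"
    by (rule continuous_on_compose2[OF continuous_tf_shift]) (auto intro: continuous_intros)
  have "continuous_on UNIV (\<lambda>z. S (tf_shift (- z) u))"
    by (rule bounded_linear.continuous_on[OF bounded_clinear_bounded_linear[OF S] t])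
  then show ?thesis unfolding coef_def
    by (rule bounded_bilinear.continuous_on[OF bounded_bilinear_cinner _ t])
qed

lemma bdd_borel_coef:
  assumes S: "trace_class S" shows "bdd_borel (coef S u v)"
  by (rule bdd_borelI[OF borel_measurable_continuous_onI[OF continuous_coef] cmod_coef_le[OF S]])
    (rule trace_class_bounded_clinear[OF S])

lemma coef_add_left: "bounded_clinear S \<Longrightarrow> coef S (u + u') v z = coef S u v z + coef S u' v z"
  by (simp add: coef_def tf_shift_add bounded_linear.linear[THEN linear_add, OF bounded_clinear_bounded_linear] cinner_add_left)

lemma coef_add_right: "coef S u (v + v') z = coef S u v z + coef S u v' z"
  by (simp add: coef_def tf_shift_add cinner_add_right)

lemma coef_scale_left: "bounded_clinear S \<Longrightarrow> coef S (c *\<^sub>C u) v z = c * coef S u v z"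
  by (simp add: coef_def tf_shift_scaleC bounded_clinear_scaleC)

lemma coef_scale_right: "coef S u (c *\<^sub>C v) z = cnj c * coef S u v z"
  by (simp add: coef_def tf_shift_scaleC)

text \<open>Matrix coefficients determine an operator, so \<open>SOME\<close> has only one
  candidate.\<close>

definition module_act :: "((real^'n) \<times> (real^'n)) cmeas \<Rightarrow> ('n::finite) op \<Rightarrow> 'n op" where
  "module_act \<mu> S = (SOME T. bounded_clinear T \<and> (\<forall>u v. cinner (T u) v = cm_integral \<mu> (coef S u v)))"

lemma
  fixes S :: "('n::finite) op"
  assumes \<mu>: "bounded_cmeas \<mu>" and S: "trace_class S"
  shows bounded_clinear_module_act: "bounded_clinear (module_act \<mu> S)"
    and cinner_module_act: "cinner (module_act \<mu> S u) v = cm_integral \<mu> (coef S u v)"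
proof -
  note bS = trace_class_bounded_clinear[OF S] and b = bdd_borel_coef[OF S]
  have "\<exists>T. bounded_clinear T \<and> (\<forall>u v. cinner (T u) v = cm_integral \<mu> (coef S u v))"
  proof (rule Riesz_sesquilinear[of "\<lambda>u v. cm_integral \<mu> (coef S u v)" "tv_norm \<mu> * trace_norm S"])
    fix u u' v v' :: "'n L2" and c
    show "cm_integral \<mu> (coef S (u + u') v) = cm_integral \<mu> (coef S u v) + cm_integral \<mu> (coef S u' v)"
      unfolding coef_add_left[OF bS, abs_def] by (rule cm_integral_add[OF \<mu> b b])
    show "cm_integral \<mu> (coef S u (v + v')) = cm_integral \<mu> (coef S u v) + cm_integral \<mu> (coef S u v')"
      unfolding coef_add_right[abs_def] by (rule cm_integral_add[OF \<mu> b b])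
    show "cm_integral \<mu> (coef S (c *\<^sub>C u) v) = c * cm_integral \<mu> (coef S u v)"
      unfolding coef_scale_left[OF bS, abs_def] by (rule cm_integral_scale)
    show "cm_integral \<mu> (coef S u (c *\<^sub>C v)) = cnj c * cm_integral \<mu> (coef S u v)"
      unfolding coef_scale_right[abs_def] by (rule cm_integral_scale)
    show "cmod (cm_integral \<mu> (coef S u v)) \<le> tv_norm \<mu> * trace_norm S * norm u * norm v"
      using cmod_cm_integral_le[OF \<mu> b cmod_coef_le[OF S]] by (simp add: mult.assoc)
  qed blast
  from someI_ex[OF this] show "bounded_clinear (module_act \<mu> S)"
    "cinner (module_act \<mu> S u) v = cm_integral \<mu> (coef S u v)"
    unfolding module_act_def by blast+
qed

section \<open>Trace norm bound and module laws\<close>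

lemma inj_on_tf_shift:
  assumes F: "orthonormal F" shows "inj_on (tf_shift z) F"
proof (rule inj_onI)
  fix e e' assume e: "e \<in> F" "e' \<in> F" "tf_shift z e = tf_shift z e'"
  have "cinner e e' = cinner e e"
    using cinner_tf_shift[of z e e'] cinner_tf_shift[of z e e] e(3) by simp
  then show "e = e'" using F e(1,2) unfolding orthonormal_def by (metis zero_neq_one)
qed

lemma orthonormal_tf_shift:
  assumes F: "orthonormal F" shows "orthonormal (tf_shift z ` F)"
  unfolding orthonormal_def
proof (intro ballI)
  fix e e' assume "e \<in> tf_shift z ` F" "e' \<in> tf_shift z ` F"
  then obtain f f' where f: "f \<in> F" "f' \<in> F" "e = tf_shift z f" "e' = tf_shift z f'" by blast
  then have "(e = e') = (f = f')"
    by (simp only: inj_on_eq_iff[OF inj_on_tf_shift[OF F] f(1,2)])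
  then show "cinner e e' = (if e = e' then 1 else 0)" using F f by (simp add: orthonormal_def)
qed

text \<open>Conjugation by a time-frequency shift permutes the pairs of contractions and orthonormal systems.\<close>

lemma coef_pairing_le:
  fixes S :: "('n::finite) op"
  assumes S: "trace_class S" and V: "contr V" and F: "orthonormal F" "finite F"
  shows "cmod (\<Sum>e\<in>F. coef S e (adj V e) z) \<le> trace_norm S"
proof -
  have bV: "bounded_clinear V" using V by (simp add: contr_def)
  define p where "p = tf_shift (- z :: (real^'n) \<times> (real^'n))"
  have bp: "bounded_clinear p" unfolding p_def by (rule bounded_clinear_tf_shift)
  define V' where "V' f = p (V (adj p f))" for f
  have V': "contr V'"
    unfolding V'_def p_def by (intro contr_compose[OF contr_tf_shift contr_compose[OF V contr_adj[OF contr_tf_shift]]])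
  have "coef S e (adj V e) z = cinner (V' (S (p e))) (p e)" for e
  proof -
    have "coef S e (adj V e) z = cinner (adj p (S (p e))) (adj V e)"
      by (simp add: coef_def p_def[symmetric] cinner_adj_left[OF bp])
    also have "\<dots> = cinner (V (adj p (S (p e)))) e" by (rule cinner_adj_right[OF bV])
    also have "\<dots> = cinner (p (V (adj p (S (p e))))) (p e)" by (simp add: p_def)
    finally show ?thesis by (simp add: V'_def)
  qed
  then have "(\<Sum>e\<in>F. coef S e (adj V e) z) = (\<Sum>e\<in>p ` F. cinner (V' (S e)) e)"
    unfolding p_def by (subst sum.reindex[OF inj_on_tf_shift[OF F(1)]]) simp
  also have "cmod \<dots> \<le> trace_norm S"
    unfolding p_def using F by (intro trace_pairing_le[OF S V'] orthonormal_tf_shift) auto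
  finally show ?thesis .
qed

text \<open>With V moved to the second argument, the pairing is a finite sum of matrix coefficients
  and goes under the integral. There it is bounded by \<open>trace_norm S\<close> uniformly in z,
  and the sharp integral bound leaves exactly the total variation as constant.\<close>

lemma
  fixes S :: "('n::finite) op"
  assumes \<mu>: "bounded_cmeas \<mu>" and S: "trace_class S"
  shows trace_class_module_act: "trace_class (module_act \<mu> S)"
    and trace_norm_module_act: "trace_norm (module_act \<mu> S) \<le> tv_norm \<mu> * trace_norm S"
proof -
  obtain E :: "'n L2 set" where E: "is_onb E" using ex_onb by blast
  have le: "cmod (\<Sum>e\<in>F. cinner (V (module_act \<mu> S e)) e) \<le> tv_norm \<mu> * trace_norm S"
    if V: "contr V" and F: "finite F" "F \<subseteq> E" for V F
  proof -
    have oF: "orthonormal F" using is_onb_orthonormal[OF E] F orthonormal_subset by blast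
    have bV: "bounded_clinear V" using V by (simp add: contr_def)
    have "(\<Sum>e\<in>F. cinner (V (module_act \<mu> S e)) e) = (\<Sum>e\<in>F. cm_integral \<mu> (coef S e (adj V e)))"
      by (simp add: cinner_adj_right[OF bV, symmetric] cinner_module_act[OF \<mu> S])
    also have "\<dots> = cm_integral \<mu> (\<lambda>z. \<Sum>e\<in>F. coef S e (adj V e) z)"
      by (rule cm_integral_sum[OF \<mu> bdd_borel_coef[OF S], symmetric])
    also have "cmod \<dots> \<le> tv_norm \<mu> * trace_norm S"
      by (intro cmod_cm_integral_le[OF \<mu>] bdd_borel_sum bdd_borel_coef[OF S] coef_pairing_le[OF S V oF F(1)])
    finally show ?thesis .
  qed
  note * = trace_class_if_pairing_le[OF bounded_clinear_module_act[OF \<mu> S] E le]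
  show "trace_class (module_act \<mu> S)" by (rule *(1))
  show "trace_norm (module_act \<mu> S) \<le> tv_norm \<mu> * trace_norm S" by (rule *(2))
qed

lemma module_act_dirac:
  assumes S: "trace_class S"
  shows "module_act (dirac z) S = tf_shift z \<circ> S \<circ> adj (tf_shift z)"
proof
  fix u
  show "module_act (dirac z) S u = (tf_shift z \<circ> S \<circ> adj (tf_shift z)) u"
    by (rule cinner_eqI)
      (simp only: cinner_module_act[OF bounded_cmeas_dirac S] cm_integral_dirac[OF bdd_borel_coef[OF S]]
        coef_eq_conj[OF trace_class_bounded_clinear[OF S]])
qed

text \<open>Shifting both vectors by -z translates the coefficient function by z, since the phase
  from composing shifts meets its conjugate. The iterated integral is then the one for the
  convolution.\<close>

lemma module_act_module_act:
  fixes S :: "('n::finite) op"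
  assumes \<mu>: "bounded_cmeas \<mu>" and \<nu>: "bounded_cmeas \<nu>" and S: "trace_class S"
  shows "module_act \<mu> (module_act \<nu> S) = module_act (cm_conv \<mu> \<nu>) S"
proof
  fix u
  note bS = trace_class_bounded_clinear[OF S]
  have shift: "coef S (tf_shift (- z) u) (tf_shift (- z) v) w = coef S u v (z + w)" for u v z w
  proof -
    obtain c where c: "cmod c = 1" "\<And>f. tf_shift (- w) (tf_shift (- z) f) = c *\<^sub>C tf_shift (- w + - z) f"
      using ex_tf_shift_compose[of "- w" "- z"] by blast
    have "- w + - z = - (z + w)" by simp
    then show ?thesis
      by (simp only: coef_def c(2) bounded_clinear_scaleC[OF bS] cinner_scaleC_left cinner_scaleC_right
        unit_phase_cancel[OF c(1)])
  qed
  have "coef (module_act \<nu> S) u v z = cm_integral \<nu> (\<lambda>w. coef S u v (z + w))" for v z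
    unfolding coef_def[of "module_act \<nu> S"] cinner_module_act[OF \<nu> S] shift[symmetric] ..
  then have "coef (module_act \<nu> S) u v = (\<lambda>z. cm_integral \<nu> (\<lambda>w. coef S u v (z + w)))" for v by (rule ext)
  then show "module_act \<mu> (module_act \<nu> S) u = module_act (cm_conv \<mu> \<nu>) S u"
    by (intro cinner_eqI)
      (simp add: cinner_module_act[OF \<mu> trace_class_module_act[OF \<nu> S]]
        cinner_module_act[OF bounded_cmeas_conv[OF \<mu> \<nu>] S] cm_integral_conv[OF \<mu> \<nu> bdd_borel_coef[OF S]])
qed

lemma bilinear_module_act: "bilinear_on M_algebra S1_space S1_space module_act"
  unfolding bilinear_on_def
proof (intro conjI ballI allI)
  fix \<mu> \<mu>' :: "((real^'a) \<times> (real^'a)) cmeas" and S S' :: "'a op" and c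
  assume "\<mu> \<in> car M_algebra" "S \<in> car S1_space"
  then have \<mu>: "bounded_cmeas \<mu>" and S: "trace_class S" by auto
  note b = bdd_borel_coef
  show "module_act \<mu> S \<in> car S1_space" using trace_class_module_act[OF \<mu> S] by simp
  show "module_act (vadd M_algebra \<mu> \<mu>') S = vadd S1_space (module_act \<mu> S) (module_act \<mu>' S)"
    if "\<mu>' \<in> car M_algebra"
  proof -
    have \<mu>': "bounded_cmeas \<mu>'" using that by simp
    show ?thesis unfolding M_algebra_simps S1_space_simps
      by (intro ext cinner_eqI)
        (simp only: cinner_module_act[OF bounded_cmeas_add[OF \<mu> \<mu>'] S] cinner_module_act[OF \<mu> S]
          cinner_module_act[OF \<mu>' S] cinner_add_left cm_integral_add_measure[OF \<mu> \<mu>' b[OF S]])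
  qed
  show "module_act \<mu> (vadd S1_space S S') = vadd S1_space (module_act \<mu> S) (module_act \<mu> S')"
    if "S' \<in> car S1_space"
  proof -
    have S': "trace_class S'" using that by simp
    have "coef (\<lambda>f. S f + S' f) u v = (\<lambda>z. coef S u v z + coef S' u v z)" for u v
      by (simp add: coef_def cinner_add_left fun_eq_iff)
    then show ?thesis unfolding S1_space_simps
      by (intro ext cinner_eqI)
        (simp only: cinner_module_act[OF \<mu> trace_class_add(1)[OF S S']] cinner_module_act[OF \<mu> S]
          cinner_module_act[OF \<mu> S'] cinner_add_left cm_integral_add[OF \<mu> b[OF S] b[OF S']])
  qed
  show "module_act (vscale M_algebra c \<mu>) S = vscale S1_space c (module_act \<mu> S)"
    unfolding M_algebra_simps S1_space_simps
    by (intro ext cinner_eqI)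
      (simp only: cinner_module_act[OF bounded_cmeas_scale[OF \<mu>] S] cinner_module_act[OF \<mu> S]
        cinner_scaleC_left cm_integral_scale_measure[OF \<mu> b[OF S]])
  show "module_act \<mu> (vscale S1_space c S) = vscale S1_space c (module_act \<mu> S)"
  proof -
    have "coef (\<lambda>f. c *\<^sub>C S f) u v = (\<lambda>z. c * coef S u v z)" for u v
      by (simp add: coef_def fun_eq_iff)
    then show ?thesis unfolding S1_space_simps
      by (intro ext cinner_eqI)
        (simp only: cinner_module_act[OF \<mu> trace_class_scaleC_le(1)[OF S]] cinner_module_act[OF \<mu> S]
          cinner_scaleC_left cm_integral_scale)
  qed
qed

lemma cbanach_module_M: "cbanach_module M_algebra S1_space module_act"
proof -
  interpret A: cbanach_algebra M_algebra by (rule cbanach_algebra_M)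
  interpret B: cbanach_space S1_space by (rule cbanach_space_S1)
  show ?thesis
    by unfold_locales
      (simp_all add: bilinear_module_act trace_norm_module_act module_act_module_act)
qed

lemma bilinear_on_L1_if_M:
  assumes "bilinear_on M_algebra B C h" shows "bilinear_on L1_algebra B C h"
  using assms unfolding bilinear_on_def by (simp add: car_L1_algebra)

lemma cbanach_module_L1_if_M:
  assumes "cbanach_module M_algebra S1_space act" shows "cbanach_module L1_algebra S1_space act"
proof -
  interpret M: cbanach_module M_algebra S1_space act by fact
  interpret A: cbanach_algebra L1_algebra by (rule cbanach_algebra_L1)
  show ?thesis
    using M.act_act M.norm_act
    by unfold_locales (simp_all add: bilinear_on_L1_if_M[OF M.act_bilinear] car_L1_algebra)
qed

section \<open>Essentiality\<close>

text \<open>One vector is exchanged at a time.\<close>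

lemma pairing_rank_one_diff_le:
  fixes a b u v :: "('n::finite) L2"
  assumes V: "contr V" and F: "orthonormal F" "finite F"
  shows "cmod (\<Sum>e\<in>F. cinner (V (rank_one a b e - rank_one u v e)) e) \<le> norm (a - u) * norm b + norm u * norm (b - v)"
proof -
  interpret V: bounded_linear V using V by (simp add: contr_def bounded_clinear_bounded_linear)
  have "rank_one a b e - rank_one u v e = rank_one (a - u) b e + rank_one u (b - v) e" for e
    by (simp add: rank_one_def scaleC_diff_right cinner_diff_right scaleC_diff_left)
  then have "(\<Sum>e\<in>F. cinner (V (rank_one a b e - rank_one u v e)) e)
      = (\<Sum>e\<in>F. cinner (V (rank_one (a - u) b e)) e) + (\<Sum>e\<in>F. cinner (V (rank_one u (b - v) e)) e)"
    by (simp add: V.add cinner_add_left sum.distrib)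
  also have "cmod \<dots> \<le> norm (a - u) * norm b + norm u * norm (b - v)"
    by (intro norm_triangle_mono order_trans[OF trace_pairing_le[OF trace_norm_rank_one(1) V F] trace_norm_rank_one(2)])
  finally show ?thesis .
qed

text \<open>Conjugation moves both vectors, so near z = 0 strong continuity keeps the result close
  to the original operator.\<close>

lemma coef_rank_one_eq:
  fixes u v :: "('n::finite) L2"
  shows "coef (rank_one u v) f g z = cinner (rank_one (tf_shift z u) (tf_shift z v) f) g"
proof -
  obtain c where c: "cmod c = 1" "\<And>f. adj (tf_shift z) f = c *\<^sub>C tf_shift (- z) f"
    using ex_adj_tf_shift[of z] by blast
  have "coef (rank_one u v) f g z = cinner (tf_shift z (rank_one u v (adj (tf_shift z) f))) g"
    using coef_eq_conj[OF bounded_clinear_rank_one] by simp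
  also have "\<dots> = cinner (rank_one (tf_shift z u) (tf_shift z v) f) g"
    by (simp add: rank_one_def tf_shift_scaleC cinner_adj_left[OF bounded_clinear_tf_shift])
  finally show ?thesis .
qed

text \<open>Normalised indicators of small balls act as an approximate identity.\<close>

lemma rank_one_approx:
  fixes u v :: "('n::finite) L2"
  assumes e: "e > 0"
  shows "\<exists>\<mu>\<in>car L1_algebra. trace_norm (\<lambda>f. module_act \<mu> (rank_one u v) f - rank_one u v f) \<le> e"
proof -
  let ?R = "rank_one u v"
  \<comment> \<open>Moving each vector by less than e / K changes the pairing by at most e / K *
    (norm u + norm v), which is at most e.\<close>
  define K where "K = norm u + norm v + 1"
  have K: "K > 0" unfolding K_def by (simp add: add_nonneg_pos)
  have eK: "e / K > 0" using e K by simp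
  have "\<exists>r>0. \<forall>z. dist z 0 < r \<longrightarrow> norm (tf_shift z f - f) < e / K" for f :: "'n L2"
  proof -
    have "continuous (at 0) (\<lambda>z. tf_shift z f)"
      using continuous_tf_shift[of f] unfolding continuous_on_eq_continuous_at[OF open_UNIV] by blast
    then show ?thesis
      using eK unfolding continuous_at_eps_delta by (metis dist_norm tf_shift_0)
  qed
  then obtain r1 r2 where r1: "r1 > 0" "\<And>z. dist z 0 < r1 \<Longrightarrow> norm (tf_shift z u - u) < e / K"
    and r2: "r2 > 0" "\<And>z. dist z 0 < r2 \<Longrightarrow> norm (tf_shift z v - v) < e / K"
    by metis
  define r where "r = min r1 r2"
  have r: "r > 0" using r1 r2 by (simp add: r_def)
  define B where "B = (ball 0 r :: ((real^'n) \<times> (real^'n)) set)"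
  define m where "m = measure lborel B"
  have Bm[measurable]: "B \<in> sets borel" by (simp add: B_def)
  have fB: "emeasure lborel B < \<infinity>" unfolding B_def by (rule emeasure_lborel_ball_finite)
  have m: "m > 0" unfolding m_def B_def using r by (simp add: content_ball_pos)
  define g where "g z = complex_of_real (1 / m) * indicator B z" for z
  have iB: "integrable lborel (indicator B :: _ \<Rightarrow> complex)"
    using fB by (intro integrable_indicator_complex) auto
  have g: "integrable lborel g" unfolding g_def by (intro integrable_mult_right iB)
  have ig: "(LINT z|lborel. cmod (g z)) = 1"
  proof -
    have "(LINT z|lborel. cmod (g z)) = (LINT z|lborel. (1 / m) * indicator B z)"
      using m by (intro Bochner_Integration.integral_cong) (auto simp: g_def indicator_def norm_divide)
    also have "\<dots> = 1" using m by (simp add: m_def)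
    finally show ?thesis .
  qed
  have ig': "(LINT z|lborel. g z) = 1"
  proof -
    have "(LINT z|lborel. g z) = (LINT z|lborel. complex_of_real (cmod (g z)))"
      using m by (intro Bochner_Integration.integral_cong) (auto simp: g_def indicator_def norm_divide)
    then show ?thesis using ig by (simp add: integral_complex_of_real)
  qed
  let ?\<mu> = "density_cmeas g"
  have \<mu>: "bounded_cmeas ?\<mu>" by (rule bounded_cmeas_density[OF g])
  have in_L1: "?\<mu> \<in> car L1_algebra" using \<mu> by (simp add: car_L1_algebra density_cmeas_null)
  have R: "trace_class ?R" by (rule trace_norm_rank_one)
  obtain E :: "'n L2 set" where E: "is_onb E" using ex_onb by blast
  have le: "cmod (\<Sum>e\<in>F. cinner (V (module_act ?\<mu> ?R e - ?R e)) e) \<le> e" if V: "contr V" and F: "finite F" "F \<subseteq> E" for V F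
  proof -
    have oF: "orthonormal F" using is_onb_orthonormal[OF E] F orthonormal_subset by blast
    have bV: "bounded_clinear V" using V by (simp add: contr_def)
    interpret V: bounded_linear V using bV by (rule bounded_clinear_bounded_linear)
    define h where "h z = (\<Sum>e\<in>F. coef ?R e (adj V e) z) - (\<Sum>e\<in>F. cinner (V (?R e)) e)" for z
    have hb: "bdd_borel h" unfolding h_def
      by (intro bdd_borel_diff bdd_borel_sum bdd_borel_coef[OF R] bdd_borel_const)
    have hm[measurable]: "h \<in> borel_measurable borel" by (rule bdd_borel_measurable[OF hb])
    have hle: "cmod (h z) \<le> e" if z: "z \<in> B" for z
    proof -
      have dz: "dist z 0 < r1" "dist z 0 < r2" using z by (auto simp: B_def r_def dist_commute)
      have "h z = (\<Sum>e\<in>F. cinner (V (rank_one (tf_shift z u) (tf_shift z v) e - ?R e)) e)"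
        by (simp add: h_def coef_rank_one_eq cinner_adj_right[OF bV] V.diff cinner_diff_left sum_subtractf)
      also have "cmod \<dots> \<le> norm (tf_shift z u - u) * norm (tf_shift z v) + norm u * norm (tf_shift z v - v)"
        by (rule pairing_rank_one_diff_le[OF V oF F(1)])
      also have "\<dots> \<le> e / K * norm v + norm u * (e / K)"
        unfolding norm_tf_shift
        by (intro add_mono mult_left_mono mult_right_mono less_imp_le[OF r1(2)[OF dz(1)]]
          less_imp_le[OF r2(2)[OF dz(2)]] norm_ge_zero)
      also have "\<dots> = e / K * (norm u + norm v)" by (simp add: algebra_simps)
      also have "\<dots> \<le> e / K * K" using eK by (intro mult_left_mono) (auto simp: K_def)
      also have "\<dots> = e" using K by simp
      finally show ?thesis .
    qed
    have "(\<Sum>e\<in>F. cinner (V (module_act ?\<mu> ?R e - ?R e)) e)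
        = (\<Sum>e\<in>F. cm_integral ?\<mu> (coef ?R e (adj V e))) - (\<Sum>e\<in>F. cinner (V (?R e)) e)"
      by (simp add: V.diff cinner_diff_left sum_subtractf cinner_adj_right[OF bV, symmetric] cinner_module_act[OF \<mu> R])
    also have "(\<Sum>e\<in>F. cm_integral ?\<mu> (coef ?R e (adj V e))) = cm_integral ?\<mu> (\<lambda>z. \<Sum>e\<in>F. coef ?R e (adj V e) z)"
      by (rule cm_integral_sum[OF \<mu> bdd_borel_coef[OF R], symmetric])
    \<comment> \<open>As g has integral 1, the constant pairing may be put under the integral. The
      resulting integrand \<open>h\<close> is at most e on \<open>B\<close>, outside which g
      vanishes.\<close>
    also have "(\<Sum>e\<in>F. cinner (V (?R e)) e) = cm_integral ?\<mu> (\<lambda>z. \<Sum>e\<in>F. cinner (V (?R e)) e)"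
      by (simp add: cm_integral_density[OF g bdd_borel_const] ig')
    also have "cm_integral ?\<mu> (\<lambda>z. \<Sum>e\<in>F. coef ?R e (adj V e) z) - cm_integral ?\<mu> (\<lambda>z. \<Sum>e\<in>F. cinner (V (?R e)) e) = cm_integral ?\<mu> h"
      unfolding h_def
      by (rule cm_integral_diff[OF \<mu>, symmetric]) (intro bdd_borel_sum bdd_borel_coef[OF R] bdd_borel_const)+
    also have "\<dots> = (LINT z|lborel. g z * h z)" by (rule cm_integral_density[OF g hb])
    also have "cmod \<dots> \<le> (LINT z|lborel. cmod (g z * h z))" by (rule integral_norm_bound)
    also have "\<dots> \<le> (LINT z|lborel. cmod (g z) * e)"
    proof (rule integral_mono)
      show gh: "cmod (g z * h z) \<le> cmod (g z) * e" for z
      proof (cases "z \<in> B")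
        case True
        then show ?thesis unfolding norm_mult by (intro mult_left_mono hle) auto
      qed (simp add: g_def)
      show ge: "integrable lborel (\<lambda>z. cmod (g z) * e)" using g by auto
      have [measurable]: "g \<in> borel_measurable borel" using borel_measurable_integrable[OF g] by simp
      show "integrable lborel (\<lambda>z. cmod (g z * h z))"
        by (rule Bochner_Integration.integrable_bound[OF ge]) (use gh e in \<open>auto simp: abs_mult\<close>)
    qed
    also have "\<dots> = e" using ig by simp
    finally show ?thesis .
  qed
  have "trace_norm (\<lambda>f. module_act ?\<mu> ?R f - ?R f) \<le> e"
    by (rule trace_class_if_pairing_le(2)[OF bounded_clinear_diff[OF bounded_clinear_module_act[OF \<mu> R] bounded_clinear_rank_one] E le])
  then show ?thesis using in_L1 by blast
qed

lemma vlimI_approx: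
  assumes "\<And>n. trace_norm (\<lambda>f. X n f - T f) \<le> 1 / real (Suc n)" "\<And>n. trace_class (X n)" "trace_class T"
  shows "vlim S1_space X T"
  unfolding vlim_def vdist_S1_space
proof (rule tendsto_sandwich[OF _ _ tendsto_const LIMSEQ_Suc[OF lim_1_over_n]])
  show "\<forall>\<^sub>F n in sequentially. 0 \<le> trace_norm (\<lambda>f. X n f - T f)"
    using trace_norm_nonneg[OF trace_class_diff[OF assms(2,3)]] by simp
qed (use assms(1) in simp)

text \<open>Stated for an arbitrary closed subspace because \<open>closed_span\<close> is an
  intersection of these. Rank one operators are limits of elements of the range, and every trace
  class operator is a limit of finite sums of them.\<close>

lemma mem_closed_subspace_S1:
  fixes W :: "('n::finite) op set"
  assumes W: "closed_subspace S1_space W" and act: "\<And>\<mu> S. \<mu> \<in> car L1_algebra \<Longrightarrow> trace_class S \<Longrightarrow> module_act \<mu> S \<in> W"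
    and T: "trace_class T"
  shows "T \<in> W"
proof -
  have lim: "T \<in> W" if "trace_class T" "\<And>e. e > 0 \<Longrightarrow> \<exists>X\<in>W. trace_norm (\<lambda>f. X f - T f) \<le> e" for T :: "'n op"
  proof -
    have "\<forall>n. \<exists>X. X \<in> W \<and> trace_norm (\<lambda>f. X f - T f) \<le> 1 / real (Suc n)" using that(2) by (simp add: Bex_def)
    from choice[OF this] obtain X where X: "\<And>n. X n \<in> W" "\<And>n. trace_norm (\<lambda>f. X n f - T f) \<le> 1 / real (Suc n)" by blast
    have "trace_class (X n)" for n using X(1) W by (auto simp: closed_subspace_def)
    then have "vlim S1_space X T" by (intro vlimI_approx X that)
    moreover have "range X \<subseteq> W" "T \<in> car S1_space" using X(1) that(1) by auto
    moreover have "\<forall>X. \<forall>l\<in>car S1_space. range X \<subseteq> W \<longrightarrow> vlim S1_space X l \<longrightarrow> l \<in> W"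
      using W unfolding closed_subspace_def by blast
    ultimately show ?thesis by blast
  qed
  have ro: "rank_one u v \<in> W" for u v
  proof (rule lim[OF trace_norm_rank_one(1)])
    fix e :: real assume "e > 0"
    then show "\<exists>X\<in>W. trace_norm (\<lambda>f. X f - rank_one u v f) \<le> e"
      using rank_one_approx[of e u v] act trace_norm_rank_one(1) by blast
  qed
  obtain E :: "'n L2 set" where E: "is_onb E" using ex_onb by blast
  have fin: "(\<lambda>f. \<Sum>e\<in>F. rank_one (T e) e f) \<in> W" for F
  proof (induction F rule: infinite_finite_induct)
    case (insert e F)
    then have "vadd S1_space (rank_one (T e) e) (\<lambda>f. \<Sum>e\<in>F. rank_one (T e) e f) \<in> W"
      using W ro unfolding closed_subspace_def by blast
    then show ?case using insert by simp
  qed (use W in \<open>auto simp: closed_subspace_def\<close>)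
  show ?thesis
  proof (rule lim[OF T])
    fix e :: real assume e: "e > 0"
    obtain F where F: "trace_norm (\<lambda>f. T f - (\<Sum>e\<in>F. rank_one (T e) e f)) < e"
      using trace_norm_finite_rank_approx[OF T E e] by blast
    let ?X = "\<lambda>f. \<Sum>e\<in>F. rank_one (T e) e f"
    have X: "trace_class ?X" using fin[of F] W by (auto simp: closed_subspace_def)
    have "trace_norm (\<lambda>f. ?X f - T f) = trace_norm (\<lambda>f. (-1) *\<^sub>C (T f - ?X f))"
      by (simp add: scaleC_minus1)
    also have "\<dots> = trace_norm (\<lambda>f. T f - ?X f)" using trace_norm_scaleC[OF trace_class_diff[OF T X], of "-1"] by simp
    finally show "\<exists>X\<in>W. trace_norm (\<lambda>f. X f - T f) \<le> e" using F fin[of F] by (intro bexI[of _ ?X]) auto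
  qed
qed

lemma closed_subspace_S1_car: "closed_subspace S1_space (car S1_space)"
  by (auto simp: closed_subspace_def trace_norm_zero trace_class_add trace_class_scaleC_le)

lemma essential_L1:
  "essential_cbanach_module L1_algebra S1_space (module_act :: _ \<Rightarrow> ('n::finite) op \<Rightarrow> 'n op)"
proof -
  interpret cbanach_module L1_algebra S1_space "module_act :: _ \<Rightarrow> 'n op \<Rightarrow> 'n op"
    by (rule cbanach_module_L1_if_M[OF cbanach_module_M])
  show ?thesis
  proof
    let ?X = "{module_act a b |a (b :: 'n op). a \<in> car L1_algebra \<and> b \<in> car S1_space}"
    show "closed_span S1_space ?X = car S1_space"
      unfolding closed_span_def hull_def
    proof (intro equalityI subsetI)
      fix T assume "T \<in> \<Inter> {t. closed_subspace S1_space t \<and> ?X \<subseteq> t}"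
      moreover have "?X \<subseteq> car S1_space" using act_bilinear unfolding bilinear_on_def by blast
      ultimately show "T \<in> car S1_space" using closed_subspace_S1_car by blast
    next
      fix T :: "'n op" assume "T \<in> car S1_space"
      then have T: "trace_class T" by simp
      show "T \<in> \<Inter> {t. closed_subspace S1_space t \<and> ?X \<subseteq> t}"
      proof (rule InterI)
        fix t assume "t \<in> {t. closed_subspace S1_space t \<and> ?X \<subseteq> t}"
        then have t: "closed_subspace S1_space t" "?X \<subseteq> t" by auto
        show "T \<in> t"
          by (rule mem_closed_subspace_S1[OF t(1) subsetD[OF t(2)] T]) auto
      qed
    qed
  qed
qed

section \<open>Uniqueness\<close>

text \<open>The inner action is the competing one: its range is what its own essentiality makes
  total, and nothing relates it to \<open>module_act\<close> beforehand.\<close>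

lemma module_actions_agree_on_range:
  fixes act :: "((real^'n) \<times> (real^'n)) cmeas \<Rightarrow> ('n::finite) op \<Rightarrow> 'n op"
  assumes act: "shift_module_extension act" and \<mu>: "bounded_cmeas \<mu>" and \<nu>: "\<nu> \<in> car L1_algebra" and S: "trace_class S"
  shows "act \<mu> (act \<nu> S) = module_act \<mu> (act \<nu> S)"
proof (intro ext cinner_eqI)
  fix u v :: "'n L2"
  interpret cbanach_module M_algebra S1_space act using act by (simp add: shift_module_extension_def)
  have dir: "act (dirac z) T = tf_shift z \<circ> T \<circ> adj (tf_shift z)" if "trace_class T" for z T
    using act that by (simp add: shift_module_extension_def del: split_paired_All)
  have b\<nu>: "bounded_cmeas \<nu>" using \<nu> by (simp add: car_L1_algebra)
  obtain g where g: "integrable lborel g" "\<nu> = density_cmeas g"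
    using \<nu> density_cmeas_if_null[OF b\<nu>] by (auto simp: car_L1_algebra)
  have cl: "trace_class (act \<rho> R)" if "bounded_cmeas \<rho>" "trace_class R" for \<rho> R
    using act_bilinear that unfolding bilinear_on_def by simp
  have add: "act (\<lambda>B. \<rho> B + \<rho>' B) R = (\<lambda>f. act \<rho> R f + act \<rho>' R f)"
    if "bounded_cmeas \<rho>" "bounded_cmeas \<rho>'" "trace_class R" for \<rho> \<rho>' R
    using act_bilinear that unfolding bilinear_on_def by simp
  have scale: "act (\<lambda>B. c * \<rho> B) R = (\<lambda>f. c *\<^sub>C act \<rho> R f)" if "bounded_cmeas \<rho>" "trace_class R" for c \<rho> R
    using act_bilinear that unfolding bilinear_on_def by simp
  define T where "T = act \<nu> S"
  have T: "trace_class T" unfolding T_def by (rule cl[OF b\<nu> S])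
  show "cinner (act \<mu> (act \<nu> S) u) v = cinner (module_act \<mu> (act \<nu> S) u) v"
    unfolding T_def[symmetric]
  proof (rule ccontr)
    assume ne: "cinner (act \<mu> T u) v \<noteq> cinner (module_act \<mu> T u) v"
    define \<epsilon> where "\<epsilon> = cmod (cinner (act \<mu> T u) v - cinner (module_act \<mu> T u) v)"
    have \<epsilon>: "\<epsilon> > 0" using ne by (simp add: \<epsilon>_def)
    define K where "K = trace_norm S * norm u * norm v + 1"
    have K: "K > 0" unfolding K_def using trace_norm_nonneg[OF S] by (intro add_nonneg_pos) auto
    \<comment> \<open>The two errors will be \<delta> times
      \<open>trace_norm S * norm u * norm v\<close> and \<delta>, in total \<delta> K = \<epsilon> /
      2, which contradicts a gap of \<epsilon>.\<close>
    define \<delta> where "\<delta> = \<epsilon> / (2 * K)"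
    have \<delta>: "\<delta> > 0" using \<epsilon> K by (simp add: \<delta>_def)
    define \<Phi> where "\<Phi> = {\<phi> :: (real^'n) \<times> (real^'n) \<Rightarrow> complex. bdd_borel \<phi> \<and> (\<forall>x. cmod (\<phi> x) \<le> 1)}"
    have \<Phi>D: "bdd_borel \<phi>" "cmod (\<phi> x) \<le> 1" if "\<phi> \<in> \<Phi>" for \<phi> x
      using that unfolding \<Phi>_def by blast+
    \<comment> \<open>One discrete measure has to serve two approximations, so both kinds of
      integrand are put into one family. It is equicontinuous: the coefficient is a single
      continuous function, and all the others share the translation modulus of g.\<close>
    define \<H> where "\<H> = insert (coef T u v) ((\<lambda>\<phi> z. cm_integral \<nu> (\<lambda>y. \<phi> (z + y))) ` \<Phi>)"
    define C where "C = max (trace_norm T * norm u * norm v) (tv_norm \<nu>)"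
    have "\<exists>N z c. \<forall>H\<in>\<H>. cmod (cm_integral \<mu> H - (\<Sum>i<N::nat. c i * H (z i))) \<le> \<delta>"
    proof (rule discretisation[OF \<mu> \<delta>])
      show "bdd_borel H" if "H \<in> \<H>" for H
        using that by (auto simp: \<H>_def \<Phi>D bdd_borel_coef[OF T] bdd_borel_cm_integral_translate[OF b\<nu>])
      show "cmod (H z) \<le> C" if "H \<in> \<H>" for H z
      proof -
        have "cmod (coef T u v z) \<le> C" unfolding C_def using cmod_coef_le[OF T] by (rule max.coboundedI1)
        moreover have "cmod (cm_integral \<nu> (\<lambda>y. \<phi> (z + y))) \<le> C" if "\<phi> \<in> \<Phi>" for \<phi>
        proof -
          have "cmod (cm_integral \<nu> (\<lambda>y. \<phi> (z + y))) \<le> tv_norm \<nu> * 1"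
            by (rule cmod_cm_integral_le[OF b\<nu> bdd_borel_translate[OF \<Phi>D(1)[OF that]] \<Phi>D(2)[OF that]])
          then show ?thesis by (simp add: C_def)
        qed
        ultimately show ?thesis using that by (auto simp: \<H>_def)
      qed
      fix z :: "(real^'n) \<times> (real^'n)" and \<delta>' :: real assume \<delta>': "\<delta>' > 0"
      have "continuous (at z) (coef T u v)"
        using continuous_coef[OF trace_class_bounded_clinear[OF T]]
        unfolding continuous_on_eq_continuous_at[OF open_UNIV] by blast
      then obtain r1 where r1: "r1 > 0" "\<And>w. dist w z < r1 \<Longrightarrow> dist (coef T u v w) (coef T u v z) < \<delta>'"
        using \<delta>' unfolding continuous_at_eps_delta by blast
      obtain r2 where r2: "r2 > 0" "\<And>w. norm w < r2 \<Longrightarrow> translation_modulus g w < \<delta>'"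
        using translation_modulus_small[OF g(1) \<delta>'] by blast
      show "\<exists>r>0. \<forall>w. dist z w < r \<longrightarrow> (\<forall>H\<in>\<H>. cmod (H w - H z) \<le> \<delta>')"
      proof (intro exI[of _ "min r1 r2"] conjI allI impI ballI)
        show "min r1 r2 > 0" using r1 r2 by simp
        fix w H assume w: "dist z w < min r1 r2" and H: "H \<in> \<H>"
        have "cmod (coef T u v w - coef T u v z) \<le> \<delta>'"
          using r1(2)[of w] w by (simp add: dist_norm norm_minus_commute)
        moreover have "cmod (cm_integral \<nu> (\<lambda>y. \<phi> (w + y)) - cm_integral \<nu> (\<lambda>y. \<phi> (z + y))) \<le> \<delta>'"
          if "\<phi> \<in> \<Phi>" for \<phi>
        proof -
          have "cmod (cm_integral \<nu> (\<lambda>y. \<phi> (w + y)) - cm_integral \<nu> (\<lambda>y. \<phi> (z + y))) \<le> translation_modulus g (w - z)"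
            unfolding g(2) by (rule cm_integral_density_translate_diff[OF g(1) \<Phi>D(1)[OF that] \<Phi>D(2)[OF that]])
          also have "\<dots> < \<delta>'" using w by (intro r2(2)) (simp add: dist_norm norm_minus_commute)
          finally show ?thesis by simp
        qed
        ultimately show "cmod (H w - H z) \<le> \<delta>'" using H by (auto simp: \<H>_def)
      qed
    qed
    then obtain N :: nat and z c where approx: "\<And>H. H \<in> \<H> \<Longrightarrow> cmod (cm_integral \<mu> H - (\<Sum>i<N. c i * H (z i))) \<le> \<delta>"
      by blast
    define d where "d M B = (\<Sum>i<M. c i * dirac (z i) B)" for M :: nat and B
    \<comment> \<open>The prescribed values at point masses enter here: with linearity in the
      measure they determine the competing action of \<open>d M\<close> on T.\<close>
    have dS: "bounded_cmeas (d M) \<and> (\<forall>f. bdd_borel f \<longrightarrow> cm_integral (d M) f = (\<Sum>i<M. c i * f (z i))) \<and>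
        cinner (act (d M) T u) v = (\<Sum>i<M. c i * coef T u v (z i))" for M
    proof (induction M)
      case 0
      have "act (d 0) T = (\<lambda>f. 0)"
        using scale[OF bounded_cmeas_zero T, of 0] by (simp add: d_def[abs_def])
      moreover have "bounded_cmeas (\<lambda>B :: ((real^'n) \<times> (real^'n)) set. 0)" by (rule bounded_cmeas_zero)
      ultimately show ?case using cm_integral_scale_measure[of "\<lambda>B :: ((real^'n) \<times> (real^'n)) set. 0" _ 0]
        by (simp add: d_def[abs_def])
    next
      case (Suc M)
      have eq: "d (Suc M) = (\<lambda>B. d M B + c M * dirac (z M) B)" by (simp add: d_def fun_eq_iff)
      note bs = bounded_cmeas_scale[OF bounded_cmeas_dirac, of "c M" "z M"]
      have b: "bounded_cmeas (d M)" using Suc by blast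
      show ?case
      proof (intro conjI allI impI)
        show "bounded_cmeas (d (Suc M))" unfolding eq by (rule bounded_cmeas_add[OF b bs])
        show "cm_integral (d (Suc M)) f = (\<Sum>i<Suc M. c i * f (z i))" if "bdd_borel f" for f
          unfolding eq cm_integral_add_measure[OF b bs that] cm_integral_scale_measure[OF bounded_cmeas_dirac that]
            cm_integral_dirac[OF that] using Suc that by simp
        show "cinner (act (d (Suc M)) T u) v = (\<Sum>i<Suc M. c i * coef T u v (z i))"
          unfolding eq add[OF b bs T] scale[OF bounded_cmeas_dirac T] dir[OF T] cinner_add_left cinner_scaleC_left
            coef_eq_conj[OF trace_class_bounded_clinear[OF T], symmetric] using Suc by simp
      qed
    qed
    then have bd: "bounded_cmeas (d N)" and id: "\<And>f. bdd_borel f \<Longrightarrow> cm_integral (d N) f = (\<Sum>i<N. c i * f (z i))"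
      and cd: "cinner (act (d N) T u) v = (\<Sum>i<N. c i * coef T u v (z i))" by blast+
    have 1: "cmod (cinner (module_act \<mu> T u) v - cinner (act (d N) T u) v) \<le> \<delta>"
      unfolding cd cinner_module_act[OF \<mu> T] by (rule approx) (simp add: \<H>_def)
    note b1 = bounded_cmeas_conv[OF \<mu> b\<nu>] and b2 = bounded_cmeas_conv[OF bd b\<nu>]
    have tv: "tv_norm (\<lambda>B. cm_conv \<mu> \<nu> B - cm_conv (d N) \<nu> B) \<le> \<delta>"
    proof (rule tv_norm_diff_leI[OF b1 b2])
      fix f :: "(real^'n) \<times> (real^'n) \<Rightarrow> complex" and C' assume f: "bdd_borel f" "\<And>x. cmod (f x) \<le> C'"
      have C'0: "0 \<le> C'" using f(2) norm_ge_zero order_trans by blast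
      note t = bdd_borel_cm_integral_translate[OF b\<nu>]
      show "cmod (cm_integral (cm_conv \<mu> \<nu>) f - cm_integral (cm_conv (d N) \<nu>) f) \<le> \<delta> * C'"
      proof (cases "C' = 0")
        case True
        then have "f = (\<lambda>x. 0)" using f(2) by auto
        moreover have "cm_integral \<rho> (\<lambda>x :: (real^'n) \<times> (real^'n). 0) = 0" for \<rho>
          using cm_integral_scale[of \<rho> 0 "\<lambda>x. 0"] by simp
        ultimately show ?thesis using True by simp
      next
        case False
        then have C': "C' > 0" using C'0 by simp
        \<comment> \<open>The family contains test functions bounded by 1 only, so f is rescaled
          into the unit ball; the case C' = 0 was split off for this division.\<close>
        define \<phi> where "\<phi> x = complex_of_real (1 / C') * f x" for x
        have b\<phi>: "bdd_borel \<phi>" unfolding \<phi>_def by (rule bdd_borel_scale[OF f(1)])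
        have "cmod (\<phi> x) \<le> 1" for x using f(2)[of x] C' by (simp add: \<phi>_def norm_mult norm_divide)
        then have "\<phi> \<in> \<Phi>" using b\<phi> unfolding \<Phi>_def by blast
        then have \<phi>: "bdd_borel \<phi>" "(\<lambda>z. cm_integral \<nu> (\<lambda>y. \<phi> (z + y))) \<in> \<H>"
          using b\<phi> unfolding \<H>_def by blast+
        have f\<phi>: "f = (\<lambda>x. complex_of_real C' * \<phi> x)" using C' by (simp add: \<phi>_def fun_eq_iff)
        have "cmod (cm_integral (cm_conv \<mu> \<nu>) \<phi> - cm_integral (cm_conv (d N) \<nu>) \<phi>) \<le> \<delta>"
          unfolding cm_integral_conv[OF \<mu> b\<nu> \<phi>(1)] cm_integral_conv[OF bd b\<nu> \<phi>(1)] id[OF t[OF \<phi>(1)]]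
          by (rule approx[OF \<phi>(2)])
        then have "C' * cmod (cm_integral (cm_conv \<mu> \<nu>) \<phi> - cm_integral (cm_conv (d N) \<nu>) \<phi>) \<le> C' * \<delta>"
          using C' by (intro mult_left_mono) auto
        moreover have "cm_integral (cm_conv \<mu> \<nu>) f - cm_integral (cm_conv (d N) \<nu>) f
            = complex_of_real C' * (cm_integral (cm_conv \<mu> \<nu>) \<phi> - cm_integral (cm_conv (d N) \<nu>) \<phi>)"
          by (subst (1 2) f\<phi>) (simp only: cm_integral_scale right_diff_distrib)
        ultimately show ?thesis using C' by (simp add: norm_mult mult.commute)
      qed
    qed
    \<comment> \<open>The module law moves the comparison from T to S, where the acting measures are
      close in total variation and the norm inequality of the competing action applies.\<close>
    have "act \<mu> T = act (cm_conv \<mu> \<nu>) S" "act (d N) T = act (cm_conv (d N) \<nu>) S"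
      unfolding T_def using act_act[of \<mu> \<nu> S] act_act[of "d N" \<nu> S] \<mu> b\<nu> bd S by simp_all
    moreover have "act (\<lambda>B. cm_conv \<mu> \<nu> B - cm_conv (d N) \<nu> B) S = (\<lambda>f. act (cm_conv \<mu> \<nu>) S f - act (cm_conv (d N) \<nu>) S f)"
      using add[OF b1 bounded_cmeas_scale[OF b2, of "-1"] S] scale[OF b2 S, of "-1"] by (simp add: scaleC_minus1)
    ultimately have "cmod (cinner (act \<mu> T u) v - cinner (act (d N) T u) v)
        = cmod (cinner (act (\<lambda>B. cm_conv \<mu> \<nu> B - cm_conv (d N) \<nu> B) S u) v)" by (simp add: cinner_diff_left)
    also have "\<dots> \<le> trace_norm (act (\<lambda>B. cm_conv \<mu> \<nu> B - cm_conv (d N) \<nu> B) S) * norm u * norm v"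
      by (rule norm_cinner_le_trace_norm[OF cl[OF bounded_cmeas_diff[OF b1 b2] S]])
    also have "\<dots> \<le> (\<delta> * trace_norm S) * norm u * norm v"
    proof (intro mult_right_mono)
      have "trace_norm (act (\<lambda>B. cm_conv \<mu> \<nu> B - cm_conv (d N) \<nu> B) S)
          \<le> tv_norm (\<lambda>B. cm_conv \<mu> \<nu> B - cm_conv (d N) \<nu> B) * trace_norm S"
        using norm_act[of "\<lambda>B. cm_conv \<mu> \<nu> B - cm_conv (d N) \<nu> B" S] bounded_cmeas_diff[OF b1 b2] S by simp
      also have "\<dots> \<le> \<delta> * trace_norm S" by (rule mult_right_mono[OF tv trace_norm_nonneg[OF S]])
      finally show "trace_norm (act (\<lambda>B. cm_conv \<mu> \<nu> B - cm_conv (d N) \<nu> B) S) \<le> \<delta> * trace_norm S" .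
    qed auto
    finally have 2: "cmod (cinner (act \<mu> T u) v - cinner (act (d N) T u) v) \<le> \<delta> * (trace_norm S * norm u * norm v)"
      by (simp add: mult.assoc)
    have "\<epsilon> \<le> \<delta> * (trace_norm S * norm u * norm v) + \<delta>"
      using norm_triangle_ineq4[of "cinner (act \<mu> T u) v - cinner (act (d N) T u) v"
          "cinner (module_act \<mu> T u) v - cinner (act (d N) T u) v"] 1 2 by (simp add: \<epsilon>_def)
    also have "\<dots> = \<delta> * K" by (simp add: K_def distrib_left)
    also have "\<dots> = \<epsilon> / 2" using K by (simp add: \<delta>_def)
    finally show False using \<epsilon> by simp
  qed
qed

text \<open>The operators on which \<mu> acts the same way in both structures form a closed
  subspace: both actions are bounded in trace norm, and comparing the limits at each vector is
  enough.\<close>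

lemma module_action_unique:
  fixes act :: "((real^'n) \<times> (real^'n)) cmeas \<Rightarrow> ('n::finite) op \<Rightarrow> 'n op"
  assumes act: "shift_module_extension act" and ess: "essential_cbanach_module L1_algebra S1_space act"
    and \<mu>: "bounded_cmeas \<mu>" and S: "trace_class S"
  shows "act \<mu> S = module_act \<mu> S"
proof -
  interpret cbanach_module M_algebra S1_space act using act by (simp add: shift_module_extension_def)
  have bil: "bilinear_on M_algebra S1_space S1_space act" by (rule act_bilinear)
  have nrm: "trace_norm (act \<mu> T) \<le> tv_norm \<mu> * trace_norm T" if "trace_class T" for T
    using norm_act[of \<mu> T] \<mu> that by simp
  let ?W = "{T. trace_class T \<and> act \<mu> T = module_act \<mu> T}"
  note bil' = bilinear_module_act[where 'a = 'n]
  have "closed_subspace S1_space ?W"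
    unfolding closed_subspace_def
  proof (intro conjI ballI allI impI)
    have add: "act \<mu> (\<lambda>f. A f + B f) = (\<lambda>f. act \<mu> A f + act \<mu> B f)"
      "module_act \<mu> (\<lambda>f. A f + B f) = (\<lambda>f. module_act \<mu> A f + module_act \<mu> B f)"
      if "trace_class A" "trace_class B" for A B
      using bil bil' \<mu> that unfolding bilinear_on_def by simp_all
    have scale: "act \<mu> (\<lambda>f. c *\<^sub>C A f) = (\<lambda>f. c *\<^sub>C act \<mu> A f)"
      "module_act \<mu> (\<lambda>f. c *\<^sub>C A f) = (\<lambda>f. c *\<^sub>C module_act \<mu> A f)" if "trace_class A" for A c
      using bil bil' \<mu> that unfolding bilinear_on_def by simp_all
    show "?W \<subseteq> car S1_space" by auto
    show "vzero S1_space \<in> ?W" using scale[OF trace_norm_zero(1), of 0] trace_norm_zero by simp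
    show "vadd S1_space A B \<in> ?W" if "A \<in> ?W" "B \<in> ?W" for A B
      using that by (simp add: add trace_class_add)
    show "vscale S1_space c A \<in> ?W" if "A \<in> ?W" for c A
      using that by (simp add: scale trace_class_scaleC_le)
    fix X :: "nat \<Rightarrow> 'n op" and l
    assume l: "l \<in> car S1_space" and X: "range X \<subseteq> ?W" and lim: "vlim S1_space X l"
    have tl: "trace_class l" using l by simp
    have tX: "trace_class (X n)" and eX: "act \<mu> (X n) = module_act \<mu> (X n)" for n using X by auto
    have td: "trace_class (\<lambda>f. X n f - l f)" for n by (rule trace_class_diff[OF tX tl])
    have diff: "h (\<lambda>f. X n f - l f) = (\<lambda>f. h (X n) f - h l f)"
      if "h = act \<mu> \<or> h = module_act \<mu>" for h n
    proof -
      have "h (\<lambda>f. X n f + (-1) *\<^sub>C l f) = (\<lambda>f. h (X n) f + (-1) *\<^sub>C h l f)"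
        using that add[OF tX trace_class_scaleC_le(1)[OF tl]] scale[OF tl] by auto
      then show ?thesis by (simp add: scaleC_minus1)
    qed
    have conv: "(\<lambda>n. h (X n) u) \<longlonglongrightarrow> h l u"
      if h: "h = act \<mu> \<or> h = module_act \<mu>" for h u
    proof -
      have le: "norm (h (X n) u - h l u) \<le> (tv_norm \<mu> * trace_norm (\<lambda>f. X n f - l f)) * norm u" for n
      proof -
        have tc: "trace_class (h (\<lambda>f. X n f - l f))"
          using h bil bil' \<mu> td[of n] unfolding bilinear_on_def by auto
        have "norm (h (X n) u - h l u) \<le> trace_norm (h (\<lambda>f. X n f - l f)) * norm u"
          using norm_le_trace_norm[OF tc, of u] by (simp add: diff[OF h])
        also have "\<dots> \<le> (tv_norm \<mu> * trace_norm (\<lambda>f. X n f - l f)) * norm u"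
          using h nrm[OF td] trace_norm_module_act[OF \<mu> td] by (intro mult_right_mono) auto
        finally show ?thesis .
      qed
      have lm: "(\<lambda>n. (tv_norm \<mu> * trace_norm (\<lambda>f. X n f - l f)) * norm u) \<longlonglongrightarrow> (tv_norm \<mu> * 0) * norm u"
        using lim unfolding vlim_def vdist_S1_space by (intro tendsto_mult tendsto_const)
      have "(\<lambda>n. norm (h (X n) u - h l u)) \<longlonglongrightarrow> 0"
      proof (rule tendsto_sandwich[OF _ _ tendsto_const])
        show "(\<lambda>n. (tv_norm \<mu> * trace_norm (\<lambda>f. X n f - l f)) * norm u) \<longlonglongrightarrow> 0" using lm by simp
      qed (simp_all add: le)
      then show ?thesis by (rule LIM_zero_cancel[OF tendsto_norm_zero_cancel])
    qed
    have "act \<mu> l u = module_act \<mu> l u" for u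
      using LIMSEQ_unique[OF conv[of "act \<mu>" u]] conv[of "module_act \<mu>" u] eX by simp
    then show "l \<in> ?W" using tl by (simp add: fun_eq_iff)
  qed
  \<comment> \<open>This is the range of the competing action, hence it is the essentiality of
    \<open>act\<close>, not that of \<open>module_act\<close>, which concludes.\<close>
  moreover have "{act a b |a b. a \<in> car L1_algebra \<and> b \<in> car S1_space} \<subseteq> ?W"
    using module_actions_agree_on_range[OF act \<mu>] bil by (auto simp: bilinear_on_def car_L1_algebra)
  ultimately have "closed_span S1_space {act a b |a b. a \<in> car L1_algebra \<and> b \<in> car S1_space} \<subseteq> ?W"
    unfolding closed_span_def by (intro hull_minimal)
  then show ?thesis using essential_cbanach_module.essential[OF ess] S by auto
qed

theorem corollary3p2:
  shows "\<exists>act :: ((real^'n) \<times> (real^'n)) cmeas \<Rightarrow> ('n::finite) op \<Rightarrow> 'n op.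
    shift_module_extension act \<and> essential_cbanach_module L1_algebra S1_space act \<and>
    (\<forall>act'. shift_module_extension act' \<and> essential_cbanach_module L1_algebra S1_space act' \<longrightarrow>
       (\<forall>\<mu>\<in>car M_algebra. \<forall>S\<in>car S1_space. act' \<mu> S = act \<mu> S))"
proof (intro exI[of _ module_act] conjI allI impI ballI)
  show "shift_module_extension (module_act :: ((real^'n) \<times> (real^'n)) cmeas \<Rightarrow> ('n::finite) op \<Rightarrow> 'n op)"
    unfolding shift_module_extension_def
    using cbanach_module_M by (simp add: module_act_dirac trace_norm_module_act)
  show "essential_cbanach_module L1_algebra S1_space (module_act :: ((real^'n) \<times> (real^'n)) cmeas \<Rightarrow> ('n::finite) op \<Rightarrow> 'n op)"
    by (rule essential_L1)
qed (auto intro: module_action_unique)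

end
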